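(* Let $L$ be a regular Lagrangian on a Lie algebroid $E$ and $\mathcal{S}$ the canonical semispray induced by $L$. If $X\in\Gamma(\mathcal{T}E\setminus\{0\})$ is a Cartan symmetry of $L$, then $X$ is a dynamical symmetry of $\mathcal{S}$, i.e. $[\mathcal{S},X]_{\mathcal{T}E}=0$.
   Context: Lie algebroid: $\pi:E\to M$ is a vector bundle of rank $m$ over a smooth manifold $M$ of dimension $n$, with a Lie bracket $[\cdot,\cdot]_E$ on $\Gamma(E)$ and a bundle map (anchor) $\sigma:E\to TM$ inducing a Lie algebra homomorphism $\Gamma(E)\to\mathfrak{X}(M)$ with $[s_1,fs_2]_E=f[s_1,s_2]_E+(\sigma(s_1)f)s_2$. In local coordinates $x^i$ and a local basis $\{s_\alpha\}$ of sections (with induced coordinates $(x^i,y^\alpha)$ on $E$), $\sigma(s_\alpha)=\sigma_\alpha^i\,\partial/\partial x^i$, $[s_\alpha,s_\beta]_E=L_{\alpha\beta}^\gamma s_\gamma$; repeated indices are summed. The prolongation $\mathcal{T}E\to E$ has fibre $\mathcal{T}_wE=\{(u,v)\in E_{\pi(w)}\times T_wE:\sigma(u)=T_w\pi(v)\}$ at $w\in E$. It is a Lie algebroid over $E$ with anchor $\sigma^1(u,v)=v$, local basis $\mathcal{X}_\alpha(w)=(s_\alpha(\pi(w)),\sigma_\alpha^i\partial/\partial x^i|_w)$, $\mathcal{V}_\alpha(w)=(0,\partial/\partial y^\alpha|_w)$ with dual basis $\{\mathcal{X}^\alpha,\mathcal{V}^\alpha\}$, and bracket determined by $[\mathcal{X}_\alpha,\mathcal{X}_\beta]_{\mathcal{T}E}=L_{\alpha\beta}^\gamma\mathcal{X}_\gamma$,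 $[\mathcal{X}_\alpha,\mathcal{V}_\beta]_{\mathcal{T}E}=0$, $[\mathcal{V}_\alpha,\mathcal{V}_\beta]_{\mathcal{T}E}=0$. $\Gamma(\mathcal{T}E\setminus\{0\})$ denotes the sections of $\mathcal{T}E$ over $E\setminus\{0\}$ ($E$ without zero section). $J$ is the $(1,1)$-tensor with $J\mathcal{X}_\alpha=\mathcal{V}_\alpha$, $J\mathcal{V}_\alpha=0$; $\mathbb{C}=y^\alpha\mathcal{V}_\alpha$ is the Euler section; a semispray is a section $\mathcal{S}$ of $\mathcal{T}E$ with $J\mathcal{S}=\mathbb{C}$. $d^E$ denotes the exterior derivative of the Lie algebroid $\mathcal{T}E$: $d^Ef(X)=\sigma^1(X)f$, $d^E\theta(X,Y)=\sigma^1(X)\theta(Y)-\sigma^1(Y)\theta(X)-\theta([X,Y]_{\mathcal{T}E})$, and so on in higher degree; $\mathcal{L}_X=i_X\circ d^E+d^E\circ i_X$ on forms; $X(f)=\sigma^1(X)f$. A smooth $L:E\to\mathbb{R}$ is a regular Lagrangian if the matrix $g_{\alpha\beta}=\partial^2L/\partial y^\alpha\partial y^\beta$ has rank $m$ everywhere. $\theta_L=\frac{\partial L}{\partial y^\alpha}\mathcal{X}^\alpha$ is the Cartan 1-section, $\omega_L=d^E\theta_L$ the Cartan 2-section (a symplectic, i.e. closed nondegenerate, section), $E_L=\mathbb{C}(L)-L$ the energy, and the canonical semispray $\mathcal{S}$ is the unique section with $i_{\mathcal{S}}\omega_L=-d^EE_L$. $X$ is a Cartan symmetry of $L$ if $\mathcal{L}_X\omega_L=0$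 and $\mathcal{L}_XE_L=0$. *)

theory Defs
  imports "HOL-Analysis.Analysis" "Jordan_Normal_Form.DL_Rank"
begin

text \<open>The model space is \<^const>\<open>Euclidean_space\<close>: sequences of reals that vanish from index \<open>n\<close> on.
  Dimensions are natural numbers, so dimension and rank 0 are included.\<close>

definition pd :: "nat \<Rightarrow> ((nat \<Rightarrow> real) \<Rightarrow> real) \<Rightarrow> (nat \<Rightarrow> real) \<Rightarrow> real" where
  "pd i f x = deriv (\<lambda>t. f (x(i := t))) (x i)"

primrec Ck_on :: "nat \<Rightarrow> nat \<Rightarrow> (nat \<Rightarrow> real) set \<Rightarrow> ((nat \<Rightarrow> real) \<Rightarrow> real) \<Rightarrow> bool" where
  "Ck_on 0 n V f \<longleftrightarrow> continuous_map (subtopology (Euclidean_space n) V) euclideanreal f"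
| "Ck_on (Suc k) n V f \<longleftrightarrow>
     continuous_map (subtopology (Euclidean_space n) V) euclideanreal f \<and>
     (\<forall>i<n. (\<forall>x\<in>V. (\<lambda>t. f (x(i := t))) field_differentiable (at (x i))) \<and> Ck_on k n V (pd i f))"

definition smooth_real_on :: "nat \<Rightarrow> (nat \<Rightarrow> real) set \<Rightarrow> ((nat \<Rightarrow> real) \<Rightarrow> real) \<Rightarrow> bool" where
  "smooth_real_on n V f \<longleftrightarrow> (\<forall>k. Ck_on k n V f)"

type_synonym 'a chart = "'a set \<times> ('a \<Rightarrow> nat \<Rightarrow> real)"

record 'a manifold =
  mtop :: "'a topology"
  mdim :: nat
  matlas :: "'a chart set"

abbreviation mpoints :: "'a manifold \<Rightarrow> 'a set" where
  "mpoints M \<equiv> topspace (mtop M)"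

definition in_chart :: "'a chart \<Rightarrow> ('a \<Rightarrow> real) \<Rightarrow> (nat \<Rightarrow> real) \<Rightarrow> real" where
  "in_chart c f x = f (inv_into (fst c) (snd c) x)"

definition is_chart :: "'a manifold \<Rightarrow> 'a chart \<Rightarrow> bool" where
  "is_chart M c \<longleftrightarrow>
     openin (mtop M) (fst c) \<and>
     openin (Euclidean_space (mdim M)) (snd c ` fst c) \<and>
     homeomorphic_map (subtopology (mtop M) (fst c))
       (subtopology (Euclidean_space (mdim M)) (snd c ` fst c)) (snd c)"

definition smooth_transition :: "nat \<Rightarrow> 'a chart \<Rightarrow> 'a chart \<Rightarrow> bool" where
  "smooth_transition n c d \<longleftrightarrow>
     (\<forall>i<n. smooth_real_on n (snd c ` (fst c \<inter> fst d)) (in_chart c (\<lambda>p. snd d p i)))"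

definition max_atlas :: "'a manifold \<Rightarrow> 'a chart set" where
  "max_atlas M = {c. is_chart M c \<and>
     (\<forall>d\<in>matlas M. smooth_transition (mdim M) c d \<and> smooth_transition (mdim M) d c)}"

definition smooth_manifold :: "'a manifold \<Rightarrow> bool" where
  "smooth_manifold M \<longleftrightarrow>
     Hausdorff_space (mtop M) \<and> second_countable (mtop M) \<and>
     matlas M \<subseteq> max_atlas M \<and> \<Union> (fst ` matlas M) = mpoints M"

definition smooth_fun_on :: "'a manifold \<Rightarrow> 'a set \<Rightarrow> ('a \<Rightarrow> real) \<Rightarrow> bool" where
  "smooth_fun_on M W f \<longleftrightarrow>
     (\<forall>c\<in>matlas M. smooth_real_on (mdim M) (snd c ` (fst c \<inter> W)) (in_chart c f))"

definition smooth_near :: "'a manifold \<Rightarrow> 'a \<Rightarrow> ('a \<Rightarrow> real) \<Rightarrow> bool" where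
  "smooth_near M p f \<longleftrightarrow> (\<exists>W. openin (mtop M) W \<and> p \<in> W \<and> smooth_fun_on M W f)"

definition coord_deriv :: "'a chart \<Rightarrow> nat \<Rightarrow> ('a \<Rightarrow> real) \<Rightarrow> 'a \<Rightarrow> real" where
  "coord_deriv c i f p = pd i (in_chart c f) (snd c p)"

text \<open>A tangent vector at \<open>p\<close> is a derivation \<open>a\<^sup>i \<partial>/\<partial>x\<^sup>i\<close> on the functions that are smooth near \<open>p\<close>.  It is
  made total by the value 0 on all other functions, so that equal derivations are equal as functions.\<close>

definition tvec :: "'a manifold \<Rightarrow> 'a chart \<Rightarrow> 'a \<Rightarrow> (nat \<Rightarrow> real) \<Rightarrow> ('a \<Rightarrow> real) \<Rightarrow> real" where
  "tvec M c p a = (\<lambda>f. if smooth_near M p f then \<Sum>i<mdim M. a i * coord_deriv c i f p else 0)"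

definition tangent_space :: "'a manifold \<Rightarrow> 'a \<Rightarrow> (('a \<Rightarrow> real) \<Rightarrow> real) set" where
  "tangent_space M p = {v. \<exists>c\<in>max_atlas M. p \<in> fst c \<and> (\<exists>a. v = tvec M c p a)}"

definition vf_bracket ::
  "'a manifold \<Rightarrow> ('a \<Rightarrow> ('a \<Rightarrow> real) \<Rightarrow> real) \<Rightarrow> ('a \<Rightarrow> ('a \<Rightarrow> real) \<Rightarrow> real) \<Rightarrow> 'a \<Rightarrow> ('a \<Rightarrow> real) \<Rightarrow> real"
where
  "vf_bracket M V W p =
     (\<lambda>f. if smooth_near M p f then V p (\<lambda>q. W q f) - W p (\<lambda>q. V q f) else 0)"

record ('a, 'e) vbundle =
  base :: "'a manifold"
  total :: "'e manifold"
  proj :: "'e \<Rightarrow> 'a"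
  fadd :: "'e \<Rightarrow> 'e \<Rightarrow> 'e"
  fscale :: "real \<Rightarrow> 'e \<Rightarrow> 'e"
  rk :: nat

text \<open>Coordinates on an open set of the base together with a local basis of sections over it.  The
  basis is encoded by the fibre coordinates \<open>bfib\<close> that it induces.\<close>

record ('a, 'e) bchart =
  bdom :: "'a set"
  bcoord :: "'a \<Rightarrow> nat \<Rightarrow> real"
  bfib :: "'e \<Rightarrow> nat \<Rightarrow> real"

definition fibre :: "('a, 'e, 'z) vbundle_scheme \<Rightarrow> 'a \<Rightarrow> 'e set" where
  "fibre E p = {w \<in> mpoints (total E). proj E w = p}"

definition base_chart :: "('a, 'e) bchart \<Rightarrow> 'a chart" where
  "base_chart b = (bdom b, bcoord b)"

definition induced_chart :: "('a, 'e, 'z) vbundle_scheme \<Rightarrow> ('a, 'e) bchart \<Rightarrow> 'e chart" where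
  "induced_chart E b =
     ({w \<in> mpoints (total E). proj E w \<in> bdom b},
      \<lambda>w i. if i < mdim (base E) then bcoord b (proj E w) i else bfib b w (i - mdim (base E)))"

definition is_bchart :: "('a, 'e, 'z) vbundle_scheme \<Rightarrow> ('a, 'e) bchart \<Rightarrow> bool" where
  "is_bchart E b \<longleftrightarrow>
     base_chart b \<in> max_atlas (base E) \<and>
     induced_chart E b \<in> max_atlas (total E) \<and>
     (\<forall>p\<in>bdom b.
        bij_betw (bfib b) (fibre E p) (topspace (Euclidean_space (rk E))) \<and>
        (\<forall>u\<in>fibre E p. \<forall>v\<in>fibre E p. bfib b (fadd E u v) = (\<lambda>\<alpha>. bfib b u \<alpha> + bfib b v \<alpha>)) \<and>
        (\<forall>r. \<forall>u\<in>fibre E p. bfib b (fscale E r u) = (\<lambda>\<alpha>. r * bfib b u \<alpha>)))"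

text \<open>The vector space axioms on the fibres, and smoothness of the projection, follow from the
  existence of the fibrewise linear bijections in \<open>is_bchart\<close>.\<close>

definition vector_bundle :: "('a, 'e, 'z) vbundle_scheme \<Rightarrow> bool" where
  "vector_bundle E \<longleftrightarrow>
     smooth_manifold (base E) \<and> smooth_manifold (total E) \<and>
     mdim (total E) = mdim (base E) + rk E \<and>
     proj E ` mpoints (total E) \<subseteq> mpoints (base E) \<and>
     (\<forall>p\<in>mpoints (base E).
        (\<forall>u\<in>fibre E p. \<forall>v\<in>fibre E p. fadd E u v \<in> fibre E p) \<and>
        (\<forall>r. \<forall>u\<in>fibre E p. fscale E r u \<in> fibre E p) \<and>
        (\<exists>b. is_bchart E b \<and> p \<in> bdom b))"

text \<open>\<open>0 \<cdot> w\<close> is the zero vector of the fibre through \<open>w\<close>.\<close>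

definition fzero_of :: "('a, 'e, 'z) vbundle_scheme \<Rightarrow> 'e \<Rightarrow> 'e" where
  "fzero_of E w = fscale E 0 w"

definition slit :: "('a, 'e, 'z) vbundle_scheme \<Rightarrow> 'e set" where
  "slit E = {w \<in> mpoints (total E). w \<noteq> fzero_of E w}"

definition lincomb_at ::
  "('a, 'e, 'z) vbundle_scheme \<Rightarrow> ('a, 'e) bchart \<Rightarrow> 'a \<Rightarrow> (nat \<Rightarrow> real) \<Rightarrow> 'e" where
  "lincomb_at E b p a = inv_into (fibre E p) (bfib b) (\<lambda>\<alpha>. if \<alpha> < rk E then a \<alpha> else 0)"

definition basis_section :: "('a, 'e, 'z) vbundle_scheme \<Rightarrow> ('a, 'e) bchart \<Rightarrow> nat \<Rightarrow> 'a \<Rightarrow> 'e" where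
  "basis_section E b \<alpha> p = lincomb_at E b p (\<lambda>\<beta>. if \<beta> = \<alpha> then 1 else 0)"

definition smooth_section_on :: "('a, 'e, 'z) vbundle_scheme \<Rightarrow> 'a set \<Rightarrow> ('a \<Rightarrow> 'e) \<Rightarrow> bool" where
  "smooth_section_on E W s \<longleftrightarrow>
     (\<forall>p\<in>W. s p \<in> fibre E p) \<and>
     (\<forall>b. is_bchart E b \<longrightarrow>
        (\<forall>\<alpha><rk E. smooth_fun_on (base E) (W \<inter> bdom b) (\<lambda>p. bfib b (s p) \<alpha>)))"

definition sections :: "('a, 'e, 'z) vbundle_scheme \<Rightarrow> ('a \<Rightarrow> 'e) set" where
  "sections E = {s \<in> extensional (mpoints (base E)). smooth_section_on E (mpoints (base E)) s}"

definition sec_add ::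
  "('a, 'e, 'z) vbundle_scheme \<Rightarrow> ('a \<Rightarrow> 'e) \<Rightarrow> ('a \<Rightarrow> 'e) \<Rightarrow> 'a \<Rightarrow> 'e" where
  "sec_add E s t = (\<lambda>p\<in>mpoints (base E). fadd E (s p) (t p))"

definition sec_scale ::
  "('a, 'e, 'z) vbundle_scheme \<Rightarrow> ('a \<Rightarrow> real) \<Rightarrow> ('a \<Rightarrow> 'e) \<Rightarrow> 'a \<Rightarrow> 'e" where
  "sec_scale E f s = (\<lambda>p\<in>mpoints (base E). fscale E (f p) (s p))"

record ('a, 'e) algebroid = "('a, 'e) vbundle" +
  anchor :: "'e \<Rightarrow> ('a \<Rightarrow> real) \<Rightarrow> real"
  brk :: "('a \<Rightarrow> 'e) \<Rightarrow> ('a \<Rightarrow> 'e) \<Rightarrow> 'a \<Rightarrow> 'e"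

text \<open>The coefficient \<open>\<sigma>\<^sub>\<alpha>\<^sup>i\<close>, obtained by applying the derivation \<open>\<sigma>(s\<^sub>\<alpha>)\<close> to the coordinate \<open>x\<^sup>i\<close>.\<close>

definition anchor_coeff ::
  "('a, 'e, 'z) algebroid_scheme \<Rightarrow> ('a, 'e) bchart \<Rightarrow> nat \<Rightarrow> nat \<Rightarrow> 'a \<Rightarrow> real" where
  "anchor_coeff E b \<alpha> i p = anchor E (basis_section E b \<alpha> p) (\<lambda>q. bcoord b q i)"

definition anchor_bundle_map :: "('a, 'e, 'z) algebroid_scheme \<Rightarrow> bool" where
  "anchor_bundle_map E \<longleftrightarrow>
     (\<forall>p\<in>mpoints (base E).
        (\<forall>u\<in>fibre E p. anchor E u \<in> tangent_space (base E) p) \<and>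
        (\<forall>u\<in>fibre E p. \<forall>v\<in>fibre E p. anchor E (fadd E u v) = (\<lambda>f. anchor E u f + anchor E v f)) \<and>
        (\<forall>r. \<forall>u\<in>fibre E p. anchor E (fscale E r u) = (\<lambda>f. r * anchor E u f))) \<and>
     (\<forall>b. is_bchart E b \<longrightarrow> (\<forall>\<alpha><rk E. \<forall>i<mdim (base E).
        smooth_fun_on (base E) (bdom b) (anchor_coeff E b \<alpha> i)))"

definition lie_bracket_on_sections :: "('a, 'e, 'z) algebroid_scheme \<Rightarrow> bool" where
  "lie_bracket_on_sections E \<longleftrightarrow>
     (\<forall>s\<in>sections E. \<forall>t\<in>sections E. brk E s t \<in> sections E) \<and>
     (\<forall>s\<in>sections E. \<forall>s'\<in>sections E. \<forall>t\<in>sections E.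
        brk E (sec_add E s s') t = sec_add E (brk E s t) (brk E s' t)) \<and>
     (\<forall>r. \<forall>s\<in>sections E. \<forall>t\<in>sections E.
        brk E (sec_scale E (\<lambda>_. r) s) t = sec_scale E (\<lambda>_. r) (brk E s t)) \<and>
     (\<forall>s\<in>sections E. \<forall>t\<in>sections E. brk E s t = sec_scale E (\<lambda>_. -1) (brk E t s)) \<and>
     (\<forall>r\<in>sections E. \<forall>s\<in>sections E. \<forall>t\<in>sections E.
        sec_add E (brk E r (brk E s t)) (sec_add E (brk E s (brk E t r)) (brk E t (brk E r s)))
        = sec_scale E (\<lambda>_. 0) r)"

definition lie_algebroid :: "('a, 'e, 'z) algebroid_scheme \<Rightarrow> bool" where
  "lie_algebroid E \<longleftrightarrow>
     vector_bundle E \<and> anchor_bundle_map E \<and> lie_bracket_on_sections E \<and>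
     (\<forall>s\<in>sections E. \<forall>t\<in>sections E. \<forall>p\<in>mpoints (base E).
        anchor E (brk E s t p) =
          vf_bracket (base E) (\<lambda>q. anchor E (s q)) (\<lambda>q. anchor E (t q)) p) \<and>
     (\<forall>s\<in>sections E. \<forall>t\<in>sections E. \<forall>f. smooth_fun_on (base E) (mpoints (base E)) f \<longrightarrow>
        brk E s (sec_scale E f t) =
          sec_add E (sec_scale E f (brk E s t)) (sec_scale E (\<lambda>p. anchor E (s p) f) t))"

text \<open>A Lie algebroid bracket is local, so it extends to sections that are only defined near a point:
  replace them by global sections with the same germs.\<close>

definition local_brk ::
  "('a, 'e, 'z) algebroid_scheme \<Rightarrow> ('a \<Rightarrow> 'e) \<Rightarrow> ('a \<Rightarrow> 'e) \<Rightarrow> 'a \<Rightarrow> 'e" where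
  "local_brk E s t p = (SOME u. \<exists>s'\<in>sections E. \<exists>t'\<in>sections E.
     (\<exists>W. openin (mtop (base E)) W \<and> p \<in> W \<and> (\<forall>q\<in>W. s' q = s q \<and> t' q = t q)) \<and>
     u = brk E s' t' p)"

text \<open>\<open>struct_fun E b \<alpha> \<beta> \<gamma>\<close> is \<open>L\<^sub>\<alpha>\<^sub>\<beta>\<^sup>\<gamma>\<close>.\<close>

definition struct_fun ::
  "('a, 'e, 'z) algebroid_scheme \<Rightarrow> ('a, 'e) bchart \<Rightarrow> nat \<Rightarrow> nat \<Rightarrow> nat \<Rightarrow> 'a \<Rightarrow> real" where
  "struct_fun E b \<alpha> \<beta> \<gamma> p =
     bfib b (local_brk E (basis_section E b \<alpha>) (basis_section E b \<beta>) p) \<gamma>"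

type_synonym 'e prol = "'e \<times> (('e \<Rightarrow> real) \<Rightarrow> real)"

definition push_proj ::
  "('a, 'e, 'z) vbundle_scheme \<Rightarrow> 'e \<Rightarrow> (('e \<Rightarrow> real) \<Rightarrow> real) \<Rightarrow> ('a \<Rightarrow> real) \<Rightarrow> real" where
  "push_proj E w v = (\<lambda>f. if smooth_near (base E) (proj E w) f then v (\<lambda>w'. f (proj E w')) else 0)"

definition prol_fibre :: "('a, 'e, 'z) algebroid_scheme \<Rightarrow> 'e \<Rightarrow> 'e prol set" where
  "prol_fibre E w = {(u, v). u \<in> fibre E (proj E w) \<and> v \<in> tangent_space (total E) w \<and>
     anchor E u = push_proj E w v}"

definition prol_zero :: "('a, 'e, 'z) algebroid_scheme \<Rightarrow> 'e \<Rightarrow> 'e prol" where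
  "prol_zero E w = (fzero_of E w, \<lambda>f. 0)"

text \<open>\<open>prol_comb E b w a c\<close> is \<open>a\<^sup>\<alpha> \<X>\<^sub>\<alpha>(w) + c\<^sup>\<alpha> \<V>\<^sub>\<alpha>(w)\<close>; in the induced chart, \<open>\<partial>/\<partial>x\<^sup>i\<close> has index \<open>i\<close> and
  \<open>\<partial>/\<partial>y\<^sup>\<alpha>\<close> has index \<open>n + \<alpha>\<close>.\<close>

definition prol_comb ::
  "('a, 'e, 'z) algebroid_scheme \<Rightarrow> ('a, 'e) bchart \<Rightarrow> 'e \<Rightarrow> (nat \<Rightarrow> real) \<Rightarrow> (nat \<Rightarrow> real) \<Rightarrow> 'e prol"
where
  "prol_comb E b w a c =
     (lincomb_at E b (proj E w) a,
      tvec (total E) (induced_chart E b) w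
        (\<lambda>i. if i < mdim (base E)
              then \<Sum>\<alpha><rk E. a \<alpha> * anchor_coeff E b \<alpha> i (proj E w)
              else c (i - mdim (base E))))"

text \<open>The dual basis: as \<open>\<X>\<^sub>\<alpha>(w) = (s\<^sub>\<alpha>, \<sigma>\<^sub>\<alpha>\<^sup>i \<partial>/\<partial>x\<^sup>i)\<close> and \<open>\<V>\<^sub>\<alpha>(w) = (0, \<partial>/\<partial>y\<^sup>\<alpha>)\<close>, the components of \<open>(u, v)\<close>
  are the fibre coordinates of \<open>u\<close> and the values \<open>v(y\<^sup>\<alpha>)\<close>.\<close>

definition Xdual :: "('a, 'e) bchart \<Rightarrow> nat \<Rightarrow> 'e prol \<Rightarrow> real" where
  "Xdual b \<alpha> z = bfib b (fst z) \<alpha>"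

definition Vdual :: "('a, 'e) bchart \<Rightarrow> nat \<Rightarrow> 'e prol \<Rightarrow> real" where
  "Vdual b \<alpha> z = snd z (\<lambda>w. bfib b w \<alpha>)"

text \<open>The sections of the prolongation over an open set \<open>W\<close> of the total space; their values outside
  \<open>W\<close> are irrelevant.\<close>

definition prol_sections :: "('a, 'e, 'z) algebroid_scheme \<Rightarrow> 'e set \<Rightarrow> ('e \<Rightarrow> 'e prol) set" where
  "prol_sections E W = {X. (\<forall>w\<in>W. X w \<in> prol_fibre E w) \<and>
     (\<forall>b. is_bchart E b \<longrightarrow> (\<forall>\<alpha><rk E.
        smooth_fun_on (total E) (W \<inter> fst (induced_chart E b)) (\<lambda>w. Xdual b \<alpha> (X w)) \<and>
        smooth_fun_on (total E) (W \<inter> fst (induced_chart E b)) (\<lambda>w. Vdual b \<alpha> (X w))))}"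

text \<open>\<open>act X f\<close> is \<open>X(f) = \<sigma>\<^sup>1(X)f\<close>, where \<open>\<sigma>\<^sup>1\<close> is the second projection.\<close>

definition act :: "('e \<Rightarrow> 'e prol) \<Rightarrow> ('e \<Rightarrow> real) \<Rightarrow> 'e \<Rightarrow> real" where
  "act X f w = snd (X w) f"

definition bchart_at :: "('a, 'e, 'z) vbundle_scheme \<Rightarrow> 'a \<Rightarrow> ('a, 'e) bchart" where
  "bchart_at E p = (SOME b. is_bchart E b \<and> p \<in> bdom b)"

text \<open>The bracket is bilinear over the reals, satisfies the Leibniz rule for \<open>\<sigma>\<^sup>1\<close>, and is given by
  \<open>[\<X>\<^sub>\<alpha>, \<X>\<^sub>\<beta>] = L\<^sub>\<alpha>\<^sub>\<beta>\<^sup>\<gamma> \<X>\<^sub>\<gamma>\<close>, \<open>[\<X>\<^sub>\<alpha>, \<V>\<^sub>\<beta>] = 0\<close>, \<open>[\<V>\<^sub>\<alpha>, \<V>\<^sub>\<beta>] = 0\<close> on the local basis.  Expanding both arguments in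
  the basis yields the formula below.  The result does not depend on the chosen bundle chart around
  the point; the same holds for the Euler section and the Cartan 1-section.\<close>

definition prol_brk ::
  "('a, 'e, 'z) algebroid_scheme \<Rightarrow> ('e \<Rightarrow> 'e prol) \<Rightarrow> ('e \<Rightarrow> 'e prol) \<Rightarrow> 'e \<Rightarrow> 'e prol" where
  "prol_brk E X Y w =
     (let b = bchart_at E (proj E w) in
      prol_comb E b w
        (\<lambda>\<gamma>. act X (\<lambda>w'. Xdual b \<gamma> (Y w')) w - act Y (\<lambda>w'. Xdual b \<gamma> (X w')) w
             + (\<Sum>\<alpha><rk E. \<Sum>\<beta><rk E.
                  Xdual b \<alpha> (X w) * Xdual b \<beta> (Y w) * struct_fun E b \<alpha> \<beta> \<gamma> (proj E w)))
        (\<lambda>\<gamma>. act X (\<lambda>w'. Vdual b \<gamma> (Y w')) w - act Y (\<lambda>w'. Vdual b \<gamma> (X w')) w))"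

definition euler_section :: "('a, 'e, 'z) algebroid_scheme \<Rightarrow> 'e \<Rightarrow> 'e prol" where
  "euler_section E w =
     (let b = bchart_at E (proj E w) in prol_comb E b w (\<lambda>_. 0) (\<lambda>\<alpha>. bfib b w \<alpha>))"

text \<open>A form is given by its values on sections: a 1-form maps a section to a function, a 2-form
  maps two sections to a function.\<close>

type_synonym 'e form1 = "('e \<Rightarrow> 'e prol) \<Rightarrow> 'e \<Rightarrow> real"
type_synonym 'e form2 = "('e \<Rightarrow> 'e prol) \<Rightarrow> ('e \<Rightarrow> 'e prol) \<Rightarrow> 'e \<Rightarrow> real"
type_synonym 'e form3 =
  "('e \<Rightarrow> 'e prol) \<Rightarrow> ('e \<Rightarrow> 'e prol) \<Rightarrow> ('e \<Rightarrow> 'e prol) \<Rightarrow> 'e \<Rightarrow> real"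

definition d0 :: "('e \<Rightarrow> real) \<Rightarrow> 'e form1" where
  "d0 f X = act X f"

definition d1 :: "('a, 'e, 'z) algebroid_scheme \<Rightarrow> 'e form1 \<Rightarrow> 'e form2" where
  "d1 E \<theta> X Y w = act X (\<theta> Y) w - act Y (\<theta> X) w - \<theta> (prol_brk E X Y) w"

definition d2 :: "('a, 'e, 'z) algebroid_scheme \<Rightarrow> 'e form2 \<Rightarrow> 'e form3" where
  "d2 E \<omega> X Y Z w =
     act X (\<omega> Y Z) w - act Y (\<omega> X Z) w + act Z (\<omega> X Y) w
     - \<omega> (prol_brk E X Y) Z w + \<omega> (prol_brk E X Z) Y w - \<omega> (prol_brk E Y Z) X w"

text \<open>\<open>\<L>\<^sub>X = i\<^sub>X d + d i\<^sub>X\<close>, where \<open>i\<^sub>X\<close> inserts \<open>X\<close> as the first argument and vanishes on functions.\<close>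

definition lie0 :: "('e \<Rightarrow> 'e prol) \<Rightarrow> ('e \<Rightarrow> real) \<Rightarrow> 'e \<Rightarrow> real" where
  "lie0 X f w = d0 f X w"

definition lie2 ::
  "('a, 'e, 'z) algebroid_scheme \<Rightarrow> ('e \<Rightarrow> 'e prol) \<Rightarrow> 'e form2 \<Rightarrow> 'e form2" where
  "lie2 E X \<omega> Y Z w = d2 E \<omega> X Y Z w + d1 E (\<omega> X) Y Z w"

definition dy :: "('a, 'e, 'z) algebroid_scheme \<Rightarrow> ('a, 'e) bchart \<Rightarrow> nat \<Rightarrow> ('e \<Rightarrow> real) \<Rightarrow> 'e \<Rightarrow> real"
where
  "dy E b \<alpha> f = coord_deriv (induced_chart E b) (mdim (base E) + \<alpha>) f"

definition hessian_mat ::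
  "('a, 'e, 'z) algebroid_scheme \<Rightarrow> ('a, 'e) bchart \<Rightarrow> ('e \<Rightarrow> real) \<Rightarrow> 'e \<Rightarrow> real Matrix.mat" where
  "hessian_mat E b L w = Matrix.mat (rk E) (rk E) (\<lambda>(\<alpha>, \<beta>). dy E b \<alpha> (dy E b \<beta> L) w)"

definition regular_lagrangian :: "('a, 'e, 'z) algebroid_scheme \<Rightarrow> ('e \<Rightarrow> real) \<Rightarrow> bool" where
  "regular_lagrangian E L \<longleftrightarrow>
     smooth_fun_on (total E) (mpoints (total E)) L \<and>
     (\<forall>b. is_bchart E b \<longrightarrow> (\<forall>w\<in>fst (induced_chart E b).
        vec_space.rank (rk E) (hessian_mat E b L w) = rk E))"

definition cartan1 :: "('a, 'e, 'z) algebroid_scheme \<Rightarrow> ('e \<Rightarrow> real) \<Rightarrow> 'e form1" where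
  "cartan1 E L X w =
     (let b = bchart_at E (proj E w) in \<Sum>\<alpha><rk E. dy E b \<alpha> L w * Xdual b \<alpha> (X w))"

definition cartan2 :: "('a, 'e, 'z) algebroid_scheme \<Rightarrow> ('e \<Rightarrow> real) \<Rightarrow> 'e form2" where
  "cartan2 E L = d1 E (cartan1 E L)"

definition energy :: "('a, 'e, 'z) algebroid_scheme \<Rightarrow> ('e \<Rightarrow> real) \<Rightarrow> 'e \<Rightarrow> real" where
  "energy E L w = act (euler_section E) L w - L w"

definition canonical_semispray ::
  "('a, 'e, 'z) algebroid_scheme \<Rightarrow> ('e \<Rightarrow> real) \<Rightarrow> ('e \<Rightarrow> 'e prol) \<Rightarrow> bool" where
  "canonical_semispray E L S \<longleftrightarrow>
     S \<in> prol_sections E (mpoints (total E)) \<and>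
     (\<forall>Y\<in>prol_sections E (mpoints (total E)). \<forall>w\<in>mpoints (total E).
        cartan2 E L S Y w = - d0 (energy E L) Y w)"

definition cartan_symmetry ::
  "('a, 'e, 'z) algebroid_scheme \<Rightarrow> ('e \<Rightarrow> real) \<Rightarrow> ('e \<Rightarrow> 'e prol) \<Rightarrow> bool" where
  "cartan_symmetry E L X \<longleftrightarrow>
     (\<forall>Y\<in>prol_sections E (slit E). \<forall>Z\<in>prol_sections E (slit E). \<forall>w\<in>slit E.
        lie2 E X (cartan2 E L) Y Z w = 0) \<and>
     (\<forall>w\<in>slit E. lie0 X (energy E L) w = 0)"

definition dynamical_symmetry ::
  "('a, 'e, 'z) algebroid_scheme \<Rightarrow> ('e \<Rightarrow> 'e prol) \<Rightarrow> ('e \<Rightarrow> 'e prol) \<Rightarrow> bool" where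
  "dynamical_symmetry E S X \<longleftrightarrow> (\<forall>w\<in>slit E. prol_brk E S X w = prol_zero E w)"

end

theory Submission
  imports Defs
begin

text \<open>
  Why the theorem holds.  Write \<open>\<omega>\<close> for the Cartan 2-section and \<open>\<epsilon>\<close> for the energy.  In the definition of
  \<open>\<L>\<^sub>X \<omega>\<close> all terms cancel in pairs, by antisymmetry of \<open>\<omega>\<close> and of the bracket, except
  \<open>X(\<omega>(Y,Z)) - \<omega>([X,Y],Z) - \<omega>(Y,[X,Z])\<close>.  For \<open>Y = S\<close> and a Cartan symmetry \<open>X\<close> this is zero.  Since
  \<open>i\<^sub>S \<omega> = - d \<epsilon>\<close>, the first term is \<open>-X(Z(\<epsilon>))\<close> and \<open>\<omega>(S,[X,Z])\<close> is
  \<open>-[X,Z](\<epsilon>) = Z(X(\<epsilon>)) - X(Z(\<epsilon>))\<close>, where \<open>X(\<epsilon>) = 0\<close>.  What remains is \<open>\<omega>([X,S],Z) = 0\<close> for all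
  \<open>Z\<close>, and nondegeneracy of \<open>\<omega>\<close> gives \<open>[X,S] = 0\<close>.  This argument is \<open>lie_derivative_cartan2\<close>,
  \<open>cartan_symmetry_bracket\<close> and \<open>cartan2_nondegenerate\<close>.

  Everything else justifies the calculus that the argument takes for granted.  The bracket of the
  prolongation, the Euler section and the Cartan 1-section are given at each point by a formula in a
  chart chosen for that point, so before they can be differentiated it must be known that the
  formulas agree in all charts.  For the bracket this needs two facts.  Its anchor is the commutator
  of derivations (\<open>act_brk_in_chart\<close>), by symmetry of second derivatives and the anchor
  condition on the structure functions; this settles the vertical part.  The horizontal part needs
  the transformation law of the structure functions (\<open>struct_fun_change\<close>), which comes from the
  coordinate formula for the bracket of two sections (\<open>brk_coord\<close>).

  The bracket of a Lie algebroid is only given on global sections, and the semispray is only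
  characterised by global sections.  Both are brought to bear on local frames by cutoff
  functions (\<open>cutoff\<close>, \<open>global_frame\<close>, \<open>global_prol_section\<close>); with the Leibniz rule they also show
  that the bracket is local (\<open>brk_local\<close>).  Underneath lies the calculus of functions with iterated
  continuous partial derivatives: the chain rule, symmetry of second derivatives, and a flat function
  from which the cutoffs are built.
\<close>

section \<open>Partial derivatives and smooth functions on open subsets of Euclidean space\<close>

lemma Euclidean_space_upd:
  "x \<in> topspace (Euclidean_space n) \<Longrightarrow> i < n \<Longrightarrow> x(i := t) \<in> topspace (Euclidean_space n)"
  by (auto simp: topspace_Euclidean_space)

definition open_box :: "nat \<Rightarrow> (nat \<Rightarrow> real) \<Rightarrow> real \<Rightarrow> (nat \<Rightarrow> real) set" where
  "open_box n x r = {y \<in> topspace (Euclidean_space n). \<forall>i<n. \<bar>y i - x i\<bar> < r}"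

lemma Euclidean_space_box:
  assumes "openin (Euclidean_space n) V" "x \<in> V"
  shows "\<exists>e>0. open_box n x e \<subseteq> V"
proof -
  obtain T where T: "openin (powertop_real UNIV) T" "V = T \<inter> {x. \<forall>i\<ge>n. x i = 0}"
    using assms unfolding Euclidean_space_def openin_subtopology by auto
  obtain B where B: "x \<in> PiE UNIV B" "\<And>i. openin euclideanreal (B i)" "PiE UNIV B \<subseteq> T"
    using product_topology_open_contains_basis[OF T(1), of x] assms(2) T(2) by auto
  have "\<exists>e>0. \<forall>t. \<bar>t - x i\<bar> < e \<longrightarrow> t \<in> B i" for i
  proof -
    have "open (B i)" "x i \<in> B i" using B by (auto simp: PiE_iff)
    then show ?thesis by (metis open_real)
  qed
  then obtain e where e: "\<And>i. e i > 0" "\<And>i t. \<bar>t - x i\<bar> < e i \<Longrightarrow> t \<in> B i"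
    by metis
  define r where "r = Min (insert 1 (e ` {..<n}))"
  have r: "r > 0" "\<And>i. i < n \<Longrightarrow> r \<le> e i"
    using e(1) by (auto simp: r_def)
  show ?thesis
  proof (intro exI[of _ r] conjI subsetI r(1))
    fix y assume "y \<in> open_box n x r"
    then have y: "y \<in> topspace (Euclidean_space n)" "\<And>i. i < n \<Longrightarrow> \<bar>y i - x i\<bar> < r"
      by (auto simp: open_box_def)
    have "y i \<in> B i" for i
    proof (cases "i < n")
      case True then show ?thesis using y(2)[OF True] r(2)[OF True] e(2) by force
    next
      case False
      then have "y i = x i" using y(1) assms(2) T(2) by (auto simp: topspace_Euclidean_space)
      then show ?thesis using B(1) by (auto simp: PiE_iff)
    qed
    then have "y \<in> PiE UNIV B" by (auto simp: PiE_iff)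
    then show "y \<in> V" using B(3) T(2) y(1) by (auto simp: topspace_Euclidean_space)
  qed
qed

lemma eventually_curve_in_open:
  assumes "openin (Euclidean_space n) V" "\<gamma> t0 \<in> V"
    and "\<And>t. \<gamma> t \<in> topspace (Euclidean_space n)"
    and "\<And>i. i < n \<Longrightarrow> isCont (\<lambda>t. \<gamma> t i) (t0::real)"
  shows "eventually (\<lambda>t. \<gamma> t \<in> V) (nhds t0)"
proof -
  obtain e where e: "e > 0" "open_box n (\<gamma> t0) e \<subseteq> V"
    using Euclidean_space_box[OF assms(1,2)] by blast
  have "eventually (\<lambda>t. \<forall>i\<in>{..<n}. \<bar>\<gamma> t i - \<gamma> t0 i\<bar> < e) (nhds t0)"
  proof (rule eventually_ball_finite)
    show "\<forall>i\<in>{..<n}. \<forall>\<^sub>F t in nhds t0. \<bar>\<gamma> t i - \<gamma> t0 i\<bar> < e"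
    proof
      fix i assume "i \<in> {..<n}"
      then have "filterlim (\<lambda>t. \<gamma> t i) (nhds (\<gamma> t0 i)) (nhds t0)"
        using assms(4) tendsto_at_iff_tendsto_nhds[of "\<lambda>t. \<gamma> t i" t0] by (simp add: isCont_def)
      from tendstoD[OF this e(1)] show "\<forall>\<^sub>F t in nhds t0. \<bar>\<gamma> t i - \<gamma> t0 i\<bar> < e"
        by (simp add: dist_real_def)
    qed
  qed simp
  then show ?thesis
    by eventually_elim (use e assms(3) in \<open>auto simp: open_box_def\<close>)
qed

lemma eventually_upd_in_open:
  assumes "openin (Euclidean_space n) V" "x \<in> V" "i < n"
  shows "eventually (\<lambda>t. x(i := t) \<in> V) (nhds (x i))"
proof (rule eventually_curve_in_open[OF assms(1)])
  show "x(i := t) \<in> topspace (Euclidean_space n)" for t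
    using assms openin_subset by (fastforce intro!: Euclidean_space_upd)
  show "isCont (\<lambda>t. (x(i := t)) j) (x i)" for j by (cases "j = i") auto
qed (use assms in auto)

lemma continuous_map_box:
  assumes "openin (Euclidean_space n) V" "x \<in> V" "r > 0"
    and "continuous_map (subtopology (Euclidean_space n) V) euclideanreal f"
  shows "\<exists>d>0. \<forall>y\<in>open_box n x d. \<bar>f y - f x\<bar> < r"
proof -
  let ?B = "{y \<in> topspace (subtopology (Euclidean_space n) V). f y \<in> {f x - r<..<f x + r}}"
  have "openin (subtopology (Euclidean_space n) V) ?B"
    by (rule openin_continuous_map_preimage[OF assms(4)]) auto
  then have B: "openin (Euclidean_space n) ?B"
    using assms(1) openin_open_subtopology by blast
  have x: "x \<in> ?B"
    using assms openin_subset by fastforce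
  obtain e where "e > 0" "open_box n x e \<subseteq> ?B"
    using Euclidean_space_box[OF B x] by blast
  then show ?thesis by (intro exI[of _ e]) (auto simp: abs_less_iff)
qed

lemma Ck_on_imp_continuous_map:
  "Ck_on k n V f \<Longrightarrow> continuous_map (subtopology (Euclidean_space n) V) euclideanreal f"
  by (cases k) auto

lemma Ck_on_Suc_imp: "Ck_on (Suc k) n V f \<Longrightarrow> Ck_on k n V f"
proof (induction k arbitrary: f)
  case (Suc k)
  then show ?case by (auto simp del: Ck_on.simps simp: Ck_on.simps(2)[of "Suc k"] intro!: Ck_on.simps(2)[THEN iffD2])
qed simp

lemma Ck_on_pd: "Ck_on (Suc k) n V f \<Longrightarrow> i < n \<Longrightarrow> Ck_on k n V (pd i f)"
  by simp

lemma Ck_on_pd_deriv: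
  assumes "Ck_on (Suc k) n V f" "i < n" "x(i := t) \<in> V"
  shows "((\<lambda>t. f (x(i := t))) has_real_derivative pd i f (x(i := t))) (at t)"
proof -
  have "\<forall>y\<in>V. (\<lambda>s. f (y(i := s))) field_differentiable at (y i)"
    using assms by simp
  then have "(\<lambda>s. f ((x(i := t))(i := s))) field_differentiable at ((x(i := t)) i)"
    using assms(3) by blast
  then show ?thesis
    by (simp add: pd_def field_differentiable_derivI)
qed

lemma Ck_on_pd_deriv':
  assumes "Ck_on (Suc k) n V f" "i < n" "x \<in> V"
  shows "((\<lambda>t. f (x(i := t))) has_real_derivative pd i f x) (at (x i))"
  using Ck_on_pd_deriv[OF assms(1,2), of x "x i"] assms(3) by simp

lemma pd_eqI: "((\<lambda>t. f (x(i := t))) has_real_derivative D) (at (x i)) \<Longrightarrow> pd i f x = D"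
  by (simp add: pd_def DERIV_imp_deriv)

text \<open>Existence of continuous slopes: moving from \<open>x\<close> to \<open>y\<close> one coordinate at a time and applying the
  mean value theorem to each step is what makes continuous partial derivatives sufficient for
  total differentiability.\<close>

lemma Ck_on_slopes:
  assumes V: "openin (Euclidean_space n) V" "x \<in> V" and f: "Ck_on (Suc k) n V f"
  shows "\<exists>\<phi>. \<exists>e>0. (\<forall>y\<in>open_box n x e. f y - f x = (\<Sum>j<n. \<phi> j y * (y j - x j))) \<and>
    (\<forall>j<n. \<forall>r>0. \<exists>d>0. \<forall>y\<in>open_box n x d. \<bar>\<phi> j y - pd j f x\<bar> < r)"
proof -
  obtain e where e: "e > 0" "open_box n x e \<subseteq> V"
    using Euclidean_space_box[OF V] by blast
  have xE: "x \<in> topspace (Euclidean_space n)" using V openin_subset by blast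
  \<comment> \<open>the corner points of the path from \<open>x\<close> to \<open>y\<close> that changes the coordinates in turn\<close>
  define z where "z y k = (\<lambda>j. if j < k then y j else x j)" for y and k :: nat
  have ex: "\<exists>u. u \<in> topspace (Euclidean_space n) \<and> (\<forall>i<n. \<bar>u i - x i\<bar> \<le> \<bar>y i - x i\<bar>) \<and>
      f (z y (Suc j)) - f (z y j) = pd j f u * (y j - x j)"
    if y: "y \<in> open_box n x e" and j: "j < n" for y j
  proof -
    have upd: "z y (Suc j) = (z y j)(j := y j)" "z y j = (z y j)(j := x j)"
      by (auto simp: z_def fun_eq_iff less_Suc_eq)
    have zE: "(z y j)(j := s) \<in> topspace (Euclidean_space n)" for s
      using y xE j by (auto simp: z_def topspace_Euclidean_space open_box_def)
    have bound: "\<bar>((z y j)(j := s)) i - x i\<bar> \<le> \<bar>y i - x i\<bar>" if "\<bar>s - x j\<bar> \<le> \<bar>y j - x j\<bar>" for s i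
      using that by (auto simp: z_def)
    have inV: "(z y j)(j := s) \<in> V" if "\<bar>s - x j\<bar> \<le> \<bar>y j - x j\<bar>" for s
    proof -
      have "(z y j)(j := s) \<in> open_box n x e"
        unfolding open_box_def using zE le_less_trans[OF bound[OF that]] y
        by (simp add: open_box_def del: fun_upd_apply)
      then show ?thesis using e(2) by blast
    qed
    have D: "((\<lambda>s. f ((z y j)(j := s))) has_real_derivative pd j f ((z y j)(j := s))) (at s)"
      if "\<bar>s - x j\<bar> \<le> \<bar>y j - x j\<bar>" for s
      by (rule Ck_on_pd_deriv[OF f j inV[OF that]])
    have "\<exists>s. \<bar>s - x j\<bar> \<le> \<bar>y j - x j\<bar> \<and>
        f ((z y j)(j := y j)) - f ((z y j)(j := x j)) = pd j f ((z y j)(j := s)) * (y j - x j)"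
    proof (cases "x j" "y j" rule: linorder_cases)
      case less
      then obtain s where "x j < s" "s < y j" "f ((z y j)(j := y j)) - f ((z y j)(j := x j)) = (y j - x j) * pd j f ((z y j)(j := s))"
        using MVT2[OF less, of "\<lambda>s. f ((z y j)(j := s))" "\<lambda>s. pd j f ((z y j)(j := s))"] D by auto
      then show ?thesis by (intro exI[of _ s]) auto
    next
      case equal then show ?thesis by (intro exI[of _ "x j"]) auto
    next
      case greater
      then obtain s where "y j < s" "s < x j" "f ((z y j)(j := x j)) - f ((z y j)(j := y j)) = (x j - y j) * pd j f ((z y j)(j := s))"
        using MVT2[OF greater, of "\<lambda>s. f ((z y j)(j := s))" "\<lambda>s. pd j f ((z y j)(j := s))"] D by auto
      then show ?thesis by (intro exI[of _ s]) (auto simp: algebra_simps)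
    qed
    then obtain s where s: "\<bar>s - x j\<bar> \<le> \<bar>y j - x j\<bar>"
        "f ((z y j)(j := y j)) - f ((z y j)(j := x j)) = pd j f ((z y j)(j := s)) * (y j - x j)" by blast
    show ?thesis
      by (rule exI[of _ "(z y j)(j := s)"]) (use s zE bound upd in auto)
  qed
  define P where "P y j u \<longleftrightarrow> u \<in> topspace (Euclidean_space n) \<and> (\<forall>i<n. \<bar>u i - x i\<bar> \<le> \<bar>y i - x i\<bar>) \<and>
      f (z y (Suc j)) - f (z y j) = pd j f u * (y j - x j)" for y j u
  define \<phi> where "\<phi> j y = pd j f (SOME u. P y j u)" for j y
  have P: "P y j (SOME u. P y j u)"
    if "y \<in> open_box n x e" "j < n" for y j
    using ex[OF that, folded P_def] by (rule someI_ex)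
  have "\<forall>y\<in>open_box n x e. f y - f x = (\<Sum>j<n. \<phi> j y * (y j - x j))"
  proof
    fix y assume y: "y \<in> open_box n x e"
    have "z y 0 = x" "z y n = y"
      using y xE by (auto simp: z_def topspace_Euclidean_space fun_eq_iff open_box_def)
    then have "f y - f x = f (z y n) - f (z y 0)" by simp
    also have "\<dots> = (\<Sum>j<n. f (z y (Suc j)) - f (z y j))" by (simp only: sum_lessThan_telescope[of "\<lambda>j. f (z y j)"])
    also have "\<dots> = (\<Sum>j<n. \<phi> j y * (y j - x j))"
      using P[OF y] by (auto simp: P_def \<phi>_def intro!: sum.cong)
    finally show "f y - f x = (\<Sum>j<n. \<phi> j y * (y j - x j))" .
  qed
  moreover have "\<exists>d>0. \<forall>y\<in>open_box n x d. \<bar>\<phi> j y - pd j f x\<bar> < r"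
    if j: "j < n" and r: "r > 0" for j r
  proof -
    have "continuous_map (subtopology (Euclidean_space n) V) euclideanreal (pd j f)"
      using Ck_on_imp_continuous_map Ck_on_pd[OF f j] by blast
    then obtain d where d: "d > 0" "\<forall>y\<in>open_box n x d. \<bar>pd j f y - pd j f x\<bar> < r"
      using continuous_map_box[OF V r] by blast
    show ?thesis
    proof (intro exI[of _ "min d e"] conjI ballI impI)
      fix y assume y: "y \<in> open_box n x (min d e)"
      then have "y \<in> open_box n x e" by (auto simp: open_box_def)
      then have u: "P y j (SOME u. P y j u)" by (rule P[OF _ j])
      then have "(SOME u. P y j u) \<in> open_box n x d"
        using y by (force simp: P_def open_box_def)
      then show "\<bar>\<phi> j y - pd j f x\<bar> < r"
        unfolding \<phi>_def using d(2) by blast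
    qed (use d e in auto)
  qed
  ultimately show ?thesis using e(1) by blast
qed

lemma chain_rule_curve:
  assumes V: "openin (Euclidean_space n) V" "\<gamma> t0 \<in> V" and f: "Ck_on (Suc k) n V f"
    and \<gamma>: "\<And>t. \<gamma> t \<in> topspace (Euclidean_space n)"
    and D: "\<And>j. j < n \<Longrightarrow> ((\<lambda>t. \<gamma> t j) has_real_derivative \<gamma>' j) (at t0)"
  shows "((\<lambda>t. f (\<gamma> t)) has_real_derivative (\<Sum>j<n. pd j f (\<gamma> t0) * \<gamma>' j)) (at t0)"
proof -
  obtain \<phi> e where e: "e > 0"
    "\<forall>y\<in>open_box n (\<gamma> t0) e. f y - f (\<gamma> t0) = (\<Sum>j<n. \<phi> j y * (y j - \<gamma> t0 j))"
    and \<phi>: "\<forall>j<n. \<forall>r>0. \<exists>d>0. \<forall>y\<in>open_box n (\<gamma> t0) d. \<bar>\<phi> j y - pd j f (\<gamma> t0)\<bar> < r"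
    using Ck_on_slopes[OF V f] by blast
  have near: "eventually (\<lambda>t. \<gamma> t \<in> open_box n (\<gamma> t0) d) (at t0)" if "d > 0" for d
  proof -
    have "\<forall>\<^sub>F t in at t0. \<forall>i\<in>{..<n}. \<bar>\<gamma> t i - \<gamma> t0 i\<bar> < d"
    proof (rule eventually_ball_finite)
    show "\<forall>i\<in>{..<n}. \<forall>\<^sub>F t in at t0. \<bar>\<gamma> t i - \<gamma> t0 i\<bar> < d"
    proof
      fix i assume "i \<in> {..<n}"
      then have "((\<lambda>t. \<gamma> t i) \<longlongrightarrow> \<gamma> t0 i) (at t0)"
        using DERIV_isCont[OF D] by (simp add: isCont_def)
      from tendstoD[OF this that] show "\<forall>\<^sub>F t in at t0. \<bar>\<gamma> t i - \<gamma> t0 i\<bar> < d"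
        by (simp add: dist_real_def)
    qed
    qed simp
    then show ?thesis by eventually_elim (use \<gamma> in \<open>auto simp: open_box_def\<close>)
  qed
  have lim\<phi>: "((\<lambda>t. \<phi> j (\<gamma> t)) \<longlongrightarrow> pd j f (\<gamma> t0)) (at t0)" if j: "j < n" for j
  proof (rule tendstoI)
    fix r :: real assume "r > 0"
    then obtain d where d: "d > 0" "\<forall>y\<in>open_box n (\<gamma> t0) d. \<bar>\<phi> j y - pd j f (\<gamma> t0)\<bar> < r"
      using \<phi>[rule_format, OF j \<open>r > 0\<close>] by auto
    show "\<forall>\<^sub>F t in at t0. dist (\<phi> j (\<gamma> t)) (pd j f (\<gamma> t0)) < r"
      using near[OF d(1)] by eventually_elim (use d(2) in \<open>auto simp: dist_real_def\<close>)
  qed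
  have "((\<lambda>t. \<Sum>j<n. \<phi> j (\<gamma> t) * ((\<gamma> t j - \<gamma> t0 j) / (t - t0))) \<longlongrightarrow> (\<Sum>j<n. pd j f (\<gamma> t0) * \<gamma>' j)) (at t0)"
    using D by (intro tendsto_sum tendsto_mult lim\<phi>) (auto simp: has_field_derivative_iff)
  moreover have "eventually (\<lambda>t. (\<Sum>j<n. \<phi> j (\<gamma> t) * ((\<gamma> t j - \<gamma> t0 j) / (t - t0))) = (f (\<gamma> t) - f (\<gamma> t0)) / (t - t0)) (at t0)"
    using near[OF e(1)]
    by eventually_elim (use e(2) in \<open>simp add: sum_divide_distrib\<close>)
  ultimately show ?thesis
    unfolding has_field_derivative_iff by (rule Lim_transform_eventually)
qed

text \<open>Applying the mean value theorem first in one variable and then in the other turns the second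
  difference over a square into a mixed second derivative at an intermediate point.\<close>

lemma mixed_difference:
  fixes F :: "real \<Rightarrow> real \<Rightarrow> real"
  assumes h: "h > 0"
    and F1: "\<And>s t. a \<le> s \<Longrightarrow> s \<le> a + h \<Longrightarrow> b \<le> t \<Longrightarrow> t \<le> b + h \<Longrightarrow>
      ((\<lambda>s. F s t) has_real_derivative F1 s t) (at s)"
    and F12: "\<And>s t. a \<le> s \<Longrightarrow> s \<le> a + h \<Longrightarrow> b \<le> t \<Longrightarrow> t \<le> b + h \<Longrightarrow>
      ((\<lambda>t. F1 s t) has_real_derivative F12 s t) (at t)"
  shows "\<exists>s t. a < s \<and> s < a + h \<and> b < t \<and> t < b + h \<and>
    F (a + h) (b + h) - F (a + h) b - F a (b + h) + F a b = h * h * F12 s t"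
proof -
  have "\<exists>s. a < s \<and> s < a + h \<and> (F (a + h) (b + h) - F (a + h) b) - (F a (b + h) - F a b) =
      (a + h - a) * (F1 s (b + h) - F1 s b)"
    by (rule MVT2) (use h in \<open>auto intro!: derivative_eq_intros F1\<close>)
  then obtain s where s: "a < s" "s < a + h"
      "F (a + h) (b + h) - F (a + h) b - F a (b + h) + F a b = h * (F1 s (b + h) - F1 s b)" by auto
  have "\<exists>t. b < t \<and> t < b + h \<and> F1 s (b + h) - F1 s b = (b + h - b) * F12 s t"
    by (rule MVT2) (use h s in \<open>auto intro!: F12\<close>)
  then show ?thesis using s by auto
qed

text \<open>Both orders of differentiation describe the same second difference, and by continuity both
  intermediate values tend to the values at the corner.\<close>

lemma mixed_partials_real:
  fixes F :: "real \<Rightarrow> real \<Rightarrow> real"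
  assumes e: "e > 0"
    and D: "\<And>s t. \<bar>s - a\<bar> < e \<Longrightarrow> \<bar>t - b\<bar> < e \<Longrightarrow>
      ((\<lambda>s. F s t) has_real_derivative F1 s t) (at s) \<and> ((\<lambda>t. F1 s t) has_real_derivative F12 s t) (at t) \<and>
      ((\<lambda>t. F s t) has_real_derivative F2 s t) (at t) \<and> ((\<lambda>s. F2 s t) has_real_derivative F21 s t) (at s)"
    and c: "\<And>r. r > 0 \<Longrightarrow> \<exists>d>0. \<forall>s t. \<bar>s - a\<bar> < d \<longrightarrow> \<bar>t - b\<bar> < d \<longrightarrow>
       \<bar>F12 s t - F12 a b\<bar> < r \<and> \<bar>F21 s t - F21 a b\<bar> < r"
  shows "F12 a b = F21 a b"
proof (rule ccontr)
  assume ne: "F12 a b \<noteq> F21 a b"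
  define r where "r = \<bar>F12 a b - F21 a b\<bar> / 2"
  have "r > 0" using ne by (simp add: r_def)
  then obtain d where d: "d > 0" "\<And>s t. \<bar>s - a\<bar> < d \<Longrightarrow> \<bar>t - b\<bar> < d \<Longrightarrow>
       \<bar>F12 s t - F12 a b\<bar> < r \<and> \<bar>F21 s t - F21 a b\<bar> < r"
    using c by metis
  define h where "h = min d e / 2"
  have h: "h > 0" "h < d" "h < e" using d e by (auto simp: h_def)
  obtain s t where st: "a < s" "s < a + h" "b < t" "t < b + h"
      "F (a + h) (b + h) - F (a + h) b - F a (b + h) + F a b = h * h * F12 s t"
    using mixed_difference[OF h(1), of a b F F1 F12] D h by force
  obtain t' s' where st': "b < t'" "t' < b + h" "a < s'" "s' < a + h"
      "F (a + h) (b + h) - F a (b + h) - F (a + h) b + F a b = h * h * F21 s' t'"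
    using mixed_difference[OF h(1), of b a "\<lambda>t s. F s t" "\<lambda>t s. F2 s t" "\<lambda>t s. F21 s t"] D h by force
  have "h * h * F12 s t = h * h * F21 s' t'" using st st' by linarith
  then have "F12 s t = F21 s' t'" using h by simp
  moreover have "\<bar>F12 s t - F12 a b\<bar> < r" "\<bar>F21 s' t' - F21 a b\<bar> < r"
    using d(2)[of s t] d(2)[of s' t'] st st' h by auto
  ultimately show False unfolding r_def by (smt (verit) field_sum_of_halves)
qed

lemma pd_commute:
  assumes V: "openin (Euclidean_space n) V" "x \<in> V" and f: "Ck_on (Suc (Suc k)) n V f"
    and ij: "i < n" "j < n"
  shows "pd i (pd j f) x = pd j (pd i f) x"
proof (cases "i = j")
  case False
  have xE: "x \<in> topspace (Euclidean_space n)" using V openin_subset by blast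
  define P where "P s t = x(i := s, j := t)" for s t
  have PE: "P s t \<in> topspace (Euclidean_space n)" for s t
    using xE ij by (auto simp: P_def topspace_Euclidean_space)
  have Px: "P (x i) (x j) = x" by (simp add: P_def)
  have P': "P s t = x(j := t, i := s)" for s t using False by (simp add: P_def fun_upd_twist)
  have Pb: "P s t \<in> open_box n x d" if "\<bar>s - x i\<bar> < d" "\<bar>t - x j\<bar> < d" for s t d
    using that PE[of s t] by (auto simp: P_def open_box_def)
  obtain e where e: "e > 0" "open_box n x e \<subseteq> V"
    using Euclidean_space_box[OF V] by blast
  have PV: "P s t \<in> V" if "\<bar>s - x i\<bar> < e" "\<bar>t - x j\<bar> < e" for s t
    using e(2) Pb[OF that] by blast
  have Di: "((\<lambda>s. g (P s t)) has_real_derivative pd i g (P s t)) (at s)"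
    if "Ck_on (Suc l) n V g" "\<bar>s - x i\<bar> < e" "\<bar>t - x j\<bar> < e" for g l s t
    unfolding P' by (rule Ck_on_pd_deriv[OF that(1) ij(1)]) (use PV[OF that(2,3)] in \<open>simp add: P'\<close>)
  have Dj: "((\<lambda>t. g (P s t)) has_real_derivative pd j g (P s t)) (at t)"
    if "Ck_on (Suc l) n V g" "\<bar>s - x i\<bar> < e" "\<bar>t - x j\<bar> < e" for g l s t
    unfolding P_def by (rule Ck_on_pd_deriv[OF that(1) ij(2)]) (use PV[OF that(2,3)] in \<open>simp add: P_def\<close>)
  have f1: "Ck_on (Suc k) n V (pd i f)" "Ck_on (Suc k) n V (pd j f)"
    using f ij Ck_on_pd by blast+
  have f2: "continuous_map (subtopology (Euclidean_space n) V) euclideanreal (pd j (pd i f))"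
    "continuous_map (subtopology (Euclidean_space n) V) euclideanreal (pd i (pd j f))"
    using f1 ij Ck_on_pd Ck_on_imp_continuous_map by blast+
  have "pd j (pd i f) (P (x i) (x j)) = pd i (pd j f) (P (x i) (x j))"
  proof (rule mixed_partials_real[where F = "\<lambda>s t. f (P s t)" and ?F1.0 = "\<lambda>s t. pd i f (P s t)"
        and ?F12.0 = "\<lambda>s t. pd j (pd i f) (P s t)" and ?F2.0 = "\<lambda>s t. pd j f (P s t)" and ?F21.0 = "\<lambda>s t. pd i (pd j f) (P s t)",
        OF e(1)])
    fix r :: real assume r: "r > 0"
    obtain d1 where d1: "d1 > 0" "\<forall>y\<in>open_box n x d1. \<bar>pd j (pd i f) y - pd j (pd i f) x\<bar> < r"
      using continuous_map_box[OF V r f2(1)] by blast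
    obtain d2 where d2: "d2 > 0" "\<forall>y\<in>open_box n x d2. \<bar>pd i (pd j f) y - pd i (pd j f) x\<bar> < r"
      using continuous_map_box[OF V r f2(2)] by blast
    show "\<exists>d>0. \<forall>s t. \<bar>s - x i\<bar> < d \<longrightarrow> \<bar>t - x j\<bar> < d \<longrightarrow>
        \<bar>pd j (pd i f) (P s t) - pd j (pd i f) (P (x i) (x j))\<bar> < r \<and>
        \<bar>pd i (pd j f) (P s t) - pd i (pd j f) (P (x i) (x j))\<bar> < r"
    proof (intro exI[of _ "min d1 d2"] conjI allI impI)
      fix s t assume "\<bar>s - x i\<bar> < min d1 d2" "\<bar>t - x j\<bar> < min d1 d2"
      then show "\<bar>pd j (pd i f) (P s t) - pd j (pd i f) (P (x i) (x j))\<bar> < r"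
        "\<bar>pd i (pd j f) (P s t) - pd i (pd j f) (P (x i) (x j))\<bar> < r"
        unfolding Px using d1(2) d2(2) Pb by simp_all
    qed (use d1 d2 in auto)
  qed (use Di Dj f f1 in blast)
  then show ?thesis by (simp add: Px)
qed simp

lemma pd_cong:
  assumes "openin (Euclidean_space n) V" "x \<in> V" "i < n" "\<And>y. y \<in> V \<Longrightarrow> f y = g y"
  shows "pd i f x = pd i g x"
  unfolding pd_def
  by (rule deriv_cong_ev[OF eventually_mono[OF eventually_upd_in_open[OF assms(1-3)]]]) (use assms(4) in auto)

lemma DERIV_cong_near:
  "(f has_real_derivative D) (at u) \<Longrightarrow> \<forall>\<^sub>F v in nhds u. f v = g v \<Longrightarrow> (g has_real_derivative D) (at u)"
  using DERIV_cong_ev[of u u f g D D] by simp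

lemma Ck_on_SucI:
  assumes "continuous_map (subtopology (Euclidean_space n) V) euclideanreal f"
    and D: "\<And>x i. x \<in> V \<Longrightarrow> i < n \<Longrightarrow> ((\<lambda>t. f (x(i := t))) has_real_derivative D x i) (at (x i))"
    and "\<And>i. i < n \<Longrightarrow> Ck_on k n V (pd i f)"
  shows "Ck_on (Suc k) n V f"
proof -
  have "(\<lambda>t. f (x(i := t))) field_differentiable at (x i)" if "x \<in> V" "i < n" for x i
    using D[OF that] unfolding field_differentiable_def by (rule exI)
  then show ?thesis using assms(1,3) by simp
qed

text \<open>Openness of the domain matters: a partial derivative at a point also sees the values of the function
  near the point.\<close>

lemma Ck_on_cong:
  assumes V: "openin (Euclidean_space n) V" and fg: "\<And>y. y \<in> V \<Longrightarrow> f y = g y"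
    and f: "Ck_on k n V f"
  shows "Ck_on k n V g"
  using fg f
proof (induction k arbitrary: f g)
  case 0
  then show ?case by (auto elim!: continuous_map_eq)
next
  case (Suc k)
  have "continuous_map (subtopology (Euclidean_space n) V) euclideanreal g"
    using Suc.prems by (auto elim!: continuous_map_eq)
  moreover have "(\<lambda>t. g (x(i := t))) field_differentiable at (x i)" if "i < n" "x \<in> V" for i x
  proof -
    have "((\<lambda>t. f (x(i := t))) has_real_derivative pd i f x) (at (x i))"
      by (rule Ck_on_pd_deriv'[OF Suc.prems(2) that])
    moreover have "\<forall>\<^sub>F t in nhds (x i). f (x(i := t)) = g (x(i := t))"
      by (rule eventually_mono[OF eventually_upd_in_open[OF V that(2,1)]]) (use Suc.prems(1) in auto)
    ultimately have "((\<lambda>t. g (x(i := t))) has_real_derivative pd i f x) (at (x i))"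
      by (rule DERIV_cong_near)
    then show ?thesis by (auto simp: field_differentiable_def)
  qed
  moreover have "Ck_on k n V (pd i g)" if "i < n" for i
    by (rule Suc.IH[OF _ Ck_on_pd[OF Suc.prems(2) that]])
       (use pd_cong[OF V _ that, of _ f g] Suc.prems(1) in auto)
  ultimately show ?case by simp
qed

lemma Ck_on_subset: "Ck_on k n V f \<Longrightarrow> W \<subseteq> V \<Longrightarrow> Ck_on k n W f"
proof (induction k arbitrary: f)
  case 0 then show ?case by (auto intro: continuous_map_from_subtopology_mono)
next
  case (Suc k) then show ?case by (auto intro: continuous_map_from_subtopology_mono)
qed

lemma continuous_map_locally:
  assumes W: "\<And>x. x \<in> V \<Longrightarrow> openin X (W x) \<and> x \<in> W x \<and> continuous_map (subtopology X (W x)) Y f"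
  shows "continuous_map (subtopology X V) Y f"
proof (rule pasting_lemma[where I = V and T = "\<lambda>x. V \<inter> W x" and f = "\<lambda>_. f"])
  show "openin (subtopology X V) (V \<inter> W x)" if "x \<in> V" for x
    using W[OF that] by (metis openin_subtopology_Int2)
  show "continuous_map (subtopology (subtopology X V) (V \<inter> W x)) Y f" if "x \<in> V" for x
    using W[OF that] continuous_map_from_subtopology_mono[of X "W x" _ f "V \<inter> W x"]
    by (simp add: subtopology_subtopology)
  show "\<exists>j. j \<in> V \<and> x \<in> V \<inter> W j \<and> f x = f x" if "x \<in> topspace (subtopology X V)" for x
    using that W by auto
qed auto

text \<open>Being smooth is a local property; it lets charts be changed around one point at a time.\<close>

lemma Ck_on_locally:
  assumes "\<And>x. x \<in> V \<Longrightarrow> \<exists>W. openin (Euclidean_space n) W \<and> x \<in> W \<and> Ck_on k n W f"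
  shows "Ck_on k n V f"
  using assms
proof (induction k arbitrary: f)
  case base: 0
  obtain W where W: "\<And>x. x \<in> V \<Longrightarrow> openin (Euclidean_space n) (W x) \<and> x \<in> W x \<and> Ck_on 0 n (W x) f"
    using base by metis
  show ?case unfolding Ck_on.simps
    by (rule continuous_map_locally[of V _ W]) (use W in \<open>simp\<close>)
next
  case (Suc k)
  obtain W where W: "\<And>x. x \<in> V \<Longrightarrow> openin (Euclidean_space n) (W x) \<and> x \<in> W x \<and> Ck_on (Suc k) n (W x) f"
    using Suc.prems by metis
  show ?case unfolding Ck_on.simps
  proof (intro conjI allI impI ballI)
    show "continuous_map (subtopology (Euclidean_space n) V) euclideanreal f"
      by (rule continuous_map_locally[of V _ W]) (use W in \<open>simp\<close>)
    show "(\<lambda>t. f (x(i := t))) field_differentiable at (x i)" if "i < n" "x \<in> V" for i x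
    proof -
      have "Ck_on (Suc k) n (W x) f" "x \<in> W x" using W[OF that(2)] by (simp_all only:)
      from Ck_on_pd_deriv'[OF this(1) that(1) this(2)] show ?thesis
        unfolding field_differentiable_def by (rule exI)
    qed
    show "Ck_on k n V (pd i f)" if i: "i < n" for i
    proof (rule Suc.IH)
      fix x assume "x \<in> V"
      then have "openin (Euclidean_space n) (W x)" "x \<in> W x" "Ck_on (Suc k) n (W x) f"
        using W by (simp_all only:)
      then show "\<exists>W. openin (Euclidean_space n) W \<and> x \<in> W \<and> Ck_on k n W (pd i f)"
        using Ck_on_pd[OF _ i] by blast
    qed
  qed
qed

lemma Ck_on_const: "Ck_on k n V (\<lambda>_. c)"
proof (induction k arbitrary: c)
  case (Suc k)
  have "pd i (\<lambda>_. c) = (\<lambda>_. 0)" for i by (simp add: pd_def fun_eq_iff)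
  then show ?case using Suc by simp
qed simp

lemma Ck_on_coord: "Ck_on k n V (\<lambda>x. x j)"
proof -
  have c: "continuous_map (subtopology (Euclidean_space n) V) euclideanreal (\<lambda>x. x j)"
    unfolding Euclidean_space_def
    by (intro continuous_map_from_subtopology continuous_map_product_projection) simp
  show ?thesis
  proof (cases k)
    case (Suc l)
    have D: "((\<lambda>t. (x(i := t)) j) has_real_derivative (if i = j then 1 else 0)) (at s)" for x :: "nat \<Rightarrow> real" and i s
      by (cases "i = j") auto
    then have "pd i (\<lambda>x. x j) = (\<lambda>_. if i = j then 1 else 0)" for i
      by (intro ext pd_eqI)
    moreover have "(\<lambda>t. (x(i := t)) j) field_differentiable at (x i)" for x :: "nat \<Rightarrow> real" and i
      using D unfolding field_differentiable_def by blast
    ultimately show ?thesis using c Suc Ck_on_const by simp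
  qed (use c in simp)
qed

lemma pd_add:
  assumes "Ck_on (Suc k) n V f" "Ck_on (Suc k) n V g" "x \<in> V" "i < n"
  shows "pd i (\<lambda>x. f x + g x) x = pd i f x + pd i g x"
  by (rule pd_eqI) (use Ck_on_pd_deriv'[OF assms(1,4,3)] Ck_on_pd_deriv'[OF assms(2,4,3)] in \<open>auto intro!: derivative_eq_intros\<close>)

lemma pd_mult:
  assumes "Ck_on (Suc k) n V f" "Ck_on (Suc k) n V g" "x \<in> V" "i < n"
  shows "pd i (\<lambda>x. f x * g x) x = pd i f x * g x + f x * pd i g x"
  by (rule pd_eqI) (use Ck_on_pd_deriv'[OF assms(1,4,3)] Ck_on_pd_deriv'[OF assms(2,4,3)] in \<open>auto intro!: derivative_eq_intros\<close>)

lemma Ck_on_add: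
  assumes V: "openin (Euclidean_space n) V" and "Ck_on k n V f" "Ck_on k n V g"
  shows "Ck_on k n V (\<lambda>x. f x + g x)"
  using assms(2,3)
proof (induction k arbitrary: f g)
  case 0 then show ?case by (auto intro: continuous_map_add)
next
  case (Suc k)
  have "Ck_on k n V (pd i (\<lambda>x. f x + g x))" if "i < n" for i
    by (rule Ck_on_cong[OF V _ Suc.IH[OF Ck_on_pd[OF Suc.prems(1) that] Ck_on_pd[OF Suc.prems(2) that]]])
       (use pd_add[OF Suc.prems _ that] in simp)
  then show ?case
    using Suc.prems by (auto intro: continuous_map_add field_differentiable_add)
qed

lemma Ck_on_mult:
  assumes V: "openin (Euclidean_space n) V" and "Ck_on k n V f" "Ck_on k n V g"
  shows "Ck_on k n V (\<lambda>x. f x * g x)"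
  using assms(2,3)
proof (induction k arbitrary: f g)
  case 0 then show ?case by (auto intro: continuous_map_real_mult)
next
  case (Suc k)
  have "Ck_on k n V (pd i (\<lambda>x. f x * g x))" if "i < n" for i
    by (rule Ck_on_cong[OF V _ Ck_on_add[OF V Suc.IH[OF Ck_on_pd[OF Suc.prems(1) that] Ck_on_Suc_imp[OF Suc.prems(2)]]
          Suc.IH[OF Ck_on_Suc_imp[OF Suc.prems(1)] Ck_on_pd[OF Suc.prems(2) that]]]])
       (use pd_mult[OF Suc.prems _ that] in simp)
  then show ?case
    using Suc.prems by (auto intro: continuous_map_real_mult field_differentiable_mult)
qed

lemma Ck_on_sum:
  assumes "openin (Euclidean_space n) V" "\<And>j. j \<in> A \<Longrightarrow> Ck_on k n V (f j)"
  shows "Ck_on k n V (\<lambda>x. \<Sum>j\<in>A. f j x)"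
  using assms(2)
  by (induction A rule: infinite_finite_induct) (auto intro: Ck_on_const Ck_on_add[OF assms(1)])

lemma pd_compose:
  assumes U: "openin (Euclidean_space m) U" and f: "Ck_on (Suc k) m U f"
    and g: "\<And>j. j < m \<Longrightarrow> Ck_on (Suc l) n V (\<lambda>x. G x j)"
    and G: "\<And>x. G x \<in> topspace (Euclidean_space m)" "G x \<in> U" and x: "x \<in> V" "i < n"
  shows "((\<lambda>t. f (G (x(i := t)))) has_real_derivative (\<Sum>j<m. pd j f (G x) * pd i (\<lambda>x. G x j) x)) (at (x i))"
  using chain_rule_curve[OF U, of "\<lambda>t. G (x(i := t))" "x i" k f "\<lambda>j. pd i (\<lambda>x. G x j) x"]
    Ck_on_pd_deriv'[OF g x(2,1)] f G by simp

lemma Ck_on_compose: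
  assumes V: "openin (Euclidean_space n) V" and U: "openin (Euclidean_space m) U" and f: "Ck_on k m U f"
    and g: "\<And>j. j < m \<Longrightarrow> Ck_on k n V (\<lambda>x. G x j)"
    and G: "\<And>x. G x \<in> topspace (Euclidean_space m)" "\<And>x. x \<in> V \<Longrightarrow> G x \<in> U"
  shows "Ck_on k n V (\<lambda>x. f (G x))"
  using f g
proof (induction k arbitrary: f)
  have cont: "continuous_map (subtopology (Euclidean_space n) V) euclideanreal (\<lambda>x. f (G x))"
    if f: "continuous_map (subtopology (Euclidean_space m) U) euclideanreal f"
      and g: "\<And>j. j < m \<Longrightarrow> continuous_map (subtopology (Euclidean_space n) V) euclideanreal (\<lambda>x. G x j)" for f
  proof -
    have "continuous_map (subtopology (Euclidean_space n) V) (Euclidean_space m) (\<lambda>x i. if i < m then G x i else 0)"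
      using g by (simp add: continuous_map_componentwise_Euclidean_space)
    moreover have "(\<lambda>x i. if i < m then G x i else 0) = G"
      using G(1) by (fastforce simp: topspace_Euclidean_space fun_eq_iff)
    ultimately have "continuous_map (subtopology (Euclidean_space n) V) (subtopology (Euclidean_space m) U) G"
      using G(2) by (auto simp: continuous_map_in_subtopology)
    from continuous_map_compose[OF this f] show ?thesis by (simp add: comp_def)
  qed
  { case 0 then show ?case using cont by simp }
  case (Suc k)
  have D: "((\<lambda>t. f (G (x(i := t)))) has_real_derivative (\<Sum>j<m. pd j f (G x) * pd i (\<lambda>x. G x j) x)) (at (x i))"
    if "x \<in> V" "i < n" for x i
    by (rule pd_compose[OF U Suc.prems(1) Suc.prems(2)]) (use G that in auto)
  have "Ck_on k n V (pd i (\<lambda>x. f (G x)))" if i: "i < n" for i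
  proof (rule Ck_on_cong[OF V])
    show "(\<Sum>j<m. pd j f (G x) * pd i (\<lambda>x. G x j) x) = pd i (\<lambda>x. f (G x)) x" if "x \<in> V" for x
      using pd_eqI[OF D[OF that i]] by simp
    show "Ck_on k n V (\<lambda>x. \<Sum>j<m. pd j f (G x) * pd i (\<lambda>x. G x j) x)"
    proof (intro Ck_on_sum[OF V] Ck_on_mult[OF V])
      fix j assume "j \<in> {..<m}"
      then have j: "j < m" by simp
      show "Ck_on k n V (\<lambda>x. pd j f (G x))"
        by (rule Suc.IH[OF Ck_on_pd[OF Suc.prems(1) j] Ck_on_Suc_imp[OF Suc.prems(2)]])
      show "Ck_on k n V (pd i (\<lambda>x. G x j))"
        by (rule Ck_on_pd[OF Suc.prems(2)[OF j] i])
    qed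
  qed
  moreover have "continuous_map (subtopology (Euclidean_space n) V) euclideanreal (\<lambda>x. f (G x))"
    by (rule cont[OF Ck_on_imp_continuous_map[OF Suc.prems(1)] Ck_on_imp_continuous_map[OF Suc.prems(2)]])
  ultimately show ?case by (intro Ck_on_SucI[OF _ D])
qed

section \<open>Cutoff functions on Euclidean space\<close>

text \<open>The functions \<open>u\<^sup>-\<^sup>k exp (-1/u)\<close>, continued by zero.  The parameter makes the family closed under
  differentiation, up to linear combinations.\<close>

definition flat :: "nat \<Rightarrow> real \<Rightarrow> real" where
  "flat k u = (if u > 0 then (1 / u) ^ k * exp (- (1 / u)) else 0)"

text \<open>The exponential beats every power, after the substitution \<open>u = 1/x\<close>.\<close>

lemma flat_tendsto_0: "(flat k \<longlongrightarrow> 0) (at_right 0)"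
proof -
  have "((\<lambda>x::real. x ^ k / exp x) \<longlongrightarrow> 0) at_top" by (rule tendsto_power_div_exp_0)
  then have "((\<lambda>u::real. (inverse u) ^ k / exp (inverse u)) \<longlongrightarrow> 0) (at_right 0)"
    by (rule filterlim_compose[OF _ filterlim_inverse_at_top_right])
  moreover have "\<forall>\<^sub>F u in at_right 0. (inverse u) ^ k / exp (inverse u) = flat k u"
    by (simp add: eventually_at_right_field flat_def exp_minus divide_inverse gt_ex)
  ultimately show ?thesis by (rule Lim_transform_eventually)
qed

lemma flat_deriv: "(flat k has_real_derivative flat (k + 2) u - k * flat (k + 1) u) (at u)"
proof (cases u "0::real" rule: linorder_cases)
  case less
  have "((\<lambda>_. 0) has_real_derivative 0) (at u)" by simp
  moreover have "\<forall>\<^sub>F v in nhds u. 0 = flat k v"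
    by (rule eventually_mono[OF eventually_nhds_in_open[of "{..<0}"]]) (use less in \<open>auto simp: flat_def\<close>)
  ultimately have "(flat k has_real_derivative 0) (at u)" by (rule DERIV_cong_near)
  then show ?thesis using less by (simp add: flat_def)
next
  case equal
  have "((\<lambda>y. flat k y / y) \<longlongrightarrow> 0) (at_left 0)"
  proof (rule Lim_transform_eventually[of "\<lambda>_. 0"])
    show "\<forall>\<^sub>F y in at_left 0. 0 = flat k y / y"
      by (simp add: eventually_at_left_field flat_def) (auto intro: exI[of _ "-1"])
  qed simp
  moreover have "((\<lambda>y. flat k y / y) \<longlongrightarrow> 0) (at_right 0)"
  proof (rule Lim_transform_eventually[OF flat_tendsto_0[of "k+1"]])
    show "\<forall>\<^sub>F y in at_right 0. flat (k + 1) y = flat k y / y"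
      by (simp add: eventually_at_right_field flat_def) (auto intro: exI[of _ 1])
  qed
  ultimately show ?thesis
    using equal by (simp add: has_field_derivative_iff filterlim_split_at flat_def)
next
  case greater
  have "((\<lambda>u. (1 / u) ^ k * exp (- (1 / u))) has_real_derivative flat (k + 2) u - k * flat (k + 1) u) (at u)"
  proof -
    let ?v = "1 / u"
    have v: "((\<lambda>u. 1 / u) has_real_derivative - (?v * ?v)) (at u)"
      using greater by (auto intro!: derivative_eq_intros)
    have "((\<lambda>u. (1 / u) ^ k * exp (- (1 / u))) has_real_derivative
        (k * ?v ^ (k - 1) * (- (?v * ?v))) * exp (- ?v) + ?v ^ k * (exp (- ?v) * (?v * ?v))) (at u)"
      by (rule derivative_eq_intros v refl)+ (simp add: algebra_simps)
    moreover have E: "(k * v ^ (k - 1) * (- (v * v))) * E + v ^ k * (E * (v * v)) = v ^ (k + 2) * E - k * (v ^ (k + 1) * E)" for v E :: real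
      by (cases k) (auto simp: algebra_simps)
    ultimately show ?thesis
      unfolding E using greater by (simp only: flat_def if_True)
  qed
  moreover have "\<forall>\<^sub>F v in nhds u. (1 / v) ^ k * exp (- (1 / v)) = flat k v"
    by (rule eventually_mono[OF eventually_nhds_in_open[of "{0<..}"]]) (use greater in \<open>auto simp: flat_def\<close>)
  ultimately show ?thesis by (rule DERIV_cong_near)
qed

lemma Ck_on_flat:
  assumes V: "openin (Euclidean_space n) V" and f: "Ck_on k n V f"
  shows "Ck_on k n V (\<lambda>x. flat l (f x))"
  using f
proof (induction k arbitrary: l)
  have cont: "continuous_map (subtopology (Euclidean_space n) V) euclideanreal (\<lambda>x. flat l (f x))"
    if "continuous_map (subtopology (Euclidean_space n) V) euclideanreal f" for l
  proof -
    have "continuous_map euclideanreal euclideanreal (flat l)"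
      using DERIV_isCont[OF flat_deriv[of l]] by (simp add: continuous_at_imp_continuous_on)
    from continuous_map_compose[OF that this] show ?thesis by (simp add: comp_def)
  qed
  { case 0 then show ?case using cont by simp }
  case (Suc k)
  have D: "((\<lambda>t. flat l (f (x(i := t)))) has_real_derivative
      (flat (l + 2) (f x) + (- real l) * flat (l + 1) (f x)) * pd i f x) (at (x i))"
    if "x \<in> V" "i < n" for x i
    using DERIV_chain2[where f = "flat l" and g = "\<lambda>t. f (x(i := t))", OF flat_deriv Ck_on_pd_deriv'[OF Suc.prems that(2,1)]]
    by simp
  have "Ck_on k n V (pd i (\<lambda>x. flat l (f x)))" if i: "i < n" for i
  proof (rule Ck_on_cong[OF V])
    show "(flat (l + 2) (f x) + (- real l) * flat (l + 1) (f x)) * pd i f x = pd i (\<lambda>x. flat l (f x)) x" if "x \<in> V" for x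
      using pd_eqI[OF D[OF that i]] by simp
    show "Ck_on k n V (\<lambda>x. (flat (l + 2) (f x) + (- real l) * flat (l + 1) (f x)) * pd i f x)"
      by (intro Ck_on_mult[OF V] Ck_on_add[OF V] Ck_on_const Ck_on_pd[OF Suc.prems i]
          Suc.IH[OF Ck_on_Suc_imp[OF Suc.prems]])
  qed
  moreover have "continuous_map (subtopology (Euclidean_space n) V) euclideanreal (\<lambda>x. flat l (f x))"
    by (rule cont[OF Ck_on_imp_continuous_map[OF Suc.prems]])
  ultimately show ?case by (intro Ck_on_SucI[OF _ D])
qed

text \<open>Since \<open>flat 0\<close> vanishes on the left and increases on the right, \<open>flat 0 (flat 0 1 - flat 0 u)\<close> is
  constant on either side of the unit interval.  This composition takes the place of the usual
  quotient of two flat functions.\<close>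

definition smooth_step :: "real \<Rightarrow> real" where
  "smooth_step u = flat 0 (flat 0 1 + (-1) * flat 0 u) * inverse (flat 0 (flat 0 1))"

lemma smooth_step_eq: "u \<le> 0 \<Longrightarrow> smooth_step u = 1" "u \<ge> 1 \<Longrightarrow> smooth_step u = 0"
proof -
  assume "u \<ge> 1"
  then have "flat 0 1 \<le> flat 0 u" by (auto simp: flat_def)
  then show "smooth_step u = 0" by (simp add: smooth_step_def flat_def[of 0 "_ - _"])
qed (auto simp: smooth_step_def flat_def)

text \<open>The cutoff is a step function of the squared distance; it vanishes outside a closed cube, whose
  compactness is what later survives the passage to a manifold.\<close>

lemma Euclidean_space_cutoff:
  assumes V: "openin (Euclidean_space n) V" "x \<in> V"
  shows "\<exists>\<psi> K W. (\<forall>k. Ck_on k n (topspace (Euclidean_space n)) \<psi>) \<and>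
    compactin (Euclidean_space n) K \<and> K \<subseteq> V \<and> openin (Euclidean_space n) W \<and> x \<in> W \<and> W \<subseteq> K \<and>
    (\<forall>y\<in>W. \<psi> y = 1) \<and> (\<forall>y\<in>topspace (Euclidean_space n) - K. \<psi> y = 0)"
proof -
  obtain e where e: "e > 0" "open_box n x e \<subseteq> V" using Euclidean_space_box[OF V] by blast
  have xE: "x \<in> topspace (Euclidean_space n)" using V openin_subset by blast
  define r where "r = e / 2"
  have r: "0 < r" "r < e" using e by (auto simp: r_def)
  define \<rho> where "\<rho> y = (\<Sum>i<n. (y i + - x i) * (y i + - x i))" for y :: "nat \<Rightarrow> real"
  have sq: "\<bar>y i - x i\<bar>\<^sup>2 \<le> \<rho> y" if "i < n" for y i
  proof -
    have "(y i + - x i) * (y i + - x i) \<le> \<rho> y"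
      unfolding \<rho>_def using that by (intro member_le_sum) auto
    then show ?thesis by (simp add: power2_eq_square)
  qed
  define K where "K = {y \<in> topspace (Euclidean_space n). \<forall>i<n. \<bar>y i - x i\<bar> \<le> r}"
  \<comment> \<open>rescaled so that the step runs from \<open>\<rho> y = r\<^sup>2 / 2\<close> to \<open>\<rho> y = r\<^sup>2\<close>\<close>
  define \<psi> where "\<psi> y = smooth_step ((\<rho> y + \<rho> y + - (r * r)) * inverse (r * r))" for y
  define W where "W = {y \<in> topspace (Euclidean_space n). \<rho> y \<in> {..<r * r / 2}}"
  let ?E = "topspace (Euclidean_space n)"
  have \<rho>: "Ck_on k n ?E \<rho>" for k
    unfolding \<rho>_def by (intro Ck_on_sum Ck_on_mult Ck_on_add Ck_on_const Ck_on_coord) auto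
  have "\<forall>k. Ck_on k n ?E \<psi>"
    unfolding \<psi>_def smooth_step_def
    by (intro allI Ck_on_mult Ck_on_add Ck_on_flat Ck_on_const \<rho>) auto
  moreover have "compactin (Euclidean_space n) K"
  proof -
    have "K = PiE UNIV (\<lambda>i. if i < n then {x i - r..x i + r} else {0})"
    proof (intro equalityI subsetI)
      fix y assume "y \<in> PiE UNIV (\<lambda>i. if i < n then {x i - r..x i + r} else {0})"
      then have y: "y i \<in> (if i < n then {x i - r..x i + r} else {0})" for i by (simp add: PiE_iff)
      have "\<bar>y i - x i\<bar> \<le> r" if "i < n" for i using y[of i] that by (auto simp: abs_le_iff)
      moreover have "y i = 0" if "i \<ge> n" for i using y[of i] that by auto
      ultimately show "y \<in> K" by (simp add: K_def topspace_Euclidean_space)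
    qed (auto simp: K_def topspace_Euclidean_space PiE_iff abs_le_iff)
    moreover have "compactin (powertop_real UNIV) (PiE UNIV (\<lambda>i. if i < n then {x i - r..x i + r} else {0}))"
      by (simp add: compactin_PiE)
    ultimately show ?thesis unfolding Euclidean_space_def compactin_subtopology
      by (auto simp: K_def topspace_Euclidean_space)
  qed
  moreover have "K \<subseteq> V" using e(2) r by (force simp: K_def open_box_def)
  moreover have "openin (Euclidean_space n) W"
    unfolding W_def using \<rho>[of 0] by (intro openin_continuous_map_preimage) auto
  moreover have "x \<in> W" using xE r by (auto simp: W_def \<rho>_def)
  moreover have "W \<subseteq> K"
  proof
    fix y assume y: "y \<in> W"
    have "\<bar>y i - x i\<bar> \<le> r" if "i < n" for i
    proof -
      have "\<bar>y i - x i\<bar>\<^sup>2 \<le> r\<^sup>2" proof -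
        have "\<rho> y < r * r / 2" using y by (simp add: W_def)
        with sq[OF that, of y] zero_le_square[of r] show ?thesis
          unfolding power2_eq_square by linarith
      qed
      then show ?thesis using r power2_le_imp_le by (metis less_imp_le)
    qed
    then show "y \<in> K" using y by (auto simp: K_def W_def)
  qed
  moreover have "\<psi> y = 1" if "y \<in> W" for y
    unfolding \<psi>_def by (rule smooth_step_eq) (use that r in \<open>auto simp: W_def field_simps\<close>)
  moreover have "\<psi> y = 0" if y: "y \<in> ?E - K" for y
  proof -
    obtain i where i: "i < n" "\<bar>y i - x i\<bar> > r" using y by (auto simp: K_def not_le)
    then have "r\<^sup>2 \<le> \<bar>y i - x i\<bar>\<^sup>2" using r by (intro power_mono) auto
    then have "r * r \<le> \<rho> y" using sq[OF i(1), of y] by (simp add: power2_eq_square)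
    then show ?thesis unfolding \<psi>_def using r by (intro smooth_step_eq) (auto simp: field_simps)
  qed
  ultimately show ?thesis
    by (intro exI[of _ \<psi>] exI[of _ K] exI[of _ W] conjI ballI)
qed

section \<open>Smooth functions and tangent vectors in charts\<close>

lemma chart_inv: "is_chart M c \<Longrightarrow> p \<in> fst c \<Longrightarrow> inv_into (fst c) (snd c) (snd c p) = p"
proof -
  assume c: "is_chart M c" and p: "p \<in> fst c"
  have "topspace (subtopology (mtop M) (fst c)) = fst c"
    using c by (auto simp: is_chart_def dest: openin_subset)
  then have "inj_on (snd c) (fst c)"
    using c homeomorphic_imp_injective_map unfolding is_chart_def by metis
  then show ?thesis using p by simp
qed

lemma in_chart_fun: "in_chart c f = (\<lambda>x. f (inv_into (fst c) (snd c) x))"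
  by (simp add: in_chart_def fun_eq_iff)

lemma in_chart_eq: "is_chart M c \<Longrightarrow> p \<in> fst c \<Longrightarrow> in_chart c f (snd c p) = f p"
  by (simp add: in_chart_def chart_inv)

lemma chart_in_Euclidean_space:
  "is_chart M c \<Longrightarrow> p \<in> fst c \<Longrightarrow> snd c p \<in> topspace (Euclidean_space (mdim M))"
  by (auto simp: is_chart_def dest: openin_subset)

lemma chart_open_image:
  assumes "is_chart M c" "openin (mtop M) W"
  shows "openin (Euclidean_space (mdim M)) (snd c ` (fst c \<inter> W))"
proof -
  have "open_map (subtopology (mtop M) (fst c)) (subtopology (Euclidean_space (mdim M)) (snd c ` fst c)) (snd c)"
    using assms(1) homeomorphic_imp_open_map by (auto simp: is_chart_def)
  then have "openin (subtopology (Euclidean_space (mdim M)) (snd c ` fst c)) (snd c ` (fst c \<inter> W))"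
    using assms(2) openin_subtopology_Int2 unfolding open_map_def by blast
  then show ?thesis using assms(1) openin_open_subtopology by (auto simp: is_chart_def)
qed

lemma chart_open_preimage:
  assumes "is_chart M c" "openin (Euclidean_space (mdim M)) U"
  shows "openin (mtop M) {p \<in> fst c. snd c p \<in> U}"
proof -
  have c: "continuous_map (subtopology (mtop M) (fst c)) (subtopology (Euclidean_space (mdim M)) (snd c ` fst c)) (snd c)"
    using assms(1) homeomorphic_imp_continuous_map by (auto simp: is_chart_def)
  then have c: "continuous_map (subtopology (mtop M) (fst c)) (Euclidean_space (mdim M)) (snd c)"
    by (simp add: continuous_map_in_subtopology)
  have "topspace (subtopology (mtop M) (fst c)) = fst c"
    using assms by (auto simp: is_chart_def dest: openin_subset)
  then have "openin (subtopology (mtop M) (fst c)) {p \<in> fst c. snd c p \<in> U}"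
    using openin_continuous_map_preimage[OF c assms(2)] by simp
  then show ?thesis using assms(1) openin_open_subtopology by (auto simp: is_chart_def)
qed

abbreviation smooth_in :: "'a manifold \<Rightarrow> 'a chart \<Rightarrow> 'a set \<Rightarrow> ('a \<Rightarrow> real) \<Rightarrow> bool" where
  "smooth_in M c W f \<equiv> smooth_real_on (mdim M) (snd c ` (fst c \<inter> W)) (in_chart c f)"

lemma smooth_in_subset: "smooth_in M c W f \<Longrightarrow> W' \<subseteq> W \<Longrightarrow> smooth_in M c W' f"
  unfolding smooth_real_on_def by (blast intro: Ck_on_subset)

lemma smooth_in_cong:
  assumes "is_chart M c" "openin (mtop M) W" "\<And>q. q \<in> W \<Longrightarrow> f q = g q" "smooth_in M c W f"
  shows "smooth_in M c W g"
  unfolding smooth_real_on_def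
proof
  fix k
  have "in_chart c f y = in_chart c g y" if "y \<in> snd c ` (fst c \<inter> W)" for y
    using that assms(3) by (auto simp: in_chart_eq[OF assms(1)])
  moreover have "Ck_on k (mdim M) (snd c ` (fst c \<inter> W)) (in_chart c f)"
    using assms(4) by (simp only: smooth_real_on_def)
  ultimately show "Ck_on k (mdim M) (snd c ` (fst c \<inter> W)) (in_chart c g)"
    by (rule Ck_on_cong[OF chart_open_image[OF assms(1,2)]])
qed

text \<open>The chart expression of a composite: this one form of the chain rule serves changes of charts, the
  bundle projection, and sections of a bundle.\<close>

context
  fixes M :: "'a manifold" and N :: "'b manifold" and c d W W' \<Phi>
  assumes c: "is_chart M c" and d: "is_chart N d"
    and W: "openin (mtop M) W" and W': "openin (mtop N) W'"
    and \<Phi>: "\<And>p. p \<in> fst c \<Longrightarrow> p \<in> W \<Longrightarrow> \<Phi> p \<in> fst d \<and> \<Phi> p \<in> W'"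
    and \<Phi>s: "\<And>j. j < mdim N \<Longrightarrow> smooth_in M c W (\<lambda>p. snd d (\<Phi> p) j)"
begin

private definition G :: "(nat \<Rightarrow> real) \<Rightarrow> nat \<Rightarrow> real" where
  "G x = (\<lambda>j. if j < mdim N then in_chart c (\<lambda>p. snd d (\<Phi> p) j) x else 0)"

private lemma G_Euclidean: "G x \<in> topspace (Euclidean_space (mdim N))"
  by (simp add: G_def topspace_Euclidean_space)

private lemma G_eq:
  assumes "p \<in> fst c" "p \<in> W" shows "G (snd c p) = snd d (\<Phi> p)"
proof -
  have "snd d (\<Phi> p) \<in> topspace (Euclidean_space (mdim N))"
    using chart_in_Euclidean_space[OF d] \<Phi> assms by blast
  then show ?thesis
    using assms by (auto simp: G_def in_chart_eq[OF c] topspace_Euclidean_space fun_eq_iff)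
qed

private lemma G_mem: "x \<in> snd c ` (fst c \<inter> W) \<Longrightarrow> G x \<in> snd d ` (fst d \<inter> W')"
  using G_eq \<Phi> by auto

private lemma G_comp: "x \<in> snd c ` (fst c \<inter> W) \<Longrightarrow> in_chart d f (G x) = in_chart c (\<lambda>p. f (\<Phi> p)) x"
  using G_eq \<Phi> by (auto simp: in_chart_eq[OF c] in_chart_eq[OF d])

private lemma G_smooth: "j < mdim N \<Longrightarrow> Ck_on k (mdim M) (snd c ` (fst c \<inter> W)) (\<lambda>x. G x j)"
  using \<Phi>s[of j] by (simp add: G_def smooth_real_on_def)

lemma smooth_in_compose:
  assumes f: "smooth_in N d W' f"
  shows "smooth_in M c W (\<lambda>p. f (\<Phi> p))"
  unfolding smooth_real_on_def
proof
  fix k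
  have "Ck_on k (mdim M) (snd c ` (fst c \<inter> W)) (\<lambda>x. in_chart d f (G x))"
    by (rule Ck_on_compose[OF chart_open_image[OF c W] chart_open_image[OF d W'] _ G_smooth G_Euclidean G_mem])
       (use f in \<open>auto simp: smooth_real_on_def\<close>)
  then show "Ck_on k (mdim M) (snd c ` (fst c \<inter> W)) (in_chart c (\<lambda>p. f (\<Phi> p)))"
    by (rule Ck_on_cong[OF chart_open_image[OF c W], rotated]) (rule G_comp)
qed

lemma coord_deriv_compose:
  assumes f: "smooth_in N d W' f" and p: "p \<in> fst c" "p \<in> W" and i: "i < mdim M"
  shows "coord_deriv c i (\<lambda>p. f (\<Phi> p)) p =
    (\<Sum>j<mdim N. coord_deriv d j f (\<Phi> p) * coord_deriv c i (\<lambda>p. snd d (\<Phi> p) j) p)"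
proof -
  have x: "snd c p \<in> snd c ` (fst c \<inter> W)" using p by auto
  have V: "openin (Euclidean_space (mdim M)) (snd c ` (fst c \<inter> W))" by (rule chart_open_image[OF c W])
  have "pd i (in_chart c (\<lambda>p. f (\<Phi> p))) (snd c p) = pd i (\<lambda>x. in_chart d f (G x)) (snd c p)"
    by (rule pd_cong[OF V x i]) (simp add: G_comp)
  also have "\<dots> = (\<Sum>j<mdim N. pd j (in_chart d f) (G (snd c p)) * pd i (\<lambda>x. G x j) (snd c p))"
    by (rule pd_eqI, rule pd_compose[OF chart_open_image[OF d W'], where k = 0 and l = 0])
       (use f G_smooth G_Euclidean G_mem x i in \<open>auto simp: smooth_real_on_def simp del: Ck_on.simps\<close>)
  also have "\<dots> = (\<Sum>j<mdim N. coord_deriv d j f (\<Phi> p) * coord_deriv c i (\<lambda>p. snd d (\<Phi> p) j) p)"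
  proof (rule sum.cong)
    fix j assume "j \<in> {..<mdim N}"
    then have "(\<lambda>x. G x j) = in_chart c (\<lambda>p. snd d (\<Phi> p) j)" by (simp add: G_def)
    then show "pd j (in_chart d f) (G (snd c p)) * pd i (\<lambda>x. G x j) (snd c p) =
        coord_deriv d j f (\<Phi> p) * coord_deriv c i (\<lambda>p. snd d (\<Phi> p) j) p"
      by (simp only: coord_deriv_def G_eq[OF p])
  qed simp
  finally show ?thesis by (simp add: coord_deriv_def)
qed

end

lemma smooth_in_change:
  assumes "is_chart M c" "is_chart M d" "smooth_transition (mdim M) c d" "openin (mtop M) W"
    and "smooth_in M d W f"
  shows "smooth_in M c (W \<inter> fst d) f"
proof (rule smooth_in_compose[OF assms(1,2) _ assms(4), where \<Phi> = "\<lambda>p. p"])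
  show "smooth_in M c (W \<inter> fst d) (\<lambda>p. snd d p j)" if "j < mdim M" for j
    by (rule smooth_in_subset[of _ _ "fst d"]) (use that assms(3) in \<open>auto simp: smooth_transition_def\<close>)
qed (use assms in \<open>auto simp: is_chart_def\<close>)

lemma smooth_in_locally:
  assumes "is_chart M c"
    and "\<And>p. p \<in> fst c \<Longrightarrow> p \<in> W \<Longrightarrow> \<exists>W'. openin (mtop M) W' \<and> p \<in> W' \<and> smooth_in M c W' f"
  shows "smooth_in M c W f"
  unfolding smooth_real_on_def
proof (intro allI Ck_on_locally)
  fix k x assume "x \<in> snd c ` (fst c \<inter> W)"
  then obtain p where p: "p \<in> fst c" "p \<in> W" "x = snd c p" by auto
  then obtain W' where W': "openin (mtop M) W'" "p \<in> W'" "smooth_in M c W' f" using assms(2) by blast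
  show "\<exists>V. openin (Euclidean_space (mdim M)) V \<and> x \<in> V \<and> Ck_on k (mdim M) V (in_chart c f)"
    by (rule exI[of _ "snd c ` (fst c \<inter> W')"])
       (use W' p chart_open_image[OF assms(1) W'(1)] in \<open>auto simp: smooth_real_on_def\<close>)
qed

locale smooth_mfd =
  fixes M :: "'a manifold"
  assumes smooth_manifold: "smooth_manifold M"
begin

lemma is_chart: "c \<in> max_atlas M \<Longrightarrow> is_chart M c"
  by (simp add: max_atlas_def)

lemma chart_open: "c \<in> max_atlas M \<Longrightarrow> openin (mtop M) (fst c)"
  using is_chart by (auto simp: is_chart_def)

lemma atlas_chart: "c \<in> matlas M \<Longrightarrow> c \<in> max_atlas M"
  using smooth_manifold by (auto simp: smooth_manifold_def)

lemma ex_chart: "p \<in> mpoints M \<Longrightarrow> \<exists>c\<in>matlas M. p \<in> fst c"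
  using smooth_manifold by (force simp: smooth_manifold_def)

text \<open>Smoothness is defined by the charts of the atlas; as the transition maps are smooth, it carries over
  to every compatible chart.\<close>

lemma smooth_fun_on_chart:
  assumes W: "openin (mtop M) W" and f: "smooth_fun_on M W f" and c: "c \<in> max_atlas M"
  shows "smooth_in M c W f"
proof (rule smooth_in_locally[OF is_chart[OF c]])
  fix p assume p: "p \<in> fst c" "p \<in> W"
  then obtain d where d: "d \<in> matlas M" "p \<in> fst d" using ex_chart W openin_subset by blast
  have "smooth_in M c (W \<inter> fst d) f"
    by (rule smooth_in_change[OF is_chart[OF c] is_chart[OF atlas_chart[OF d(1)]] _ W])
       (use c d f in \<open>auto simp: max_atlas_def smooth_fun_on_def\<close>)
  then show "\<exists>W'. openin (mtop M) W' \<and> p \<in> W' \<and> smooth_in M c W' f"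
    using p d W chart_open[OF atlas_chart[OF d(1)]] by (intro exI[of _ "W \<inter> fst d"]) auto
qed

lemma smooth_fun_onI:
  assumes "\<And>p. p \<in> W \<Longrightarrow> \<exists>c\<in>max_atlas M. \<exists>W'. openin (mtop M) W' \<and> p \<in> W' \<and> p \<in> fst c \<and> smooth_in M c W' f"
  shows "smooth_fun_on M W f"
  unfolding smooth_fun_on_def
proof
  fix d assume d: "d \<in> matlas M"
  show "smooth_in M d W f"
  proof (rule smooth_in_locally[OF is_chart[OF atlas_chart[OF d]]])
    fix p assume p: "p \<in> fst d" "p \<in> W"
    then obtain c W' where c: "c \<in> max_atlas M" "openin (mtop M) W'" "p \<in> W'" "p \<in> fst c" "smooth_in M c W' f"
      using assms by blast
    have "smooth_in M d (W' \<inter> fst c) f"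
      by (rule smooth_in_change[OF is_chart[OF atlas_chart[OF d]] is_chart[OF c(1)] _ c(2,5)])
         (use c d in \<open>auto simp: max_atlas_def\<close>)
    then show "\<exists>W'. openin (mtop M) W' \<and> p \<in> W' \<and> smooth_in M d W' f"
      using c chart_open[OF c(1)] by (intro exI[of _ "W' \<inter> fst c"]) auto
  qed
qed

lemma smooth_nearI:
  assumes "c \<in> max_atlas M" "p \<in> fst c" "openin (mtop M) W" "p \<in> W" "smooth_in M c W f"
  shows "smooth_near M p f"
  unfolding smooth_near_def
  by (rule exI[of _ "W \<inter> fst c"])
     (use assms chart_open[OF assms(1)] in \<open>auto intro!: smooth_fun_onI bexI[of _ c] exI[of _ W]\<close>)

lemma smooth_nearE:
  assumes "smooth_near M p f" "c \<in> max_atlas M"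
  obtains W where "openin (mtop M) W" "p \<in> W" "smooth_in M c W f"
  using assms smooth_fun_on_chart unfolding smooth_near_def by blast

lemma smooth_near_mpoints: "smooth_near M p f \<Longrightarrow> p \<in> mpoints M"
  unfolding smooth_near_def using openin_subset by blast

lemma smooth_fun_on_iff:
  assumes W: "openin (mtop M) W"
  shows "smooth_fun_on M W f \<longleftrightarrow> (\<forall>p\<in>W. smooth_near M p f)"
proof
  assume "smooth_fun_on M W f" then show "\<forall>p\<in>W. smooth_near M p f"
    using W unfolding smooth_near_def by blast
next
  assume R: "\<forall>p\<in>W. smooth_near M p f"
  show "smooth_fun_on M W f"
  proof (rule smooth_fun_onI)
    fix p assume p: "p \<in> W"
    then obtain c where c: "c \<in> matlas M" "p \<in> fst c" using ex_chart W openin_subset by blast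
    obtain W' where "openin (mtop M) W'" "p \<in> W'" "smooth_in M c W' f"
      using smooth_nearE[OF R[rule_format, OF p] atlas_chart[OF c(1)]] .
    then show "\<exists>c\<in>max_atlas M. \<exists>W'. openin (mtop M) W' \<and> p \<in> W' \<and> p \<in> fst c \<and> smooth_in M c W' f"
      using c atlas_chart by blast
  qed
qed

lemma smooth_near_nhd:
  assumes "smooth_near M p f"
  shows "\<exists>W. openin (mtop M) W \<and> p \<in> W \<and> (\<forall>q\<in>W. smooth_near M q f)"
  using assms smooth_fun_on_iff unfolding smooth_near_def by blast

lemma smooth_near_cong:
  assumes "smooth_near M p f" "openin (mtop M) W" "p \<in> W" "\<And>q. q \<in> W \<Longrightarrow> f q = g q"
  shows "smooth_near M p g"
proof -
  obtain c where c: "c \<in> max_atlas M" "p \<in> fst c"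
    using ex_chart[OF smooth_near_mpoints[OF assms(1)]] atlas_chart by blast
  obtain W' where W': "openin (mtop M) W'" "p \<in> W'" "smooth_in M c W' f" using smooth_nearE[OF assms(1) c(1)] .
  have "smooth_in M c (W \<inter> W') g"
    by (rule smooth_in_cong[OF is_chart[OF c(1)] _ assms(4) smooth_in_subset[OF W'(3)]]) (use assms W' in auto)
  then show ?thesis using assms W' by (intro smooth_nearI[OF c, of "W \<inter> W'"]) auto
qed

lemma smooth_near_const: assumes "p \<in> mpoints M" shows "smooth_near M p (\<lambda>_. r)"
proof -
  obtain c where c: "c \<in> max_atlas M" "p \<in> fst c" using ex_chart[OF assms] atlas_chart by blast
  show ?thesis
    by (rule smooth_nearI[OF c openin_topspace assms]) (simp add: smooth_real_on_def in_chart_fun Ck_on_const)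
qed

text \<open>Sums and products are treated at once: all that matters is that the operation preserves smoothness in
  coordinates.\<close>

lemma smooth_near_combine:
  assumes "smooth_near M p f" "smooth_near M p g"
    and "\<And>V n k a b. openin (Euclidean_space n) V \<Longrightarrow> Ck_on k n V a \<Longrightarrow> Ck_on k n V b \<Longrightarrow> Ck_on k n V (\<lambda>x. h (a x) (b x))"
  shows "smooth_near M p (\<lambda>q. h (f q) (g q))"
proof -
  obtain c where c: "c \<in> max_atlas M" "p \<in> fst c"
    using ex_chart[OF smooth_near_mpoints[OF assms(1)]] atlas_chart by blast
  obtain W where W: "openin (mtop M) W" "p \<in> W" "smooth_in M c W f" using smooth_nearE[OF assms(1) c(1)] .
  obtain W' where W': "openin (mtop M) W'" "p \<in> W'" "smooth_in M c W' g" using smooth_nearE[OF assms(2) c(1)] .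
  have o: "openin (mtop M) (W \<inter> W')" using W W' by auto
  have s: "smooth_in M c (W \<inter> W') f" "smooth_in M c (W \<inter> W') g" using W W' smooth_in_subset by blast+
  show ?thesis
    by (rule smooth_nearI[OF c o])
       (use W W' s assms(3)[OF chart_open_image[OF is_chart[OF c(1)] o]] in \<open>auto simp: smooth_real_on_def in_chart_fun\<close>)
qed

lemma smooth_near_add: "smooth_near M p f \<Longrightarrow> smooth_near M p g \<Longrightarrow> smooth_near M p (\<lambda>q. f q + g q)"
  by (rule smooth_near_combine[where h = "(+)"]) (auto intro: Ck_on_add)

lemma smooth_near_mult: "smooth_near M p f \<Longrightarrow> smooth_near M p g \<Longrightarrow> smooth_near M p (\<lambda>q. f q * g q)"
  by (rule smooth_near_combine[where h = "(*)"]) (auto intro: Ck_on_mult)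

lemma smooth_near_minus: assumes "smooth_near M p f" shows "smooth_near M p (\<lambda>q. - f q)"
  using smooth_near_mult[OF smooth_near_const[OF smooth_near_mpoints[OF assms], of "-1"] assms] by simp

lemma smooth_near_diff: "smooth_near M p f \<Longrightarrow> smooth_near M p g \<Longrightarrow> smooth_near M p (\<lambda>q. f q - g q)"
  using smooth_near_add[OF _ smooth_near_minus, of p f g] by simp

lemma smooth_near_sum:
  assumes "p \<in> mpoints M" "\<And>j. j \<in> A \<Longrightarrow> smooth_near M p (f j)"
  shows "smooth_near M p (\<lambda>q. \<Sum>j\<in>A. f j q)"
  using assms(2)
  by (induction A rule: infinite_finite_induct) (auto intro: smooth_near_const[OF assms(1)] smooth_near_add)

lemma smooth_near_coord:
  assumes c: "c \<in> max_atlas M" "p \<in> fst c"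
  shows "smooth_near M p (\<lambda>q. snd c q i)"
proof (rule smooth_nearI[OF c chart_open[OF c(1)] c(2)])
  show "smooth_in M c (fst c) (\<lambda>q. snd c q i)"
    unfolding smooth_real_on_def
    by (intro allI Ck_on_cong[OF chart_open_image[OF is_chart[OF c(1)] chart_open[OF c(1)]] _ Ck_on_coord[of _ _ _ i]])
       (auto simp: in_chart_eq[OF is_chart[OF c(1)]])
qed

lemma smooth_near_coord_deriv:
  assumes c: "c \<in> max_atlas M" "p \<in> fst c" and f: "smooth_near M p f" and i: "i < mdim M"
  shows "smooth_near M p (coord_deriv c i f)"
proof -
  obtain W where W: "openin (mtop M) W" "p \<in> W" "smooth_in M c W f" using smooth_nearE[OF f c(1)] .
  show ?thesis
  proof (rule smooth_nearI[OF c W(1,2)])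
    show "smooth_in M c W (coord_deriv c i f)"
      unfolding smooth_real_on_def
    proof
      fix k
      have "Ck_on (Suc k) (mdim M) (snd c ` (fst c \<inter> W)) (in_chart c f)"
        using W(3) unfolding smooth_real_on_def by blast
      from Ck_on_pd[OF this i]
      show "Ck_on k (mdim M) (snd c ` (fst c \<inter> W)) (in_chart c (coord_deriv c i f))"
        by (rule Ck_on_cong[OF chart_open_image[OF is_chart[OF c(1)] W(1)], rotated])
           (auto simp: in_chart_eq[OF is_chart[OF c(1)]] coord_deriv_def)
    qed
  qed
qed

lemma coord_deriv_cong:
  assumes c: "c \<in> max_atlas M" "p \<in> fst c" and "openin (mtop M) W" "p \<in> W" "\<And>q. q \<in> W \<Longrightarrow> f q = g q" "i < mdim M"
  shows "coord_deriv c i f p = coord_deriv c i g p"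
  unfolding coord_deriv_def
  by (rule pd_cong[OF chart_open_image[OF is_chart[OF c(1)] assms(3)]]) (use assms in \<open>auto simp: in_chart_eq[OF is_chart[OF c(1)]]\<close>)

lemma coord_deriv_const: "coord_deriv c i (\<lambda>_. r) p = 0"
  by (simp add: coord_deriv_def in_chart_fun pd_def)

lemma smooth_near_Ck:
  assumes c: "c \<in> max_atlas M" "p \<in> fst c" and f: "smooth_near M p f" and g: "smooth_near M p g"
  shows "\<exists>V. openin (Euclidean_space (mdim M)) V \<and> snd c p \<in> V \<and>
    (\<forall>k. Ck_on k (mdim M) V (in_chart c f)) \<and> (\<forall>k. Ck_on k (mdim M) V (in_chart c g))"
proof -
  obtain W where W: "openin (mtop M) W" "p \<in> W" "smooth_in M c W f" using smooth_nearE[OF f c(1)] .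
  obtain W' where W': "openin (mtop M) W'" "p \<in> W'" "smooth_in M c W' g" using smooth_nearE[OF g c(1)] .
  show ?thesis
  proof (intro exI[of _ "snd c ` (fst c \<inter> (W \<inter> W'))"] conjI)
    show "\<forall>k. Ck_on k (mdim M) (snd c ` (fst c \<inter> (W \<inter> W'))) (in_chart c f)"
      using smooth_in_subset[OF W(3), of "W \<inter> W'"] by (simp add: smooth_real_on_def)
    show "\<forall>k. Ck_on k (mdim M) (snd c ` (fst c \<inter> (W \<inter> W'))) (in_chart c g)"
      using smooth_in_subset[OF W'(3), of "W \<inter> W'"] by (simp add: smooth_real_on_def)
    show "openin (Euclidean_space (mdim M)) (snd c ` (fst c \<inter> (W \<inter> W')))"
      by (rule chart_open_image[OF is_chart[OF c(1)] openin_Int[OF W(1) W'(1)]])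
    show "snd c p \<in> snd c ` (fst c \<inter> (W \<inter> W'))" using W(2) W'(2) c(2) by blast
  qed
qed

lemma coord_deriv_add:
  assumes c: "c \<in> max_atlas M" "p \<in> fst c" and "smooth_near M p f" "smooth_near M p g" "i < mdim M"
  shows "coord_deriv c i (\<lambda>q. f q + g q) p = coord_deriv c i f p + coord_deriv c i g p"
proof -
  obtain V where V: "snd c p \<in> V"
    "\<forall>k. Ck_on k (mdim M) V (in_chart c f)" "\<forall>k. Ck_on k (mdim M) V (in_chart c g)"
    using smooth_near_Ck[OF assms(1-4)] by (elim exE conjE)
  show ?thesis using pd_add[OF V(2)[rule_format] V(3)[rule_format] V(1) assms(5)] by (simp add: coord_deriv_def in_chart_fun)
qed

lemma coord_deriv_mult:
  assumes c: "c \<in> max_atlas M" "p \<in> fst c" and "smooth_near M p f" "smooth_near M p g" "i < mdim M"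
  shows "coord_deriv c i (\<lambda>q. f q * g q) p = coord_deriv c i f p * g p + f p * coord_deriv c i g p"
proof -
  obtain V where V: "snd c p \<in> V"
    "\<forall>k. Ck_on k (mdim M) V (in_chart c f)" "\<forall>k. Ck_on k (mdim M) V (in_chart c g)"
    using smooth_near_Ck[OF assms(1-4)] by (elim exE conjE)
  show ?thesis using pd_mult[OF V(2)[rule_format] V(3)[rule_format] V(1) assms(5)] chart_inv[OF is_chart[OF c(1)] c(2)]
    by (simp add: coord_deriv_def in_chart_fun)
qed

lemma coord_deriv_commute:
  assumes c: "c \<in> max_atlas M" "p \<in> fst c" and f: "smooth_near M p f" and ij: "i < mdim M" "j < mdim M"
  shows "coord_deriv c i (coord_deriv c j f) p = coord_deriv c j (coord_deriv c i f) p"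
proof -
  have open_c: "openin (Euclidean_space (mdim M)) (snd c ` fst c)"
    using is_chart[OF c(1)] by (simp add: is_chart_def)
  have eq: "pd i (in_chart c (coord_deriv c j f)) (snd c p) = pd i (pd j (in_chart c f)) (snd c p)" if "i < mdim M" for i j
    by (rule pd_cong[OF open_c _ that]) (use c in \<open>auto simp: in_chart_eq[OF is_chart[OF c(1)]] coord_deriv_def\<close>)
  obtain V where V: "openin (Euclidean_space (mdim M)) V" "snd c p \<in> V" "\<forall>k. Ck_on k (mdim M) V (in_chart c f)"
    using smooth_near_Ck[OF c f f] by (elim exE conjE)
  show ?thesis
    using pd_commute[OF V(1,2) V(3)[rule_format] ij] eq[OF ij(1), of j] eq[OF ij(2), of i] by (simp add: coord_deriv_def[of c _ "coord_deriv _ _ _"])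
qed

lemma coord_deriv_coord:
  assumes c: "c \<in> max_atlas M" "p \<in> fst c" and i: "i < mdim M"
  shows "coord_deriv c i (\<lambda>q. snd c q j) p = (if i = j then 1 else 0)"
proof -
  have open_c: "openin (Euclidean_space (mdim M)) (snd c ` fst c)"
    using is_chart[OF c(1)] by (simp add: is_chart_def)
  have "coord_deriv c i (\<lambda>q. snd c q j) p = pd i (\<lambda>x. x j) (snd c p)"
    unfolding coord_deriv_def
    by (rule pd_cong[OF open_c _ i]) (use c in \<open>auto simp: in_chart_eq[OF is_chart[OF c(1)]]\<close>)
  also have "\<dots> = (if i = j then 1 else 0)"
    by (rule pd_eqI) (cases "i = j"; auto)
  finally show ?thesis .
qed

lemma smooth_in_chart_near:
  assumes c: "c \<in> max_atlas M" and "\<And>q. q \<in> fst c \<Longrightarrow> q \<in> W \<Longrightarrow> smooth_near M q f"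
  shows "smooth_in M c W f"
proof (rule smooth_in_locally[OF is_chart[OF c]])
  fix p assume "p \<in> fst c" "p \<in> W"
  from smooth_nearE[OF assms(2)[OF this] c]
  show "\<exists>W'. openin (mtop M) W' \<and> p \<in> W' \<and> smooth_in M c W' f" by blast
qed

lemma coord_deriv_chart_change:
  assumes c: "c \<in> max_atlas M" "p \<in> fst c" and d: "d \<in> max_atlas M" "p \<in> fst d"
    and f: "smooth_near M p f" and i: "i < mdim M"
  shows "coord_deriv c i f p = (\<Sum>j<mdim M. coord_deriv d j f p * coord_deriv c i (\<lambda>q. snd d q j) p)"
proof -
  obtain W where W: "openin (mtop M) W" "p \<in> W" "smooth_in M d W f" using smooth_nearE[OF f d(1)] .
  let ?W = "W \<inter> fst d"
  show ?thesis
  proof (rule coord_deriv_compose[OF is_chart[OF c(1)] is_chart[OF d(1)], of "?W" W "\<lambda>p. p" f])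
    show "smooth_in M c ?W (\<lambda>p. snd d p j)" if "j < mdim M" for j
      by (rule smooth_in_chart_near[OF c(1)]) (use smooth_near_coord[OF d(1)] in auto)
  qed (use W c d i chart_open[OF d(1)] in auto)
qed

subsection \<open>Tangent vectors as derivations\<close>

lemma tvec_tangent: "c \<in> max_atlas M \<Longrightarrow> p \<in> fst c \<Longrightarrow> tvec M c p a \<in> tangent_space M p"
  by (auto simp: tangent_space_def)

lemma tvec_coord:
  assumes "c \<in> max_atlas M" "p \<in> fst c" "i < mdim M"
  shows "tvec M c p a (\<lambda>q. snd c q i) = a i"
proof -
  have "tvec M c p a (\<lambda>q. snd c q i) = (\<Sum>j<mdim M. a j * (if j = i then 1 else 0))"
    using smooth_near_coord[OF assms(1,2)] by (simp add: tvec_def coord_deriv_coord[OF assms(1,2)])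
  then show ?thesis using assms(3) by (simp add: if_distrib cong: if_cong)
qed

lemma tangent_nonsmooth: "v \<in> tangent_space M p \<Longrightarrow> \<not> smooth_near M p f \<Longrightarrow> v f = 0"
  by (auto simp: tangent_space_def tvec_def)

text \<open>A tangent vector comes with components in some chart.  By the chain rule it has components in every
  other chart too, namely its values on the coordinate functions.\<close>

lemma tangent_expand:
  assumes v: "v \<in> tangent_space M p" and c: "c \<in> max_atlas M" "p \<in> fst c" and f: "smooth_near M p f"
  shows "v f = (\<Sum>i<mdim M. v (\<lambda>q. snd c q i) * coord_deriv c i f p)"
proof -
  obtain d a where d: "d \<in> max_atlas M" "p \<in> fst d" "v = tvec M d p a"
    using v by (auto simp: tangent_space_def)
  have "v f = (\<Sum>j<mdim M. a j * (\<Sum>i<mdim M. coord_deriv c i f p * coord_deriv d j (\<lambda>q. snd c q i) p))"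
    using f coord_deriv_chart_change[OF d(1,2) c f] by (auto simp: d(3) tvec_def intro!: sum.cong)
  also have "\<dots> = (\<Sum>i<mdim M. (\<Sum>j<mdim M. a j * coord_deriv d j (\<lambda>q. snd c q i) p) * coord_deriv c i f p)"
    by (simp add: sum_distrib_left sum_distrib_right ac_simps) (rule sum.swap)
  also have "\<dots> = (\<Sum>i<mdim M. v (\<lambda>q. snd c q i) * coord_deriv c i f p)"
    using smooth_near_coord[OF c] by (simp add: d(3) tvec_def)
  finally show ?thesis .
qed

text \<open>On functions that are not smooth near the point all tangent vectors vanish, so they are determined by
  their values on the coordinates of one chart.\<close>

lemma tangent_eqI:
  assumes "v \<in> tangent_space M p" "w \<in> tangent_space M p" "c \<in> max_atlas M" "p \<in> fst c"
    and "\<And>i. i < mdim M \<Longrightarrow> v (\<lambda>q. snd c q i) = w (\<lambda>q. snd c q i)"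
  shows "v = w"
proof
  fix f show "v f = w f"
  proof (cases "smooth_near M p f")
    case True
    have "v f = (\<Sum>i<mdim M. w (\<lambda>q. snd c q i) * coord_deriv c i f p)"
      unfolding tangent_expand[OF assms(1,3,4) True] using assms(5) by (intro sum.cong) auto
    then show ?thesis using tangent_expand[OF assms(2,3,4) True] by simp
  qed (use assms tangent_nonsmooth in metis)
qed

lemma tangent_eq_tvec:
  assumes "v \<in> tangent_space M p" "c \<in> max_atlas M" "p \<in> fst c"
    and "\<And>i. i < mdim M \<Longrightarrow> v (\<lambda>q. snd c q i) = a i"
  shows "v = tvec M c p a"
  by (rule tangent_eqI[OF assms(1) tvec_tangent[OF assms(2,3)] assms(2,3)])
     (use assms tvec_coord in simp)

lemma tangent_chart:
  assumes "v \<in> tangent_space M p" obtains c where "c \<in> max_atlas M" "p \<in> fst c"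
  using assms by (auto simp: tangent_space_def)

lemma tangent_add:
  assumes v: "v \<in> tangent_space M p" and "smooth_near M p f" "smooth_near M p g"
  shows "v (\<lambda>q. f q + g q) = v f + v g"
proof -
  obtain c where c: "c \<in> max_atlas M" "p \<in> fst c" using tangent_chart[OF v] .
  show ?thesis
    using assms smooth_near_add[OF assms(2,3)]
    by (simp add: tangent_expand[OF v c] coord_deriv_add[OF c] algebra_simps sum.distrib)
qed

lemma tangent_mult:
  assumes v: "v \<in> tangent_space M p" and "smooth_near M p f" "smooth_near M p g"
  shows "v (\<lambda>q. f q * g q) = v f * g p + f p * v g"
proof -
  obtain c where c: "c \<in> max_atlas M" "p \<in> fst c" using tangent_chart[OF v] .
  show ?thesis
    using assms smooth_near_mult[OF assms(2,3)]
    by (simp add: tangent_expand[OF v c] coord_deriv_mult[OF c] algebra_simps sum.distrib sum_distrib_left)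
qed

lemma tangent_const:
  assumes v: "v \<in> tangent_space M p" shows "v (\<lambda>_. r) = 0"
  using v by (auto simp: tangent_space_def tvec_def coord_deriv_const)

lemma tangent_cong:
  assumes v: "v \<in> tangent_space M p" and W: "openin (mtop M) W" "p \<in> W" "\<And>q. q \<in> W \<Longrightarrow> f q = g q"
  shows "v f = v g"
proof (cases "smooth_near M p f")
  case True
  then have g: "smooth_near M p g" using smooth_near_cong W by blast
  obtain c where c: "c \<in> max_atlas M" "p \<in> fst c" using tangent_chart[OF v] .
  show ?thesis using True g coord_deriv_cong[OF c W] by (simp add: tangent_expand[OF v c])
next
  case False
  then have "\<not> smooth_near M p g" using smooth_near_cong[OF _ W(1,2), of g f] W(3) by auto
  then show ?thesis using False tangent_nonsmooth[OF v] by simp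
qed

lemma tangent_minus:
  assumes v: "v \<in> tangent_space M p" and "smooth_near M p f"
  shows "v (\<lambda>q. - f q) = - v f"
  using tangent_mult[OF v smooth_near_const[OF smooth_near_mpoints[OF assms(2)], of "-1"] assms(2)] tangent_const[OF v, of "-1"]
  by simp

lemma tangent_sum:
  assumes v: "v \<in> tangent_space M p" and f: "\<And>j. j \<in> A \<Longrightarrow> smooth_near M p (f j)" and p: "p \<in> mpoints M"
  shows "v (\<lambda>q. \<Sum>j\<in>A. f j q) = (\<Sum>j\<in>A. v (f j))"
  using f
proof (induction A rule: infinite_finite_induct)
  case (insert j A)
  then show ?case
    using tangent_add[OF v, of "f j" "\<lambda>q. \<Sum>j\<in>A. f j q"] smooth_near_sum[OF p, of A f] by simp
qed (use tangent_const[OF v] in auto)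

subsection \<open>Cutoff functions\<close>

text \<open>The support of the cutoff in a chart is compact, hence closed in the manifold by the Hausdorff
  property; so continuing by zero outside the chart is smooth.  The open set \<open>V2\<close>, on which the cutoff
  vanishes, covers the manifold together with \<open>W\<close>; this makes it possible to check smoothness of
  products with functions that are only smooth on \<open>W\<close>.\<close>

lemma cutoff:
  assumes W: "openin (mtop M) W" "p \<in> W"
  shows "\<exists>\<psi> W1 V2. (\<forall>q\<in>mpoints M. smooth_near M q \<psi>) \<and>
    openin (mtop M) W1 \<and> p \<in> W1 \<and> W1 \<subseteq> W \<and> (\<forall>q\<in>W1. \<psi> q = 1) \<and>
    openin (mtop M) V2 \<and> V2 \<union> W = mpoints M \<and> (\<forall>q\<in>V2. \<psi> q = 0)"
proof -
  have "p \<in> mpoints M" using W openin_subset by blast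
  then obtain c where c: "c \<in> max_atlas M" "p \<in> fst c" using ex_chart atlas_chart by blast
  note ic = is_chart[OF c(1)]
  have oc: "fst c \<subseteq> mpoints M" using chart_open[OF c(1)] openin_subset by blast
  have "snd c p \<in> snd c ` (fst c \<inter> W)" using W c by auto
  from Euclidean_space_cutoff[OF chart_open_image[OF ic W(1)] this]
  obtain \<psi>0 K W0 where *: "\<And>k. Ck_on k (mdim M) (topspace (Euclidean_space (mdim M))) \<psi>0"
    "compactin (Euclidean_space (mdim M)) K" "K \<subseteq> snd c ` (fst c \<inter> W)" "openin (Euclidean_space (mdim M)) W0"
    "snd c p \<in> W0" "W0 \<subseteq> K" "\<forall>y\<in>W0. \<psi>0 y = 1" "\<forall>y\<in>topspace (Euclidean_space (mdim M)) - K. \<psi>0 y = 0"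
    by auto
  define K' where "K' = {q \<in> fst c. snd c q \<in> K}"
  define \<psi> where "\<psi> q = (if q \<in> fst c then \<psi>0 (snd c q) else 0)" for q
  have "K' \<subseteq> W"
  proof
    fix q assume q: "q \<in> K'"
    then obtain q' where "q' \<in> fst c" "q' \<in> W" "snd c q = snd c q'" using *(3) by (auto simp: K'_def)
    then show "q \<in> W" using q chart_inv[OF ic] by (metis (no_types, lifting) K'_def mem_Collect_eq)
  qed
  have "snd c ` K' = K" using *(3) by (auto simp: K'_def)
  then have "compactin (subtopology (Euclidean_space (mdim M)) (snd c ` fst c)) (snd c ` K')"
    using *(2,3) by (auto simp: compactin_subtopology)
  then have "compactin (subtopology (mtop M) (fst c)) K'"
    using homeomorphic_map_compactness[of "subtopology (mtop M) (fst c)" _ "snd c" K'] ic oc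
    by (auto simp: is_chart_def K'_def)
  then have "closedin (mtop M) K'"
    using smooth_manifold compactin_imp_closedin by (auto simp: compactin_subtopology smooth_manifold_def)
  then have o2: "openin (mtop M) (mpoints M - K')" by (simp add: closedin_def)
  have z: "\<psi> q = 0" if "q \<in> mpoints M - K'" for q
    using that *(8) chart_in_Euclidean_space[OF ic] by (auto simp: \<psi>_def K'_def)
  show ?thesis
  proof (rule exI[of _ \<psi>], rule exI[of _ "{q \<in> fst c. snd c q \<in> W0}"], rule exI[of _ "mpoints M - K'"], intro conjI ballI)
    show "smooth_near M q \<psi>" if "q \<in> mpoints M" for q
    proof (cases "q \<in> fst c")
      case True
      have "smooth_in M c (fst c) \<psi>"
        unfolding smooth_real_on_def
      proof
        fix k
        have "snd c ` (fst c \<inter> fst c) \<subseteq> topspace (Euclidean_space (mdim M))"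
          using chart_in_Euclidean_space[OF ic] by auto
        from Ck_on_subset[OF *(1) this] show "Ck_on k (mdim M) (snd c ` (fst c \<inter> fst c)) (in_chart c \<psi>)"
          by (rule Ck_on_cong[OF chart_open_image[OF ic chart_open[OF c(1)]], rotated])
             (auto simp: in_chart_eq[OF ic] \<psi>_def)
      qed
      then show ?thesis by (rule smooth_nearI[OF c(1) True chart_open[OF c(1)] True])
    next
      case False
      then have "q \<in> mpoints M - K'" using that by (auto simp: K'_def)
      then show ?thesis using smooth_near_cong[OF smooth_near_const[OF that, of 0] o2] z by auto
    qed
    show "openin (mtop M) {q \<in> fst c. snd c q \<in> W0}" by (rule chart_open_preimage[OF ic *(4)])
    show "{q \<in> fst c. snd c q \<in> W0} \<subseteq> W" using \<open>K' \<subseteq> W\<close> *(6) by (auto simp: K'_def)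
    show "mpoints M - K' \<union> W = mpoints M" using \<open>K' \<subseteq> W\<close> W openin_subset by blast
  qed (use c o2 z * in \<open>auto simp: \<psi>_def\<close>)
qed

end

section \<open>Vector bundles in bundle charts\<close>

locale smooth_bundle =
  fixes E :: "('a, 'e, 'z) vbundle_scheme"
  assumes vector_bundle: "vector_bundle E"

sublocale smooth_bundle \<subseteq> B: smooth_mfd "base E"
  using vector_bundle by unfold_locales (simp add: vector_bundle_def)

sublocale smooth_bundle \<subseteq> T: smooth_mfd "total E"
  using vector_bundle by unfold_locales (simp add: vector_bundle_def)

context smooth_bundle begin

abbreviation "N \<equiv> mdim (base E)"
abbreviation "tdom b \<equiv> fst (induced_chart E b)"

lemma mdim_total: "mdim (total E) = N + rk E"
  using vector_bundle by (simp add: vector_bundle_def)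

lemma base_chart: "is_bchart E b \<Longrightarrow> base_chart b \<in> max_atlas (base E)"
  by (simp add: is_bchart_def)

lemma fst_base_chart [simp]: "fst (base_chart b) = bdom b"
  and snd_base_chart [simp]: "snd (base_chart b) = bcoord b"
  by (simp_all add: base_chart_def)

lemma bdom_open: "is_bchart E b \<Longrightarrow> openin (mtop (base E)) (bdom b)"
  using B.chart_open[OF base_chart] by simp

lemma bdom_mpoints: "is_bchart E b \<Longrightarrow> p \<in> bdom b \<Longrightarrow> p \<in> mpoints (base E)"
  using bdom_open openin_subset by blast

lemma total_chart: "is_bchart E b \<Longrightarrow> induced_chart E b \<in> max_atlas (total E)"
  by (simp add: is_bchart_def)

lemma dom_iff: "w \<in> tdom b \<longleftrightarrow> w \<in> mpoints (total E) \<and> proj E w \<in> bdom b"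
  by (simp add: induced_chart_def)

lemma dom_open: "is_bchart E b \<Longrightarrow> openin (mtop (total E)) (tdom b)"
  using T.chart_open[OF total_chart] .

lemma induced_coord_base: "i < N \<Longrightarrow> snd (induced_chart E b) w i = bcoord b (proj E w) i"
  and induced_coord_fibre: "snd (induced_chart E b) w (N + \<alpha>) = bfib b w \<alpha>"
  by (simp_all add: induced_chart_def)

lemma proj_mpoints: "w \<in> mpoints (total E) \<Longrightarrow> proj E w \<in> mpoints (base E)"
  using vector_bundle by (auto simp: vector_bundle_def)

lemma ex_bchart: "p \<in> mpoints (base E) \<Longrightarrow> \<exists>b. is_bchart E b \<and> p \<in> bdom b"
  using vector_bundle by (auto simp: vector_bundle_def)

lemma bchart_at:
  assumes "p \<in> mpoints (base E)" shows "is_bchart E (bchart_at E p)" "p \<in> bdom (bchart_at E p)"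
  using someI_ex[OF ex_bchart[OF assms]] by (auto simp: bchart_at_def)

lemma fibreD: "w \<in> fibre E p \<Longrightarrow> w \<in> mpoints (total E) \<and> proj E w = p"
  by (simp add: fibre_def)

lemma in_own_fibre: "w \<in> mpoints (total E) \<Longrightarrow> w \<in> fibre E (proj E w)"
  by (simp add: fibre_def)

lemma fadd_fibre: "p \<in> mpoints (base E) \<Longrightarrow> u \<in> fibre E p \<Longrightarrow> v \<in> fibre E p \<Longrightarrow> fadd E u v \<in> fibre E p"
  and fscale_fibre: "p \<in> mpoints (base E) \<Longrightarrow> u \<in> fibre E p \<Longrightarrow> fscale E r u \<in> fibre E p"
  using vector_bundle by (auto simp: vector_bundle_def)

lemma bfib_bij:
  "is_bchart E b \<Longrightarrow> p \<in> bdom b \<Longrightarrow> bij_betw (bfib b) (fibre E p) (topspace (Euclidean_space (rk E)))"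
  by (simp add: is_bchart_def)

lemma bfib_fadd:
  "is_bchart E b \<Longrightarrow> p \<in> bdom b \<Longrightarrow> u \<in> fibre E p \<Longrightarrow> v \<in> fibre E p \<Longrightarrow> bfib b (fadd E u v) \<alpha> = bfib b u \<alpha> + bfib b v \<alpha>"
  and bfib_fscale:
  "is_bchart E b \<Longrightarrow> p \<in> bdom b \<Longrightarrow> u \<in> fibre E p \<Longrightarrow> bfib b (fscale E r u) \<alpha> = r * bfib b u \<alpha>"
  by (simp_all add: is_bchart_def)

lemma bfib_beyond: "is_bchart E b \<Longrightarrow> p \<in> bdom b \<Longrightarrow> w \<in> fibre E p \<Longrightarrow> rk E \<le> \<alpha> \<Longrightarrow> bfib b w \<alpha> = 0"
  using bfib_bij[of b p] by (auto simp: bij_betw_def topspace_Euclidean_space)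

lemma bfib_inj:
  assumes "is_bchart E b" "p \<in> bdom b" "u \<in> fibre E p" "v \<in> fibre E p" "\<And>\<alpha>. \<alpha> < rk E \<Longrightarrow> bfib b u \<alpha> = bfib b v \<alpha>"
  shows "u = v"
proof -
  have "bfib b u = bfib b v"
  proof
    fix \<alpha> show "bfib b u \<alpha> = bfib b v \<alpha>"
      using assms(5)[of \<alpha>] bfib_beyond[OF assms(1,2,3), of \<alpha>] bfib_beyond[OF assms(1,2,4), of \<alpha>]
      by (cases "\<alpha> < rk E") auto
  qed
  then show ?thesis using bfib_bij[OF assms(1,2)] assms(3,4) by (auto simp: bij_betw_def inj_on_def)
qed

lemma lincomb_at:
  assumes "is_bchart E b" "p \<in> bdom b"
  shows lincomb_fibre: "lincomb_at E b p a \<in> fibre E p"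
    and bfib_lincomb: "bfib b (lincomb_at E b p a) \<alpha> = (if \<alpha> < rk E then a \<alpha> else 0)"
proof -
  have m: "(\<lambda>\<alpha>. if \<alpha> < rk E then a \<alpha> else 0) \<in> bfib b ` fibre E p"
    using bfib_bij[OF assms] by (auto simp: bij_betw_def topspace_Euclidean_space)
  show "lincomb_at E b p a \<in> fibre E p" using inv_into_into[OF m] by (simp add: lincomb_at_def)
  show "bfib b (lincomb_at E b p a) \<alpha> = (if \<alpha> < rk E then a \<alpha> else 0)"
    using f_inv_into_f[OF m] by (simp add: lincomb_at_def)
qed

lemma lincomb_eqI:
  assumes "is_bchart E b" "p \<in> bdom b" "u \<in> fibre E p" "\<And>\<alpha>. \<alpha> < rk E \<Longrightarrow> bfib b u \<alpha> = a \<alpha>"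
  shows "lincomb_at E b p a = u"
  by (rule bfib_inj[OF assms(1,2) lincomb_fibre[OF assms(1,2)] assms(3)]) (simp add: bfib_lincomb[OF assms(1,2)] assms(4))

lemma basis_fibre: "is_bchart E b \<Longrightarrow> p \<in> bdom b \<Longrightarrow> basis_section E b \<beta> p \<in> fibre E p"
  and bfib_basis: "is_bchart E b \<Longrightarrow> p \<in> bdom b \<Longrightarrow> \<alpha> < rk E \<Longrightarrow>
    bfib b (basis_section E b \<beta> p) \<alpha> = (if \<alpha> = \<beta> then 1 else 0)"
  by (simp_all add: basis_section_def lincomb_fibre bfib_lincomb)

text \<open>The fibres carry no vector space type, so linearity is used through the fibre coordinates: the vector
  is built up from its components one basis vector at a time.\<close>

lemma linear_on_fibre:
  assumes b: "is_bchart E b" "p \<in> bdom b"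
    and add: "\<And>u v. u \<in> fibre E p \<Longrightarrow> v \<in> fibre E p \<Longrightarrow> \<phi> (fadd E u v) = \<phi> u + (\<phi> v :: real)"
    and scale: "\<And>r u. u \<in> fibre E p \<Longrightarrow> \<phi> (fscale E r u) = r * \<phi> u"
    and w: "w \<in> fibre E p"
  shows "\<phi> w = (\<Sum>\<beta><rk E. bfib b w \<beta> * \<phi> (basis_section E b \<beta> p))"
proof -
  have p: "p \<in> mpoints (base E)" using bdom_mpoints b by blast
  let ?l = "\<lambda>k. lincomb_at E b p (\<lambda>\<beta>. if \<beta> < k then bfib b w \<beta> else 0)"
  have "k \<le> rk E \<Longrightarrow> \<phi> (?l k) = (\<Sum>\<beta><k. bfib b w \<beta> * \<phi> (basis_section E b \<beta> p))" for k
  proof (induction k)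
    case 0
    have "?l 0 = fscale E 0 (?l 0)"
      by (rule lincomb_eqI[OF b fscale_fibre[OF p lincomb_fibre[OF b]]])
         (simp add: bfib_fscale[OF b lincomb_fibre[OF b]])
    then have "\<phi> (?l 0) = 0 * \<phi> (?l 0)" using scale[OF lincomb_fibre[OF b]] by metis
    then show ?case by simp
  next
    case (Suc k)
    let ?u = "fscale E (bfib b w k) (basis_section E b k p)"
    have u: "?u \<in> fibre E p" by (rule fscale_fibre[OF p basis_fibre[OF b]])
    have "?l (Suc k) = fadd E (?l k) ?u"
      by (rule lincomb_eqI[OF b fadd_fibre[OF p lincomb_fibre[OF b] u]])
         (auto simp: bfib_fadd[OF b lincomb_fibre[OF b] u] bfib_fscale[OF b basis_fibre[OF b]] bfib_lincomb[OF b] bfib_basis[OF b] less_Suc_eq)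
    then have "\<phi> (?l (Suc k)) = \<phi> (?l k) + bfib b w k * \<phi> (basis_section E b k p)"
      using add[OF lincomb_fibre[OF b] u] scale[OF basis_fibre[OF b]] by simp
    then show ?case using Suc by simp
  qed
  from this[of "rk E"] have "\<phi> (?l (rk E)) = (\<Sum>\<beta><rk E. bfib b w \<beta> * \<phi> (basis_section E b \<beta> p))" by simp
  moreover have "?l (rk E) = w" by (rule lincomb_eqI[OF b w]) simp
  ultimately show ?thesis by simp
qed

lemma bfib_change:
  assumes b: "is_bchart E b" "p \<in> bdom b" and b': "is_bchart E b'" "p \<in> bdom b'" and w: "w \<in> fibre E p"
  shows "bfib b' w \<alpha> = (\<Sum>\<beta><rk E. bfib b w \<beta> * bfib b' (basis_section E b \<beta> p) \<alpha>)"
  by (rule linear_on_fibre[OF b _ _ w, where \<phi> = "\<lambda>w. bfib b' w \<alpha>"])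
     (simp_all add: bfib_fadd[OF b'] bfib_fscale[OF b'])

lemma smooth_near_bfib: "is_bchart E b \<Longrightarrow> w \<in> tdom b \<Longrightarrow> smooth_near (total E) w (\<lambda>w. bfib b w \<alpha>)"
  using T.smooth_near_coord[OF total_chart, of b w "N + \<alpha>"] by (simp add: induced_coord_fibre)

text \<open>In bundle charts the projection forgets the last coordinates; its continuity is that of this map.\<close>

lemma proj_preimage_open:
  assumes W: "openin (mtop (base E)) W"
  shows "openin (mtop (total E)) {w \<in> mpoints (total E). proj E w \<in> W}"
proof (subst openin_subopen, intro ballI)
  fix w assume w: "w \<in> {w \<in> mpoints (total E). proj E w \<in> W}"
  obtain b where b: "is_bchart E b" "proj E w \<in> bdom b" using ex_bchart[OF proj_mpoints] w by blast
  note cb = B.is_chart[OF base_chart[OF b(1)]] and ct = T.is_chart[OF total_chart[OF b(1)]]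
  let ?tr = "\<lambda>(x :: nat \<Rightarrow> real) i. if i < N then x i else 0"
  define U where "U = {x \<in> topspace (Euclidean_space (N + rk E)). ?tr x \<in> bcoord b ` (bdom b \<inter> W)}"
  have U: "openin (Euclidean_space (mdim (total E))) U"
    unfolding U_def mdim_total
  proof (rule openin_continuous_map_preimage)
    show "continuous_map (Euclidean_space (N + rk E)) (Euclidean_space N) ?tr"
      unfolding continuous_map_componentwise_Euclidean_space
      using Ck_on_coord[of 0 "N + rk E" UNIV] by simp
    show "openin (Euclidean_space N) (bcoord b ` (bdom b \<inter> W))"
      using chart_open_image[OF cb W] by simp
  qed
  have tr: "?tr (snd (induced_chart E b) w') = bcoord b (proj E w')" if "w' \<in> tdom b" for w'
  proof -
    have "bcoord b (proj E w') \<in> topspace (Euclidean_space N)"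
      using chart_in_Euclidean_space[OF cb] that by (simp add: dom_iff)
    then show ?thesis by (auto simp: induced_coord_base topspace_Euclidean_space fun_eq_iff)
  qed
  show "\<exists>V. openin (mtop (total E)) V \<and> w \<in> V \<and> V \<subseteq> {w \<in> mpoints (total E). proj E w \<in> W}"
  proof (intro exI[of _ "{w' \<in> tdom b. snd (induced_chart E b) w' \<in> U}"] conjI subsetI)
    show "openin (mtop (total E)) {w' \<in> tdom b. snd (induced_chart E b) w' \<in> U}"
      by (rule chart_open_preimage[OF ct U])
    show "w \<in> {w' \<in> tdom b. snd (induced_chart E b) w' \<in> U}"
      using w b tr[of w] chart_in_Euclidean_space[OF ct, of w] by (simp add: dom_iff U_def mdim_total)
    fix w' assume "w' \<in> {w' \<in> tdom b. snd (induced_chart E b) w' \<in> U}"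
    then have w': "w' \<in> tdom b" "snd (induced_chart E b) w' \<in> U" by auto
    then have "bcoord b (proj E w') \<in> bcoord b ` (bdom b \<inter> W)" using tr by (auto simp: U_def)
    then obtain q where "q \<in> bdom b" "q \<in> W" "bcoord b (proj E w') = bcoord b q" by auto
    moreover have "inv_into (bdom b) (bcoord b) (bcoord b (proj E w')) = proj E w'"
      "inv_into (bdom b) (bcoord b) (bcoord b q) = q"
      using chart_inv[OF cb, of "proj E w'"] chart_inv[OF cb, of q] w'(1) \<open>q \<in> bdom b\<close>
      unfolding fst_base_chart snd_base_chart dom_iff by blast+
    ultimately have "proj E w' = q" by metis
    with w' \<open>q \<in> W\<close> show "w' \<in> {w \<in> mpoints (total E). proj E w \<in> W}" by (simp add: dom_iff)
  qed
qed

lemma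
  assumes b: "is_bchart E b" and w: "w \<in> tdom b" and f: "smooth_near (base E) (proj E w) f"
  shows smooth_near_proj_chart: "smooth_near (total E) w (\<lambda>w. f (proj E w))"
    and coord_deriv_proj: "i < N + rk E \<Longrightarrow> coord_deriv (induced_chart E b) i (\<lambda>w. f (proj E w)) w =
      (if i < N then coord_deriv (base_chart b) i f (proj E w) else 0)"
proof -
  note cb = B.is_chart[OF base_chart[OF b(1)]] and ct = T.is_chart[OF total_chart[OF b(1)]]
  obtain W where W: "openin (mtop (base E)) W" "proj E w \<in> W" "smooth_in (base E) (base_chart b) W f"
    using B.smooth_nearE[OF f base_chart[OF b]] .
  let ?W = "{w \<in> mpoints (total E). proj E w \<in> W}"
  have ww: "w \<in> ?W" using w W by (simp add: dom_iff)
  have s: "smooth_in (total E) (induced_chart E b) ?W (\<lambda>w. snd (base_chart b) (proj E w) j)" if "j < mdim (base E)" for j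
    by (rule T.smooth_in_chart_near[OF total_chart[OF b]])
       (use T.smooth_near_coord[OF total_chart[OF b], of _ j] that in \<open>simp add: induced_coord_base\<close>)
  have \<Phi>: "\<And>w. w \<in> tdom b \<Longrightarrow> w \<in> ?W \<Longrightarrow> proj E w \<in> fst (base_chart b) \<and> proj E w \<in> W"
    by (simp add: dom_iff)
  note comp = ct cb proj_preimage_open[OF W(1)] W(1) \<Phi> s W(3)
  show "smooth_near (total E) w (\<lambda>w. f (proj E w))"
    by (rule T.smooth_nearI[OF total_chart[OF b] w proj_preimage_open[OF W(1)] ww])
       (rule smooth_in_compose[OF comp])
  assume i: "i < N + rk E"
  have "coord_deriv (induced_chart E b) i (\<lambda>w. f (proj E w)) w =
    (\<Sum>j<N. coord_deriv (base_chart b) j f (proj E w) * coord_deriv (induced_chart E b) i (\<lambda>w. snd (base_chart b) (proj E w) j) w)"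
    by (rule coord_deriv_compose[OF comp w ww]) (use i in \<open>simp_all add: mdim_total\<close>)
  also have "\<dots> = (\<Sum>j<N. coord_deriv (base_chart b) j f (proj E w) * (if i = j then 1 else 0))"
  proof (rule sum.cong)
    fix j assume "j \<in> {..<N}"
    then show "coord_deriv (base_chart b) j f (proj E w) * coord_deriv (induced_chart E b) i (\<lambda>w. snd (base_chart b) (proj E w) j) w =
      coord_deriv (base_chart b) j f (proj E w) * (if i = j then 1 else 0)"
      using T.coord_deriv_coord[OF total_chart[OF b] w, of i j] i by (simp add: induced_coord_base mdim_total)
  qed simp
  also have "\<dots> = (if i < N then coord_deriv (base_chart b) i f (proj E w) else 0)"
    by (simp add: if_distrib cong: if_cong)
  finally show "coord_deriv (induced_chart E b) i (\<lambda>w. f (proj E w)) w =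
      (if i < N then coord_deriv (base_chart b) i f (proj E w) else 0)" .
qed

lemma smooth_near_proj:
  assumes "w \<in> mpoints (total E)" "smooth_near (base E) (proj E w) f"
  shows "smooth_near (total E) w (\<lambda>w. f (proj E w))"
proof -
  obtain b where "is_bchart E b" "proj E w \<in> bdom b" using ex_bchart[OF proj_mpoints[OF assms(1)]] by blast
  then show ?thesis using smooth_near_proj_chart assms by (simp add: dom_iff)
qed

text \<open>The entries of the transition matrix are the fibre coordinates of one chart along a basis section of
  the other, and in the latter's coordinates a basis section has constant fibre components.\<close>

lemma smooth_near_transition:
  assumes b: "is_bchart E b" "p \<in> bdom b" and b': "is_bchart E b'" "p \<in> bdom b'"
  shows "smooth_near (base E) p (\<lambda>q. bfib b' (basis_section E b \<beta> q) \<alpha>)"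
proof -
  note cb = B.is_chart[OF base_chart[OF b(1)]] and ct = T.is_chart[OF total_chart[OF b(1)]]
  let ?W = "bdom b \<inter> bdom b'" and ?\<Phi> = "basis_section E b \<beta>"
  have W: "openin (mtop (base E)) ?W" using bdom_open b b' by blast
  have D: "?\<Phi> q \<in> tdom b \<and> ?\<Phi> q \<in> tdom b'" if "q \<in> ?W" for q
    using fibreD[OF basis_fibre[OF b(1)], of q \<beta>] that by (auto simp: dom_iff)
  have "smooth_in (base E) (base_chart b) ?W (\<lambda>q. bfib b' (?\<Phi> q) \<alpha>)"
  proof (rule smooth_in_compose[OF cb ct W dom_open[OF b'(1)], where \<Phi> = ?\<Phi>])
    show "smooth_in (total E) (induced_chart E b) (tdom b') (\<lambda>w. bfib b' w \<alpha>)"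
      by (rule T.smooth_in_chart_near[OF total_chart[OF b(1)]]) (rule smooth_near_bfib[OF b'(1)])
    show "smooth_in (base E) (base_chart b) ?W (\<lambda>q. snd (induced_chart E b) (?\<Phi> q) j)" if "j < mdim (total E)" for j
    proof (rule B.smooth_in_chart_near[OF base_chart[OF b(1)]])
      fix q assume q: "q \<in> ?W"
      show "smooth_near (base E) q (\<lambda>q. snd (induced_chart E b) (?\<Phi> q) j)"
      proof (cases "j < N")
        case True
        show ?thesis
          by (rule B.smooth_near_cong[OF B.smooth_near_coord[OF base_chart[OF b(1)], of q j] W q])
             (use q True D fibreD[OF basis_fibre[OF b(1)]] in \<open>auto simp: induced_coord_base\<close>)
      next
        case False
        then obtain \<gamma> where j: "j = N + \<gamma>" by (metis le_add_diff_inverse not_less)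
        have "q \<in> mpoints (base E)" using q bdom_mpoints[OF b(1)] by blast
        from B.smooth_near_const[OF this, of "if \<gamma> = \<beta> then 1 else 0"] show ?thesis
          by (rule B.smooth_near_cong[OF _ W q])
             (use that in \<open>simp add: j induced_coord_fibre bfib_basis[OF b(1)] mdim_total\<close>)
      qed
    qed
  qed (use D in auto)
  then show ?thesis by (intro B.smooth_nearI[OF base_chart[OF b(1)] _ W]) (use b b' in auto)
qed

lemma slit_iff: "is_bchart E b \<Longrightarrow> w \<in> tdom b \<Longrightarrow> w \<in> slit E \<longleftrightarrow> (\<exists>\<alpha><rk E. bfib b w \<alpha> \<noteq> 0)"
proof -
  assume b: "is_bchart E b" and w: "w \<in> tdom b"
  have w': "w \<in> mpoints (total E)" "proj E w \<in> bdom b" "w \<in> fibre E (proj E w)" using w by (auto simp: dom_iff fibre_def)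
  have z: "fzero_of E w \<in> fibre E (proj E w)"
    unfolding fzero_of_def by (rule fscale_fibre[OF proj_mpoints[OF w'(1)] w'(3)])
  have bz: "bfib b (fzero_of E w) \<alpha> = 0" for \<alpha>
    by (simp add: fzero_of_def bfib_fscale[OF b w'(2,3)])
  show ?thesis
    using bfib_inj[OF b w'(2,3) z] w'(1) bz unfolding slit_def by (metis (mono_tags, lifting) mem_Collect_eq)
qed

text \<open>Outside the zero section some fibre coordinate is nonzero, and it stays so nearby.\<close>

lemma slit_open: "openin (mtop (total E)) (slit E)"
proof (subst openin_subopen, intro ballI)
  fix w assume w: "w \<in> slit E"
  then have w': "w \<in> mpoints (total E)" by (simp add: slit_def)
  obtain b where b: "is_bchart E b" "proj E w \<in> bdom b" using ex_bchart[OF proj_mpoints[OF w']] by blast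
  have wd: "w \<in> tdom b" using b w' by (simp add: dom_iff)
  then obtain \<alpha> where \<alpha>: "\<alpha> < rk E" "bfib b w \<alpha> \<noteq> 0" using slit_iff[OF b(1)] w by blast
  define U where "U = {x \<in> topspace (Euclidean_space (N + rk E)). x (N + \<alpha>) \<in> - {0}}"
  have U: "openin (Euclidean_space (mdim (total E))) U"
    unfolding U_def mdim_total
  proof (rule openin_continuous_map_preimage)
    show "continuous_map (Euclidean_space (N + rk E)) euclideanreal (\<lambda>x. x (N + \<alpha>))"
      using Ck_on_coord[of 0 "N + rk E" UNIV] by simp
  qed (simp add: open_Compl)
  note ct = T.is_chart[OF total_chart[OF b(1)]]
  show "\<exists>V. openin (mtop (total E)) V \<and> w \<in> V \<and> V \<subseteq> slit E"
  proof (intro exI[of _ "{w' \<in> tdom b. snd (induced_chart E b) w' \<in> U}"] conjI subsetI)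
    show "openin (mtop (total E)) {w' \<in> tdom b. snd (induced_chart E b) w' \<in> U}"
      by (rule chart_open_preimage[OF ct U])
    show "w \<in> {w' \<in> tdom b. snd (induced_chart E b) w' \<in> U}"
      using wd \<alpha> chart_in_Euclidean_space[OF ct, of w] by (simp add: U_def induced_coord_fibre mdim_total)
    show "w' \<in> slit E" if "w' \<in> {w' \<in> tdom b. snd (induced_chart E b) w' \<in> U}" for w'
      using that \<alpha> slit_iff[OF b(1), of w'] by (auto simp: U_def induced_coord_fibre)
  qed
qed

end

section \<open>The bracket of a Lie algebroid in coordinates\<close>

locale algebroid =
  fixes E :: "('a, 'e, 'z) algebroid_scheme"
  assumes lie_algebroid: "lie_algebroid E"

sublocale algebroid \<subseteq> smooth_bundle E
  using lie_algebroid by unfold_locales (simp add: lie_algebroid_def)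

context algebroid begin

lemma anchor_bundle_map: "anchor_bundle_map E"
  using lie_algebroid by (simp add: lie_algebroid_def)

lemma anchor_tangent: "p \<in> mpoints (base E) \<Longrightarrow> u \<in> fibre E p \<Longrightarrow> anchor E u \<in> tangent_space (base E) p"
  using anchor_bundle_map by (simp add: anchor_bundle_map_def)

lemma anchor_expand:
  assumes b: "is_bchart E b" "p \<in> bdom b" and u: "u \<in> fibre E p"
  shows "anchor E u f = (\<Sum>\<alpha><rk E. bfib b u \<alpha> * anchor E (basis_section E b \<alpha> p) f)"
proof (rule linear_on_fibre[OF b _ _ u, where \<phi> = "\<lambda>u. anchor E u f"])
  have p: "p \<in> mpoints (base E)" using bdom_mpoints b by blast
  show "anchor E (fadd E u v) f = anchor E u f + anchor E v f" if "u \<in> fibre E p" "v \<in> fibre E p" for u v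
    using anchor_bundle_map p that by (simp add: anchor_bundle_map_def)
  show "anchor E (fscale E r u) f = r * anchor E u f" if "u \<in> fibre E p" for u r
    using anchor_bundle_map p that by (simp add: anchor_bundle_map_def)
qed

lemma anchor_coeff_smooth:
  assumes b: "is_bchart E b" "p \<in> bdom b" and "\<alpha> < rk E" "i < N"
  shows "smooth_near (base E) p (anchor_coeff E b \<alpha> i)"
proof -
  have "smooth_fun_on (base E) (bdom b) (anchor_coeff E b \<alpha> i)"
    using anchor_bundle_map assms by (simp add: anchor_bundle_map_def)
  then show ?thesis using B.smooth_fun_on_iff[OF bdom_open[OF b(1)]] b by blast
qed

lemma anchor_basis:
  assumes b: "is_bchart E b" "p \<in> bdom b" and f: "smooth_near (base E) p f"
  shows "anchor E (basis_section E b \<alpha> p) f = (\<Sum>i<N. anchor_coeff E b \<alpha> i p * coord_deriv (base_chart b) i f p)"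
  using B.tangent_expand[OF anchor_tangent[OF bdom_mpoints[OF b] basis_fibre[OF b]] base_chart[OF b(1)] _ f] b
  by (simp add: anchor_coeff_def)

lemma section_fibre: "s \<in> sections E \<Longrightarrow> p \<in> mpoints (base E) \<Longrightarrow> s p \<in> fibre E p"
  by (simp add: sections_def smooth_section_on_def)

lemma section_smooth:
  assumes s: "s \<in> sections E" and b: "is_bchart E b" "p \<in> bdom b" and \<alpha>: "\<alpha> < rk E"
  shows "smooth_near (base E) p (\<lambda>p. bfib b (s p) \<alpha>)"
proof -
  have eq: "mpoints (base E) \<inter> bdom b = bdom b" using bdom_mpoints[OF b(1)] by blast
  have "smooth_fun_on (base E) (mpoints (base E) \<inter> bdom b) (\<lambda>p. bfib b (s p) \<alpha>)"
    using s b \<alpha> by (simp add: sections_def smooth_section_on_def)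
  then have "smooth_fun_on (base E) (bdom b) (\<lambda>p. bfib b (s p) \<alpha>)" unfolding eq .
  then show ?thesis using B.smooth_fun_on_iff[OF bdom_open[OF b(1)]] b by blast
qed

lemma sectionI:
  assumes "s \<in> extensional (mpoints (base E))" "\<And>p. p \<in> mpoints (base E) \<Longrightarrow> s p \<in> fibre E p"
    and "\<And>b p \<alpha>. is_bchart E b \<Longrightarrow> p \<in> bdom b \<Longrightarrow> \<alpha> < rk E \<Longrightarrow> smooth_near (base E) p (\<lambda>p. bfib b (s p) \<alpha>)"
  shows "s \<in> sections E"
  unfolding sections_def smooth_section_on_def
proof (safe intro!: assms(1,2))
  fix b \<alpha> assume b: "is_bchart E b" and "\<alpha> < rk E"
  then show "smooth_fun_on (base E) (mpoints (base E) \<inter> bdom b) (\<lambda>p. bfib b (s p) \<alpha>)"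
    using B.smooth_fun_on_iff[OF openin_Int[OF openin_topspace bdom_open[OF b]]] assms(3) by blast
qed

lemma sec_add_section:
  assumes s: "s \<in> sections E" and t: "t \<in> sections E"
  shows "sec_add E s t \<in> sections E"
proof (rule sectionI)
  fix b p \<alpha> assume b: "is_bchart E b" "p \<in> bdom b" and \<alpha>: "\<alpha> < rk E"
  show "smooth_near (base E) p (\<lambda>p. bfib b (sec_add E s t p) \<alpha>)"
    by (rule B.smooth_near_cong[OF B.smooth_near_add[OF section_smooth[OF s b \<alpha>] section_smooth[OF t b \<alpha>]] bdom_open[OF b(1)] b(2)])
       (use bdom_mpoints[OF b(1)] bfib_fadd[OF b(1)] section_fibre s t in \<open>simp add: sec_add_def\<close>)
qed (use fadd_fibre section_fibre s t in \<open>auto simp: sec_add_def\<close>)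

lemma sec_scale_section:
  assumes s: "s \<in> sections E" and f: "\<And>p. p \<in> mpoints (base E) \<Longrightarrow> smooth_near (base E) p f"
  shows "sec_scale E f s \<in> sections E"
proof (rule sectionI)
  fix b p \<alpha> assume b: "is_bchart E b" "p \<in> bdom b" and \<alpha>: "\<alpha> < rk E"
  show "smooth_near (base E) p (\<lambda>p. bfib b (sec_scale E f s p) \<alpha>)"
    by (rule B.smooth_near_cong[OF B.smooth_near_mult[OF f[OF bdom_mpoints[OF b]] section_smooth[OF s b \<alpha>]] bdom_open[OF b(1)] b(2)])
       (use bdom_mpoints[OF b(1)] bfib_fscale[OF b(1)] section_fibre s in \<open>simp add: sec_scale_def\<close>)
qed (use fscale_fibre section_fibre s in \<open>auto simp: sec_scale_def\<close>)

lemma bfib_sec_add: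
  assumes "is_bchart E b" "p \<in> bdom b" "s \<in> sections E" "t \<in> sections E"
  shows "bfib b (sec_add E s t p) \<alpha> = bfib b (s p) \<alpha> + bfib b (t p) \<alpha>"
  using assms bdom_mpoints[OF assms(1,2)] by (simp add: sec_add_def bfib_fadd section_fibre)

lemma bfib_sec_scale:
  assumes "is_bchart E b" "p \<in> bdom b" "s \<in> sections E"
  shows "bfib b (sec_scale E f s p) \<alpha> = f p * bfib b (s p) \<alpha>"
  using assms bdom_mpoints[OF assms(1,2)] by (simp add: sec_scale_def bfib_fscale section_fibre)

lemma bracket_axioms: "lie_bracket_on_sections E"
  using lie_algebroid by (simp add: lie_algebroid_def)

lemma brk_section: "s \<in> sections E \<Longrightarrow> t \<in> sections E \<Longrightarrow> brk E s t \<in> sections E"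
  and brk_add_left: "s \<in> sections E \<Longrightarrow> s' \<in> sections E \<Longrightarrow> t \<in> sections E \<Longrightarrow>
    brk E (sec_add E s s') t = sec_add E (brk E s t) (brk E s' t)"
  and brk_swap: "s \<in> sections E \<Longrightarrow> t \<in> sections E \<Longrightarrow> brk E s t = sec_scale E (\<lambda>_. -1) (brk E t s)"
  using bracket_axioms unfolding lie_bracket_on_sections_def by blast+

lemma brk_antisym:
  assumes "is_bchart E b" "p \<in> bdom b" "s \<in> sections E" "t \<in> sections E"
  shows "bfib b (brk E s t p) \<gamma> = - bfib b (brk E t s p) \<gamma>"
  by (subst brk_swap) (use assms in \<open>simp_all add: bfib_sec_scale brk_section\<close>)

lemma brk_add_right:
  assumes b: "is_bchart E b" "p \<in> bdom b" and s: "s \<in> sections E" "t \<in> sections E" "t' \<in> sections E"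
  shows "bfib b (brk E s (sec_add E t t') p) \<gamma> = bfib b (brk E s t p) \<gamma> + bfib b (brk E s t' p) \<gamma>"
  using brk_antisym[OF b s(1) sec_add_section[OF s(2,3)]] brk_antisym[OF b s(1,2)] brk_antisym[OF b s(1,3)]
  by (simp add: brk_add_left s bfib_sec_add[OF b] brk_section)

lemma brk_leibniz:
  assumes b: "is_bchart E b" "p \<in> bdom b" and s: "s \<in> sections E" "t \<in> sections E"
    and f: "\<And>p. p \<in> mpoints (base E) \<Longrightarrow> smooth_near (base E) p f"
  shows "bfib b (brk E s (sec_scale E f t) p) \<gamma> = f p * bfib b (brk E s t p) \<gamma> + anchor E (s p) f * bfib b (t p) \<gamma>"
proof -
  have "smooth_fun_on (base E) (mpoints (base E)) f"
    using f B.smooth_fun_on_iff[OF openin_topspace] by blast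
  then have "brk E s (sec_scale E f t) =
      sec_add E (sec_scale E f (brk E s t)) (sec_scale E (\<lambda>p. anchor E (s p) f) t)"
    using lie_algebroid s by (simp add: lie_algebroid_def)
  then show ?thesis
    using bdom_mpoints[OF b] fscale_fibre section_fibre brk_section s
    by (simp add: sec_add_def sec_scale_def bfib_fadd[OF b] bfib_fscale[OF b])
qed

text \<open>Multiplied by a cutoff function, the two second arguments become equal; by the Leibniz rule this does not
  change the bracket at a point near which the cutoff is equal to one.\<close>

lemma brk_local_right:
  assumes b: "is_bchart E b" "p \<in> bdom b" and s: "s \<in> sections E" "t \<in> sections E" "t' \<in> sections E"
    and W: "openin (mtop (base E)) W" "p \<in> W" "\<And>q. q \<in> W \<Longrightarrow> t q = t' q"
  shows "bfib b (brk E s t p) \<gamma> = bfib b (brk E s t' p) \<gamma>"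
proof -
  have p: "p \<in> mpoints (base E)" using bdom_mpoints b by blast
  obtain \<psi> W1 V2 where \<psi>': "\<forall>q\<in>mpoints (base E). smooth_near (base E) q \<psi>"
    "openin (mtop (base E)) W1" "p \<in> W1" "W1 \<subseteq> W" "\<forall>q\<in>W1. \<psi> q = 1"
    "openin (mtop (base E)) V2" "V2 \<union> W = mpoints (base E)" "\<forall>q\<in>V2. \<psi> q = 0"
    using B.cutoff[OF W(1,2)] by (elim exE conjE)
  note \<psi> = \<psi>'(1)[rule_format] \<psi>'(2-4) \<psi>'(5)[rule_format] \<psi>'(6,7) \<psi>'(8)[rule_format]
  have "anchor E (s p) \<psi> = anchor E (s p) (\<lambda>_. 1)"
    by (rule B.tangent_cong[OF anchor_tangent[OF p section_fibre[OF s(1) p]] \<psi>(2,3)]) (use \<psi> in auto)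
  then have a0: "anchor E (s p) \<psi> = 0"
    using B.tangent_const[OF anchor_tangent[OF p section_fibre[OF s(1) p]]] by simp
  have "sec_scale E \<psi> t = sec_scale E \<psi> t'"
  proof
    fix q show "sec_scale E \<psi> t q = sec_scale E \<psi> t' q"
    proof (cases "q \<in> mpoints (base E) - W")
      case True
      then have q: "q \<in> mpoints (base E)" "\<psi> q = 0" using \<psi>(7,8) by auto
      obtain c where c: "is_bchart E c" "q \<in> bdom c" using ex_bchart q by blast
      have "fscale E 0 (t q) = fscale E 0 (t' q)"
        using section_fibre[OF s(2) q(1)] section_fibre[OF s(3) q(1)]
        by (intro bfib_inj[OF c]) (auto simp: fscale_fibre q(1) bfib_fscale[OF c])
      then show ?thesis using q by (simp add: sec_scale_def)
    qed (use W in \<open>auto simp: sec_scale_def\<close>)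
  qed
  then have "bfib b (brk E s (sec_scale E \<psi> t) p) \<gamma> = bfib b (brk E s (sec_scale E \<psi> t') p) \<gamma>" by simp
  then show ?thesis
    using \<psi>(3,5) by (simp add: brk_leibniz[OF b s(1) s(2) \<psi>(1)] brk_leibniz[OF b s(1) s(3) \<psi>(1)] a0)
qed

lemma brk_local:
  assumes b: "is_bchart E b" "p \<in> bdom b"
    and s: "s \<in> sections E" "s' \<in> sections E" and t: "t \<in> sections E" "t' \<in> sections E"
    and W: "openin (mtop (base E)) W" "p \<in> W" "\<And>q. q \<in> W \<Longrightarrow> s q = s' q \<and> t q = t' q"
  shows "brk E s t p = brk E s' t' p"
proof (rule bfib_inj[OF b])
  have p: "p \<in> mpoints (base E)" using bdom_mpoints b by blast
  show "brk E s t p \<in> fibre E p" "brk E s' t' p \<in> fibre E p"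
    using section_fibre[OF brk_section p] s t by blast+
  fix \<gamma>
  have "bfib b (brk E s t p) \<gamma> = bfib b (brk E s t' p) \<gamma>"
    by (rule brk_local_right[OF b s(1) t W(1,2)]) (use W in auto)
  also have "\<dots> = - bfib b (brk E t' s p) \<gamma>" by (rule brk_antisym[OF b s(1) t(2)])
  also have "bfib b (brk E t' s p) \<gamma> = bfib b (brk E t' s' p) \<gamma>"
    by (rule brk_local_right[OF b t(2) s W(1,2)]) (use W in auto)
  also have "- bfib b (brk E t' s' p) \<gamma> = bfib b (brk E s' t' p) \<gamma>" by (rule brk_antisym[OF b s(2) t(2), symmetric])
  finally show "bfib b (brk E s t p) \<gamma> = bfib b (brk E s' t' p) \<gamma>" .
qed

text \<open>By locality every choice of global representatives gives the same value.\<close>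

lemma local_brk_eq:
  assumes b: "is_bchart E b" "p \<in> bdom b" and s: "s' \<in> sections E" "t' \<in> sections E"
    and W: "openin (mtop (base E)) W" "p \<in> W" "\<And>q. q \<in> W \<Longrightarrow> s' q = s q \<and> t' q = t q"
  shows "local_brk E s t p = brk E s' t' p"
  unfolding local_brk_def
proof (rule some_equality)
  show "\<exists>s'a\<in>sections E. \<exists>t'a\<in>sections E.
       (\<exists>W. openin (mtop (base E)) W \<and> p \<in> W \<and> (\<forall>q\<in>W. s'a q = s q \<and> t'a q = t q)) \<and> brk E s' t' p = brk E s'a t'a p"
    using s W by blast
  fix u assume "\<exists>s'\<in>sections E. \<exists>t'\<in>sections E.
       (\<exists>W. openin (mtop (base E)) W \<and> p \<in> W \<and> (\<forall>q\<in>W. s' q = s q \<and> t' q = t q)) \<and> u = brk E s' t' p"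
  then obtain s2 t2 W2 where 2: "s2 \<in> sections E" "t2 \<in> sections E" "openin (mtop (base E)) W2" "p \<in> W2"
      "\<forall>q\<in>W2. s2 q = s q \<and> t2 q = t q" "u = brk E s2 t2 p" by blast
  have "brk E s2 t2 p = brk E s' t' p"
    by (rule brk_local[OF b 2(1) s(1) 2(2) s(2) openin_Int[OF 2(3) W(1)]]) (use 2 W in auto)
  then show "u = brk E s' t' p" using 2 by simp
qed

text \<open>A local frame agrees near a given point with global sections, and a function on the domain of the
  frame becomes global after multiplication with the same cutoff function.\<close>

definition extends_frame ::
  "('a, 'e) bchart \<Rightarrow> ('a \<Rightarrow> real) \<Rightarrow> (nat \<Rightarrow> 'a \<Rightarrow> 'e) \<Rightarrow> 'a set \<Rightarrow> bool" where
  "extends_frame b \<psi> e W \<longleftrightarrow> openin (mtop (base E)) W \<and> W \<subseteq> bdom b \<and> (\<forall>q\<in>W. \<psi> q = 1) \<and>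
    (\<forall>\<beta>. e \<beta> \<in> sections E) \<and> (\<forall>\<beta>. \<forall>q\<in>W. e \<beta> q = basis_section E b \<beta> q) \<and>
    (\<forall>F. (\<forall>q\<in>bdom b. smooth_near (base E) q F) \<longrightarrow>
      (\<forall>q\<in>mpoints (base E). smooth_near (base E) q (\<lambda>q. \<psi> q * F q)))"

lemma extends_frameD:
  assumes "extends_frame b \<psi> e W"
  shows "openin (mtop (base E)) W" "W \<subseteq> bdom b" "q \<in> W \<Longrightarrow> \<psi> q = 1" "e \<beta> \<in> sections E"
    "q \<in> W \<Longrightarrow> e \<beta> q = basis_section E b \<beta> q"
    "(\<And>q. q \<in> bdom b \<Longrightarrow> smooth_near (base E) q F) \<Longrightarrow> q \<in> mpoints (base E) \<Longrightarrow>
       smooth_near (base E) q (\<lambda>q. \<psi> q * F q)"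
  using assms by (simp_all add: extends_frame_def)

lemma global_frame:
  assumes b: "is_bchart E b" "p \<in> bdom b"
  shows "\<exists>\<psi> e W. extends_frame b \<psi> e W \<and> p \<in> W"
proof -
  obtain \<psi> W1 V2 where \<psi>': "\<forall>q\<in>mpoints (base E). smooth_near (base E) q \<psi>"
    "openin (mtop (base E)) W1" "p \<in> W1" "W1 \<subseteq> bdom b" "\<forall>q\<in>W1. \<psi> q = 1"
    "openin (mtop (base E)) V2" "V2 \<union> bdom b = mpoints (base E)" "\<forall>q\<in>V2. \<psi> q = 0"
    using B.cutoff[OF bdom_open[OF b(1)] b(2)] by (elim exE conjE)
  note \<psi> = \<psi>'(1)[rule_format] \<psi>'(2-4) \<psi>'(5)[rule_format] \<psi>'(6,7) \<psi>'(8)[rule_format]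
  have ext: "smooth_near (base E) q (\<lambda>q. \<psi> q * (F q :: real))"
    if F: "\<And>q. q \<in> U \<Longrightarrow> smooth_near (base E) q F" and q: "q \<in> V2 \<union> U" "q \<in> mpoints (base E)" for F q U
  proof (cases "q \<in> V2")
    case True
    show ?thesis by (rule B.smooth_near_cong[OF B.smooth_near_const[OF q(2), of 0] \<psi>(6) True]) (simp add: \<psi>(8))
  next
    case False then show ?thesis using q B.smooth_near_mult[OF \<psi>(1) F] by blast
  qed
  define e where "e \<beta> = (\<lambda>q\<in>mpoints (base E). if q \<in> bdom b
      then lincomb_at E b q (\<lambda>\<alpha>. \<psi> q * (if \<alpha> = \<beta> then 1 else 0))
      else lincomb_at E (bchart_at E q) q (\<lambda>_. 0))" for \<beta>
  have ef: "e \<beta> q \<in> fibre E q" if "q \<in> mpoints (base E)" for q \<beta>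
    using that bchart_at b(1) by (auto simp: e_def lincomb_fibre)
  have eb: "bfib b' (e \<beta> q) \<alpha> = \<psi> q * (if q \<in> bdom b then bfib b' (basis_section E b \<beta> q) \<alpha> else 0)"
    if b': "is_bchart E b'" "q \<in> bdom b'" for b' q \<alpha> \<beta>
  proof (cases "q \<in> bdom b")
    case True
    have "e \<beta> q = fscale E (\<psi> q) (basis_section E b \<beta> q)"
      using True bdom_mpoints[OF b(1) True] fscale_fibre basis_fibre[OF b(1) True]
      by (auto simp: e_def bfib_fscale[OF b(1) True] bfib_basis[OF b(1) True] intro!: lincomb_eqI[OF b(1) True])
    then show ?thesis using True bfib_fscale[OF b' basis_fibre[OF b(1) True]] by simp
  next
    case False
    have q: "q \<in> mpoints (base E)" using bdom_mpoints b' by blast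
    show ?thesis
      using False q bfib_change[OF bchart_at[OF q] b' ef[OF q, of \<beta>], of \<alpha>]
      by (simp add: e_def bfib_lincomb[OF bchart_at[OF q]])
  qed
  have "e \<beta> \<in> sections E" for \<beta>
  proof (rule sectionI[OF _ ef])
    show "e \<beta> \<in> extensional (mpoints (base E))" by (simp add: e_def)
    fix b' q \<alpha> assume b': "is_bchart E b'" "q \<in> bdom b'" and "\<alpha> < rk E"
    have q: "q \<in> mpoints (base E)" using bdom_mpoints b' by blast
    let ?F = "\<lambda>q. if q \<in> bdom b then bfib b' (basis_section E b \<beta> q) \<alpha> else 0"
    have "smooth_near (base E) q (\<lambda>q. \<psi> q * ?F q)"
    proof (rule ext[of "bdom b \<inter> bdom b'" ?F])
      fix q assume q: "q \<in> bdom b \<inter> bdom b'"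
      have "smooth_near (base E) q (\<lambda>q. bfib b' (basis_section E b \<beta> q) \<alpha>)"
        using smooth_near_transition b b' q by blast
      then show "smooth_near (base E) q ?F"
        by (rule B.smooth_near_cong[OF _ bdom_open[OF b(1)]]) (use q in auto)
    qed (use q \<psi>(7) b' in auto)
    then show "smooth_near (base E) q (\<lambda>q. bfib b' (e \<beta> q) \<alpha>)"
      by (rule B.smooth_near_cong[OF _ bdom_open[OF b'(1)] b'(2)]) (simp add: eb[OF b'(1)])
  qed
  moreover have "e \<beta> q = basis_section E b \<beta> q" if "q \<in> W1" for \<beta> q
  proof -
    have q: "q \<in> bdom b" using \<psi>(4) that by blast
    show ?thesis
      by (rule bfib_inj[OF b(1) q ef[OF bdom_mpoints[OF b(1) q]] basis_fibre[OF b(1) q]]) (simp add: eb[OF b(1) q] q \<psi>(5)[OF that])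
  qed
  moreover have "smooth_near (base E) q (\<lambda>q. \<psi> q * F q)"
    if "\<forall>q\<in>bdom b. smooth_near (base E) q F" "q \<in> mpoints (base E)" for F q
    by (rule ext[of "bdom b"]) (use that \<psi>(7) in auto)
  ultimately have "extends_frame b \<psi> e W1"
    unfolding extends_frame_def using \<psi>(2,4,5) by blast
  then show ?thesis using \<psi>(3) by blast
qed

lemma struct_fun_eq:
  assumes b: "is_bchart E b" "p \<in> bdom b" and "e \<alpha> \<in> sections E" "e \<beta> \<in> sections E"
    and W: "openin (mtop (base E)) W" "p \<in> W" "\<And>\<beta> q. q \<in> W \<Longrightarrow> e \<beta> q = basis_section E b \<beta> q"
  shows "struct_fun E b \<alpha> \<beta> \<gamma> p = bfib b (brk E (e \<alpha>) (e \<beta>) p) \<gamma>"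
  unfolding struct_fun_def by (subst local_brk_eq[OF b assms(3,4) W(1,2)]) (use W in auto)

lemma struct_fun_antisym:
  assumes b: "is_bchart E b" "p \<in> bdom b"
  shows "struct_fun E b \<alpha> \<beta> \<gamma> p = - struct_fun E b \<beta> \<alpha> \<gamma> p"
proof -
  obtain \<psi> e W where fr: "extends_frame b \<psi> e W" and pW: "p \<in> W" using global_frame[OF b] by blast
  note W = extends_frameD(1)[OF fr] pW extends_frameD(2)[OF fr] and e = extends_frameD(4,5)[OF fr]
  show ?thesis
    using brk_antisym[OF b e(1) e(1), of \<alpha> \<beta> \<gamma>] struct_fun_eq[where e = e, OF b e(1) e(1) W(1,2) e(2)] by simp
qed

lemma struct_fun_smooth:
  assumes b: "is_bchart E b" "p \<in> bdom b" and \<gamma>: "\<gamma> < rk E"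
  shows "smooth_near (base E) p (struct_fun E b \<alpha> \<beta> \<gamma>)"
proof -
  obtain \<psi> e W where fr: "extends_frame b \<psi> e W" and pW: "p \<in> W" using global_frame[OF b] by blast
  note W = extends_frameD(1)[OF fr] pW extends_frameD(2)[OF fr] and e = extends_frameD(4,5)[OF fr]
  show ?thesis
  proof (rule B.smooth_near_cong[OF section_smooth[OF brk_section[OF e(1)[of \<alpha>] e(1)[of \<beta>]] b \<gamma>] W(1,2)])
    fix q assume q: "q \<in> W"
    then have "q \<in> bdom b" using W(3) by blast
    from struct_fun_eq[where e = e, OF b(1) this e(1) e(1) W(1) q e(2)]
    show "bfib b (brk E (e \<alpha>) (e \<beta>) q) \<gamma> = struct_fun E b \<alpha> \<beta> \<gamma> q" by simp
  qed
qed

text \<open>The empty sum has to be a section; it is written as a multiple by zero of one of the given ones.\<close>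

primrec sec_sum :: "nat \<Rightarrow> (nat \<Rightarrow> 'a \<Rightarrow> real) \<Rightarrow> (nat \<Rightarrow> 'a \<Rightarrow> 'e) \<Rightarrow> 'a \<Rightarrow> 'e" where
  "sec_sum 0 f e = sec_scale E (\<lambda>_. 0) (e 0)"
| "sec_sum (Suc k) f e = sec_add E (sec_sum k f e) (sec_scale E (f k) (e k))"

lemma sec_sum_section:
  assumes "\<And>\<beta>. e \<beta> \<in> sections E" "\<And>\<beta> p. \<beta> < k \<Longrightarrow> p \<in> mpoints (base E) \<Longrightarrow> smooth_near (base E) p (f \<beta>)"
  shows "sec_sum k f e \<in> sections E"
  using assms(2)
proof (induction k)
  case 0
  show ?case using assms(1) B.smooth_near_const by (simp add: sec_scale_section)
next
  case (Suc k)
  then show ?case using assms(1) by (simp add: sec_scale_section sec_add_section)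
qed

lemma bfib_sec_sum:
  assumes b: "is_bchart E b" "p \<in> bdom b" and e: "\<And>\<beta>. e \<beta> \<in> sections E"
    and f: "\<And>\<beta> p. \<beta> < k \<Longrightarrow> p \<in> mpoints (base E) \<Longrightarrow> smooth_near (base E) p (f \<beta>)"
  shows "bfib b (sec_sum k f e p) \<gamma> = (\<Sum>\<beta><k. f \<beta> p * bfib b (e \<beta> p) \<gamma>)"
  using f
proof (induction k)
  case 0 then show ?case by (simp add: bfib_sec_scale[OF b e])
next
  case (Suc k)
  have "sec_sum k f e \<in> sections E" by (rule sec_sum_section[OF e]) (use Suc.prems in auto)
  moreover have "sec_scale E (f k) (e k) \<in> sections E" by (rule sec_scale_section[OF e]) (use Suc.prems in auto)
  ultimately show ?case using Suc by (simp add: bfib_sec_add[OF b] bfib_sec_scale[OF b e])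
qed

lemma brk_sec_sum:
  assumes b: "is_bchart E b" "p \<in> bdom b" and s: "s \<in> sections E" and e: "\<And>\<beta>. e \<beta> \<in> sections E"
    and f: "\<And>\<beta> p. \<beta> < k \<Longrightarrow> p \<in> mpoints (base E) \<Longrightarrow> smooth_near (base E) p (f \<beta>)"
  shows "bfib b (brk E s (sec_sum k f e) p) \<gamma> =
    (\<Sum>\<beta><k. f \<beta> p * bfib b (brk E s (e \<beta>) p) \<gamma> + anchor E (s p) (f \<beta>) * bfib b (e \<beta> p) \<gamma>)"
  using f
proof (induction k)
  case 0
  have p: "p \<in> mpoints (base E)" using bdom_mpoints b by blast
  show ?case
    using brk_leibniz[OF b s e[of 0] B.smooth_near_const, of 0 \<gamma>] B.tangent_const[OF anchor_tangent[OF p section_fibre[OF s p]], of 0]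
    by simp
next
  case (Suc k)
  have 1: "sec_sum k f e \<in> sections E" by (rule sec_sum_section[OF e]) (use Suc.prems in auto)
  have 2: "sec_scale E (f k) (e k) \<in> sections E" by (rule sec_scale_section[OF e]) (use Suc.prems in auto)
  show ?case
    using Suc by (simp add: brk_add_right[OF b s 1 2] brk_leibniz[OF b s e])
qed

text \<open>Near the point \<open>t\<close> is the combination of the global frame with its own components, made global by the
  cutoff \<open>\<psi>\<close>; the derivatives of the components in the Leibniz rule add up to the second term.\<close>

lemma brk_frame:
  assumes b: "is_bchart E b" "p \<in> bdom b" and s: "s \<in> sections E" and t: "t \<in> sections E"
    and fr: "extends_frame b \<psi> e W" and pW: "p \<in> W"
    and \<gamma>: "\<gamma> < rk E"
  shows "bfib b (brk E s t p) \<gamma> =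
    (\<Sum>\<beta><rk E. bfib b (t p) \<beta> * bfib b (brk E s (e \<beta>) p) \<gamma>) + anchor E (s p) (\<lambda>q. bfib b (t q) \<gamma>)"
proof -
  note W = extends_frameD(1)[OF fr] pW extends_frameD(2,5,3)[OF fr]
    and e = extends_frameD(4)[OF fr] and ext = extends_frameD(6)[OF fr]
  have p: "p \<in> mpoints (base E)" using bdom_mpoints b by blast
  let ?f = "\<lambda>\<beta> q. \<psi> q * bfib b (t q) \<beta>"
  have f: "smooth_near (base E) q (?f \<beta>)" if "\<beta> < rk E" "q \<in> mpoints (base E)" for \<beta> q
    using ext[OF section_smooth[OF t b(1) _ that(1)] that(2)] .
  let ?t = "sec_sum (rk E) ?f e"
  have tt: "?t \<in> sections E" by (rule sec_sum_section[OF e f])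
  have eq: "t q = ?t q" if q: "q \<in> W" for q
  proof -
    have qb: "q \<in> bdom b" using W q by blast
    show ?thesis
    proof (rule bfib_inj[OF b(1) qb])
      show "t q \<in> fibre E q" "?t q \<in> fibre E q" using section_fibre tt t bdom_mpoints[OF b(1) qb] by blast+
      fix \<alpha> assume "\<alpha> < rk E"
      then show "bfib b (t q) \<alpha> = bfib b (?t q) \<alpha>"
        using W(4,5) q by (simp add: bfib_sec_sum[OF b(1) qb e f] bfib_basis[OF b(1) qb] if_distrib cong: if_cong)
    qed
  qed
  have "bfib b (brk E s t p) \<gamma> = bfib b (brk E s ?t p) \<gamma>"
    by (rule brk_local_right[OF b s t tt W(1,2) eq])
  also have "\<dots> = (\<Sum>\<beta><rk E. ?f \<beta> p * bfib b (brk E s (e \<beta>) p) \<gamma> + anchor E (s p) (?f \<beta>) * bfib b (e \<beta> p) \<gamma>)"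
    by (rule brk_sec_sum[OF b s e f])
  also have "\<dots> = (\<Sum>\<beta><rk E. bfib b (t p) \<beta> * bfib b (brk E s (e \<beta>) p) \<gamma>) + (\<Sum>\<beta><rk E. anchor E (s p) (?f \<beta>) * (if \<gamma> = \<beta> then 1 else 0))"
    using W(2,4,5) \<gamma> by (simp add: sum.distrib bfib_basis[OF b])
  also have "(\<Sum>\<beta><rk E. anchor E (s p) (?f \<beta>) * (if \<gamma> = \<beta> then 1 else 0)) = anchor E (s p) (?f \<gamma>)"
    using \<gamma> by (simp add: if_distrib cong: if_cong)
  also have "anchor E (s p) (?f \<gamma>) = anchor E (s p) (\<lambda>q. bfib b (t q) \<gamma>)"
    by (rule B.tangent_cong[OF anchor_tangent[OF p section_fibre[OF s p]] W(1,2)]) (simp add: W(5))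
  finally show ?thesis .
qed

text \<open>The expansion of \<open>brk_frame\<close>, applied in the second argument and then, after exchanging the arguments,
  in the first.\<close>

lemma brk_coord:
  assumes b: "is_bchart E b" "p \<in> bdom b" and s: "s \<in> sections E" and t: "t \<in> sections E" and \<gamma>: "\<gamma> < rk E"
  shows "bfib b (brk E s t p) \<gamma> = anchor E (s p) (\<lambda>q. bfib b (t q) \<gamma>) - anchor E (t p) (\<lambda>q. bfib b (s q) \<gamma>) +
    (\<Sum>\<alpha><rk E. \<Sum>\<beta><rk E. bfib b (s p) \<alpha> * bfib b (t p) \<beta> * struct_fun E b \<alpha> \<beta> \<gamma> p)"
proof -
  have p: "p \<in> mpoints (base E)" using bdom_mpoints b by blast
  obtain \<psi> e W where fr: "extends_frame b \<psi> e W" and pW: "p \<in> W" using global_frame[OF b] by blast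
  note W = extends_frameD(1)[OF fr] pW extends_frameD(2)[OF fr] and e = extends_frameD(4,5)[OF fr]
  note frame = brk_frame[OF b _ _ fr pW \<gamma>]
  have L: "bfib b (brk E (e \<beta>) (e \<alpha>) p) \<gamma> = - struct_fun E b \<alpha> \<beta> \<gamma> p" for \<alpha> \<beta>
    using struct_fun_eq[where e = e, OF b e(1) e(1) W(1,2) e(2), of \<beta> \<alpha> \<gamma>] struct_fun_antisym[OF b, of \<alpha> \<beta> \<gamma>] by simp
  have "bfib b (brk E s (e \<beta>) p) \<gamma> = (\<Sum>\<alpha><rk E. bfib b (s p) \<alpha> * struct_fun E b \<alpha> \<beta> \<gamma> p) -
      anchor E (basis_section E b \<beta> p) (\<lambda>q. bfib b (s q) \<gamma>)" for \<beta>
    using brk_antisym[OF b s e(1), of \<beta> \<gamma>] frame[OF e(1) s, of \<beta>] W(2) e(2) by (simp add: L sum_negf)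
  then have "bfib b (brk E s t p) \<gamma> = (\<Sum>\<beta><rk E. bfib b (t p) \<beta> * ((\<Sum>\<alpha><rk E. bfib b (s p) \<alpha> * struct_fun E b \<alpha> \<beta> \<gamma> p) -
      anchor E (basis_section E b \<beta> p) (\<lambda>q. bfib b (s q) \<gamma>))) + anchor E (s p) (\<lambda>q. bfib b (t q) \<gamma>)"
    using frame[OF s t] by simp
  also have "\<dots> = (\<Sum>\<beta><rk E. \<Sum>\<alpha><rk E. bfib b (s p) \<alpha> * bfib b (t p) \<beta> * struct_fun E b \<alpha> \<beta> \<gamma> p) -
      (\<Sum>\<beta><rk E. bfib b (t p) \<beta> * anchor E (basis_section E b \<beta> p) (\<lambda>q. bfib b (s q) \<gamma>)) + anchor E (s p) (\<lambda>q. bfib b (t q) \<gamma>)"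
    by (simp add: right_diff_distrib sum_subtractf sum_distrib_left ac_simps)
  also have "(\<Sum>\<beta><rk E. bfib b (t p) \<beta> * anchor E (basis_section E b \<beta> p) (\<lambda>q. bfib b (s q) \<gamma>)) = anchor E (t p) (\<lambda>q. bfib b (s q) \<gamma>)"
    using anchor_expand[OF b section_fibre[OF t p]] by simp
  also have "(\<Sum>\<beta><rk E. \<Sum>\<alpha><rk E. bfib b (s p) \<alpha> * bfib b (t p) \<beta> * struct_fun E b \<alpha> \<beta> \<gamma> p) =
    (\<Sum>\<alpha><rk E. \<Sum>\<beta><rk E. bfib b (s p) \<alpha> * bfib b (t p) \<beta> * struct_fun E b \<alpha> \<beta> \<gamma> p)" by (rule sum.swap)
  finally show ?thesis by simp
qed

text \<open>The coordinate formula in the chart \<open>b'\<close> for the bracket of two basis sections of \<open>b\<close>.\<close>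

lemma struct_fun_change:
  assumes b: "is_bchart E b" "p \<in> bdom b" and b': "is_bchart E b'" "p \<in> bdom b'" and \<gamma>: "\<gamma> < rk E"
  defines "A \<equiv> \<lambda>\<alpha> \<beta> q. bfib b' (basis_section E b \<beta> q) \<alpha>"
  shows "(\<Sum>\<kappa><rk E. struct_fun E b \<mu> \<nu> \<kappa> p * A \<gamma> \<kappa> p) =
    anchor E (basis_section E b \<mu> p) (A \<gamma> \<nu>) - anchor E (basis_section E b \<nu> p) (A \<gamma> \<mu>) +
    (\<Sum>\<alpha><rk E. \<Sum>\<beta><rk E. A \<alpha> \<mu> p * A \<beta> \<nu> p * struct_fun E b' \<alpha> \<beta> \<gamma> p)"
proof -
  have p: "p \<in> mpoints (base E)" using bdom_mpoints b by blast
  obtain \<psi> e W where fr: "extends_frame b \<psi> e W" and pW: "p \<in> W" using global_frame[OF b] by blast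
  note W = extends_frameD(1)[OF fr] pW extends_frameD(2)[OF fr] and e = extends_frameD(4,5)[OF fr]
  have a: "anchor E (e \<mu> p) (\<lambda>q. bfib b' (e \<nu> q) \<gamma>) = anchor E (basis_section E b \<mu> p) (A \<gamma> \<nu>)" for \<mu> \<nu>
  proof -
    have "anchor E (e \<mu> p) (\<lambda>q. bfib b' (e \<nu> q) \<gamma>) = anchor E (e \<mu> p) (A \<gamma> \<nu>)"
      by (rule B.tangent_cong[OF anchor_tangent[OF p section_fibre[OF e(1) p]] W(1,2)]) (simp add: A_def e(2))
    then show ?thesis by (simp only: e(2)[OF pW])
  qed
  have "(\<Sum>\<kappa><rk E. struct_fun E b \<mu> \<nu> \<kappa> p * A \<gamma> \<kappa> p) = bfib b' (brk E (e \<mu>) (e \<nu>) p) \<gamma>"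
    using bfib_change[OF b b' section_fibre[OF brk_section[OF e(1) e(1)] p]]
      struct_fun_eq[where e = e, OF b e(1) e(1) W(1,2) e(2)] by (simp add: A_def)
  then show ?thesis
    using brk_coord[OF b' e(1) e(1) \<gamma>, of \<mu> \<nu>] a e(2) W(2) by (simp add: A_def)
qed

text \<open>The anchor maps the bracket of two basis sections to a commutator of vector fields; evaluating both on
  a coordinate function gives this identity.\<close>

lemma struct_fun_anchor:
  assumes b: "is_bchart E b" "p \<in> bdom b" and \<alpha>: "\<alpha> < rk E" "\<beta> < rk E" and j: "j < N"
  shows "(\<Sum>\<gamma><rk E. struct_fun E b \<alpha> \<beta> \<gamma> p * anchor_coeff E b \<gamma> j p) =
    (\<Sum>i<N. anchor_coeff E b \<alpha> i p * coord_deriv (base_chart b) i (anchor_coeff E b \<beta> j) p) -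
    (\<Sum>i<N. anchor_coeff E b \<beta> i p * coord_deriv (base_chart b) i (anchor_coeff E b \<alpha> j) p)"
proof -
  have p: "p \<in> mpoints (base E)" using bdom_mpoints b by blast
  obtain \<psi> e W where fr: "extends_frame b \<psi> e W" and pW: "p \<in> W" using global_frame[OF b] by blast
  note W = extends_frameD(1)[OF fr] pW extends_frameD(2)[OF fr] and e = extends_frameD(4,5)[OF fr]
  let ?x = "\<lambda>q. bcoord b q j"
  have sx: "smooth_near (base E) p ?x"
    using B.smooth_near_coord[OF base_chart[OF b(1)], of p j] b by simp
  have a: "anchor E (e \<alpha> p) (\<lambda>q. anchor E (e \<beta> q) ?x) =
      (\<Sum>i<N. anchor_coeff E b \<alpha> i p * coord_deriv (base_chart b) i (anchor_coeff E b \<beta> j) p)"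
    if "\<beta> < rk E" for \<alpha> \<beta>
  proof -
    have "anchor E (e \<alpha> p) (\<lambda>q. anchor E (e \<beta> q) ?x) = anchor E (e \<alpha> p) (anchor_coeff E b \<beta> j)"
      by (rule B.tangent_cong[OF anchor_tangent[OF p section_fibre[OF e(1) p]] W(1,2)])
         (simp add: e(2) anchor_coeff_def)
    then show ?thesis
      using anchor_basis[OF b anchor_coeff_smooth[OF b that j]] e(2) W(2) by simp
  qed
  have "(\<Sum>\<gamma><rk E. struct_fun E b \<alpha> \<beta> \<gamma> p * anchor_coeff E b \<gamma> j p) = anchor E (brk E (e \<alpha>) (e \<beta>) p) ?x"
    using anchor_expand[OF b section_fibre[OF brk_section[OF e(1) e(1)] p], of \<alpha> \<beta> ?x]
      struct_fun_eq[where e = e, OF b e(1) e(1) W(1,2) e(2)] by (simp add: anchor_coeff_def)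
  also have "anchor E (brk E (e \<alpha>) (e \<beta>) p) = vf_bracket (base E) (\<lambda>q. anchor E (e \<alpha> q)) (\<lambda>q. anchor E (e \<beta> q)) p"
    using lie_algebroid e(1) p by (simp add: lie_algebroid_def)
  also have "\<dots> ?x = anchor E (e \<alpha> p) (\<lambda>q. anchor E (e \<beta> q) ?x) - anchor E (e \<beta> p) (\<lambda>q. anchor E (e \<alpha> q) ?x)"
    using sx by (simp add: vf_bracket_def)
  finally show ?thesis using a \<alpha> by simp
qed

end

section \<open>The prolongation: frames, brackets and their independence of the chart\<close>

lemma sum_lessThan_add: "sum f {..<m + (n::nat)} = sum f {..<m} + (\<Sum>i<n. f (m + i) :: real)"
  by (induction n) (auto simp: add.assoc)

context algebroid begin

definition prol_coeff :: "('a, 'e) bchart \<Rightarrow> 'e \<Rightarrow> (nat \<Rightarrow> real) \<Rightarrow> (nat \<Rightarrow> real) \<Rightarrow> nat \<Rightarrow> real" where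
  "prol_coeff b w a c i = (if i < N then \<Sum>\<alpha><rk E. a \<alpha> * anchor_coeff E b \<alpha> i (proj E w) else c (i - N))"

lemma prol_comb_eq: "prol_comb E b w a c =
    (lincomb_at E b (proj E w) a, tvec (total E) (induced_chart E b) w (prol_coeff b w a c))"
  by (simp add: prol_comb_def prol_coeff_def[abs_def])

lemma tdomD: assumes "w \<in> tdom b" shows "w \<in> mpoints (total E)" "proj E w \<in> bdom b"
  using assms by (simp_all add: dom_iff)

lemma prol_comb_fibre:
  assumes b: "is_bchart E b" and w: "w \<in> tdom b"
  shows "prol_comb E b w a c \<in> prol_fibre E w"
proof -
  have w': "w \<in> mpoints (total E)" "proj E w \<in> bdom b" using w by (simp_all add: dom_iff)
  let ?p = "proj E w" and ?u = "lincomb_at E b (proj E w) a" and ?v = "tvec (total E) (induced_chart E b) w (prol_coeff b w a c)"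
  have u: "?u \<in> fibre E ?p" by (rule lincomb_fibre[OF b w'(2)])
  have "anchor E ?u f = push_proj E w ?v f" for f
  proof (cases "smooth_near (base E) ?p f")
    case True
    have "push_proj E w ?v f = (\<Sum>i<N + rk E. prol_coeff b w a c i * coord_deriv (induced_chart E b) i (\<lambda>w. f (proj E w)) w)"
      using True smooth_near_proj[OF w'(1) True] by (simp add: push_proj_def tvec_def mdim_total)
    also have "\<dots> = (\<Sum>i<N. (\<Sum>\<alpha><rk E. a \<alpha> * anchor_coeff E b \<alpha> i ?p) * coord_deriv (base_chart b) i f ?p)"
      by (simp add: sum_lessThan_add coord_deriv_proj[OF b w True] prol_coeff_def)
    also have "\<dots> = (\<Sum>\<alpha><rk E. a \<alpha> * anchor E (basis_section E b \<alpha> ?p) f)"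
      by (simp add: anchor_basis[OF b w'(2) True] sum_distrib_left sum_distrib_right ac_simps) (rule sum.swap)
    also have "\<dots> = anchor E ?u f"
      by (simp add: anchor_expand[OF b w'(2) u] bfib_lincomb[OF b w'(2)])
    finally show ?thesis by simp
  next
    case False
    then show ?thesis
      using B.tangent_nonsmooth[OF anchor_tangent[OF bdom_mpoints[OF b w'(2)] u]] by (simp add: push_proj_def)
  qed
  then show ?thesis
    using u T.tvec_tangent[OF total_chart[OF b] w] by (auto simp: prol_comb_eq prol_fibre_def)
qed

lemma Xdual_comb: "is_bchart E b \<Longrightarrow> w \<in> tdom b \<Longrightarrow> \<alpha> < rk E \<Longrightarrow> Xdual b \<alpha> (prol_comb E b w a c) = a \<alpha>"
  by (simp add: Xdual_def prol_comb_eq bfib_lincomb dom_iff)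

lemma Vdual_comb: "is_bchart E b \<Longrightarrow> w \<in> tdom b \<Longrightarrow> \<alpha> < rk E \<Longrightarrow> Vdual b \<alpha> (prol_comb E b w a c) = c \<alpha>"
  using T.tvec_coord[OF total_chart, of b w "N + \<alpha>"]
  by (simp add: Vdual_def prol_comb_eq induced_coord_fibre mdim_total prol_coeff_def)

lemma prol_fibreD:
  assumes "z \<in> prol_fibre E w"
  shows "fst z \<in> fibre E (proj E w)" "snd z \<in> tangent_space (total E) w" "anchor E (fst z) = push_proj E w (snd z)"
  using assms by (auto simp: prol_fibre_def)

lemma prol_fibre_proj:
  assumes "z \<in> prol_fibre E w" "smooth_near (base E) (proj E w) f"
  shows "snd z (\<lambda>w. f (proj E w)) = anchor E (fst z) f"
  using prol_fibreD(3)[OF assms(1)] assms(2) by (simp add: push_proj_def)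

text \<open>The components along the base directions are not free: the condition that \<open>v\<close> projects to the anchor of
  \<open>u\<close> expresses them by the fibre coordinates of \<open>u\<close>.\<close>

lemma prol_fibre_comb:
  assumes b: "is_bchart E b" and w: "w \<in> tdom b" and z: "z \<in> prol_fibre E w"
  shows "z = prol_comb E b w (\<lambda>\<alpha>. Xdual b \<alpha> z) (\<lambda>\<alpha>. Vdual b \<alpha> z)"
proof -
  note w' = tdomD[OF w]
  have "lincomb_at E b (proj E w) (\<lambda>\<alpha>. Xdual b \<alpha> z) = fst z"
    by (rule lincomb_eqI[OF b w'(2) prol_fibreD(1)[OF z]]) (simp add: Xdual_def)
  moreover have "snd z = tvec (total E) (induced_chart E b) w (prol_coeff b w (\<lambda>\<alpha>. Xdual b \<alpha> z) (\<lambda>\<alpha>. Vdual b \<alpha> z))"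
  proof (rule T.tangent_eq_tvec[OF prol_fibreD(2)[OF z] total_chart[OF b] w])
    fix i assume i: "i < mdim (total E)"
    show "snd z (\<lambda>q. snd (induced_chart E b) q i) = prol_coeff b w (\<lambda>\<alpha>. Xdual b \<alpha> z) (\<lambda>\<alpha>. Vdual b \<alpha> z) i"
    proof (cases "i < N")
      case True
      have "smooth_near (base E) (proj E w) (\<lambda>q. bcoord b q i)"
        using B.smooth_near_coord[OF base_chart[OF b], of "proj E w" i] w' by simp
      then show ?thesis
        using True prol_fibre_proj[OF z, of "\<lambda>q. bcoord b q i"]
        by (simp add: induced_coord_base prol_coeff_def anchor_expand[OF b w'(2) prol_fibreD(1)[OF z]] anchor_coeff_def Xdual_def)
    next
      case False
      then obtain \<alpha> where "i = N + \<alpha>" by (metis le_add_diff_inverse not_less)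
      then show ?thesis by (simp add: induced_coord_fibre prol_coeff_def Vdual_def)
    qed
  qed
  ultimately show ?thesis by (simp add: prol_comb_eq prod_eq_iff)
qed

lemma prol_eqI:
  assumes b: "is_bchart E b" and w: "w \<in> tdom b" and z: "z \<in> prol_fibre E w" "z' \<in> prol_fibre E w"
    and "\<And>\<alpha>. \<alpha> < rk E \<Longrightarrow> Xdual b \<alpha> z = Xdual b \<alpha> z'" "\<And>\<alpha>. \<alpha> < rk E \<Longrightarrow> Vdual b \<alpha> z = Vdual b \<alpha> z'"
  shows "z = z'"
proof (rule prod_eqI)
  note w' = tdomD[OF w]
  show f: "fst z = fst z'"
    by (rule bfib_inj[OF b w'(2) prol_fibreD(1)[OF z(1)] prol_fibreD(1)[OF z(2)]]) (use assms(5) in \<open>simp add: Xdual_def\<close>)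
  show "snd z = snd z'"
  proof (rule T.tangent_eqI[OF prol_fibreD(2)[OF z(1)] prol_fibreD(2)[OF z(2)] total_chart[OF b] w])
    fix i assume i: "i < mdim (total E)"
    show "snd z (\<lambda>q. snd (induced_chart E b) q i) = snd z' (\<lambda>q. snd (induced_chart E b) q i)"
    proof (cases "i < N")
      case True
      have "smooth_near (base E) (proj E w) (\<lambda>q. bcoord b q i)"
        using B.smooth_near_coord[OF base_chart[OF b], of "proj E w" i] w' by simp
      then show ?thesis
        using True prol_fibre_proj[OF z(1), of "\<lambda>q. bcoord b q i"] prol_fibre_proj[OF z(2), of "\<lambda>q. bcoord b q i"] f
        by (simp add: induced_coord_base)
    next
      case False
      then obtain \<alpha> where \<alpha>: "i = N + \<alpha>" by (metis le_add_diff_inverse not_less)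
      then show ?thesis using assms(6)[of \<alpha>] i by (simp add: induced_coord_fibre Vdual_def mdim_total)
    qed
  qed
qed

subsection \<open>The local frame as derivations\<close>

definition unit_coeff :: "nat \<Rightarrow> nat \<Rightarrow> real" where
  "unit_coeff \<alpha> \<beta> = (if \<beta> = \<alpha> then 1 else 0)"

lemma sum_unit_coeff: "k < m \<Longrightarrow> (\<Sum>\<alpha><m. unit_coeff k \<alpha> * g \<alpha>) = g k"
  by (simp add: unit_coeff_def mult_delta_left)

text \<open>The frame is indexed by a single number: the horizontal vectors come first, then the vertical ones.
  This keeps the bracket computations to one double sum.\<close>

definition frame :: "('a, 'e) bchart \<Rightarrow> nat \<Rightarrow> 'e \<Rightarrow> ('e \<Rightarrow> real) \<Rightarrow> real" where
  "frame b k w = snd (if k < rk E then prol_comb E b w (unit_coeff k) (\<lambda>_. 0)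
                      else prol_comb E b w (\<lambda>_. 0) (unit_coeff (k - rk E)))"

definition frame_coord :: "('a, 'e) bchart \<Rightarrow> nat \<Rightarrow> 'e prol \<Rightarrow> real" where
  "frame_coord b k z = (if k < rk E then Xdual b k z else Vdual b (k - rk E) z)"

lemma frame_tangent: "is_bchart E b \<Longrightarrow> w \<in> tdom b \<Longrightarrow> frame b k w \<in> tangent_space (total E) w"
  by (simp add: frame_def prol_fibreD(2)[OF prol_comb_fibre])

lemma frame_horizontal:
  assumes "smooth_near (total E) w f" "k < rk E"
  shows "frame b k w f = (\<Sum>i<N. anchor_coeff E b k i (proj E w) * coord_deriv (induced_chart E b) i f w)"
proof -
  show ?thesis
    using assms by (simp add: frame_def prol_comb_eq tvec_def mdim_total sum_lessThan_add prol_coeff_def sum_unit_coeff)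
qed

lemma frame_vertical:
  assumes "smooth_near (total E) w f" "\<alpha> < rk E"
  shows "frame b (rk E + \<alpha>) w f = dy E b \<alpha> f w"
  using assms
  by (simp add: frame_def prol_comb_eq tvec_def mdim_total sum_lessThan_add prol_coeff_def sum_unit_coeff dy_def)

lemma dy_smooth:
  assumes b: "is_bchart E b" and w: "w \<in> tdom b" and f: "smooth_near (total E) w f" and \<alpha>: "\<alpha> < rk E"
  shows "smooth_near (total E) w (dy E b \<alpha> f)"
  unfolding dy_def by (rule T.smooth_near_coord_deriv[OF total_chart[OF b] w f]) (use \<alpha> in \<open>simp add: mdim_total\<close>)

lemma smooth_near_on_tdom:
  assumes b: "is_bchart E b" and w: "w \<in> tdom b" and f: "smooth_near (total E) w f"
  shows "\<exists>W. openin (mtop (total E)) W \<and> w \<in> W \<and> W \<subseteq> tdom b \<and> (\<forall>q\<in>W. smooth_near (total E) q f)"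
proof -
  obtain W where "openin (mtop (total E)) W" "w \<in> W" "\<forall>q\<in>W. smooth_near (total E) q f"
    using T.smooth_near_nhd[OF f] by blast
  then show ?thesis using dom_open[OF b] w by (intro exI[of _ "W \<inter> tdom b"]) auto
qed

lemma frame_smooth:
  assumes b: "is_bchart E b" and w: "w \<in> tdom b" and f: "smooth_near (total E) w f" and k: "k < rk E + rk E"
  shows "smooth_near (total E) w (\<lambda>w. frame b k w f)"
proof -
  obtain W where W: "openin (mtop (total E)) W" "w \<in> W" "W \<subseteq> tdom b" "\<forall>q\<in>W. smooth_near (total E) q f"
    using smooth_near_on_tdom[OF b w f] by blast
  note w' = tdomD[OF w]
  show ?thesis
  proof (cases "k < rk E")
    case True
    have "smooth_near (total E) w (\<lambda>w. \<Sum>i<N. anchor_coeff E b k i (proj E w) * coord_deriv (induced_chart E b) i f w)"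
      by (intro T.smooth_near_sum T.smooth_near_mult smooth_near_proj w' anchor_coeff_smooth[OF b w'(2) True]
          T.smooth_near_coord_deriv[OF total_chart[OF b] w f]) (auto simp: mdim_total)
    then show ?thesis
      by (rule T.smooth_near_cong[OF _ W(1,2)]) (use W(4) True in \<open>simp add: frame_horizontal\<close>)
  next
    case False
    then obtain \<alpha> where \<alpha>: "k = rk E + \<alpha>" "\<alpha> < rk E" using k by (metis add_less_cancel_left le_add_diff_inverse not_less)
    show ?thesis
      by (rule T.smooth_near_cong[OF dy_smooth[OF b w f \<alpha>(2)] W(1,2)]) (use W(4) \<alpha> in \<open>simp add: frame_vertical\<close>)
  qed
qed

lemma prol_expand:
  assumes b: "is_bchart E b" and w: "w \<in> tdom b" and z: "z \<in> prol_fibre E w" and f: "smooth_near (total E) w f"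
  shows "snd z f = (\<Sum>k<rk E + rk E. frame_coord b k z * frame b k w f)"
proof -
  have "snd z f = (\<Sum>i<N. (\<Sum>\<alpha><rk E. Xdual b \<alpha> z * anchor_coeff E b \<alpha> i (proj E w)) * coord_deriv (induced_chart E b) i f w) +
      (\<Sum>\<alpha><rk E. Vdual b \<alpha> z * dy E b \<alpha> f w)"
    by (subst prol_fibre_comb[OF b w z])
       (simp add: prol_comb_eq tvec_def f mdim_total sum_lessThan_add prol_coeff_def dy_def)
  also have "(\<Sum>i<N. (\<Sum>\<alpha><rk E. Xdual b \<alpha> z * anchor_coeff E b \<alpha> i (proj E w)) * coord_deriv (induced_chart E b) i f w) =
      (\<Sum>\<alpha><rk E. Xdual b \<alpha> z * frame b \<alpha> w f)"
    by (simp add: frame_horizontal[OF f] sum_distrib_left sum_distrib_right ac_simps) (rule sum.swap)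
  finally show ?thesis
    by (simp add: sum_lessThan_add frame_coord_def frame_vertical[OF f])
qed

lemma frame_proj:
  assumes b: "is_bchart E b" and w: "w \<in> tdom b" and f: "smooth_near (base E) (proj E w) f"
  shows "k < rk E \<Longrightarrow> frame b k w (\<lambda>w. f (proj E w)) = (\<Sum>i<N. anchor_coeff E b k i (proj E w) * coord_deriv (base_chart b) i f (proj E w))"
    and "\<alpha> < rk E \<Longrightarrow> frame b (rk E + \<alpha>) w (\<lambda>w. f (proj E w)) = 0"
  using smooth_near_proj_chart[OF b w f] coord_deriv_proj[OF b w f]
  by (simp_all add: frame_horizontal frame_vertical dy_def)

lemma frame_frame_horizontal:
  assumes b: "is_bchart E b" and w: "w \<in> tdom b" and f: "smooth_near (total E) w f"
    and v: "v \<in> tangent_space (total E) w" and k: "k < rk E"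
  shows "v (\<lambda>w. frame b k w f) = (\<Sum>j<N. v (\<lambda>w. anchor_coeff E b k j (proj E w)) * coord_deriv (induced_chart E b) j f w) +
    (\<Sum>j<N. anchor_coeff E b k j (proj E w) * v (coord_deriv (induced_chart E b) j f))"
proof -
  obtain W where W: "openin (mtop (total E)) W" "w \<in> W" "W \<subseteq> tdom b" "\<forall>q\<in>W. smooth_near (total E) q f"
    using smooth_near_on_tdom[OF b w f] by blast
  note w' = tdomD[OF w]
  have s: "smooth_near (total E) w (\<lambda>w. anchor_coeff E b k j (proj E w))" "smooth_near (total E) w (coord_deriv (induced_chart E b) j f)"
    if "j < N" for j
    using that smooth_near_proj_chart[OF b w anchor_coeff_smooth[OF b w'(2) k that]]
      T.smooth_near_coord_deriv[OF total_chart[OF b] w f, of j] by (simp_all add: mdim_total)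
  have "v (\<lambda>w. frame b k w f) = v (\<lambda>w. \<Sum>j<N. anchor_coeff E b k j (proj E w) * coord_deriv (induced_chart E b) j f w)"
    by (rule T.tangent_cong[OF v W(1,2)]) (use W(4) k in \<open>simp add: frame_horizontal\<close>)
  also have "\<dots> = (\<Sum>j<N. v (\<lambda>w. anchor_coeff E b k j (proj E w) * coord_deriv (induced_chart E b) j f w))"
    by (rule T.tangent_sum[OF v _ w'(1)]) (use s T.smooth_near_mult in auto)
  also have "\<dots> = (\<Sum>j<N. v (\<lambda>w. anchor_coeff E b k j (proj E w)) * coord_deriv (induced_chart E b) j f w +
      anchor_coeff E b k j (proj E w) * v (coord_deriv (induced_chart E b) j f))"
    by (rule sum.cong) (use T.tangent_mult[OF v s] in auto)
  finally show ?thesis by (simp add: sum.distrib)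
qed

lemma frame_frame_vertical:
  assumes b: "is_bchart E b" and w: "w \<in> tdom b" and f: "smooth_near (total E) w f"
    and v: "v \<in> tangent_space (total E) w" and \<alpha>: "\<alpha> < rk E"
  shows "v (\<lambda>w. frame b (rk E + \<alpha>) w f) = v (coord_deriv (induced_chart E b) (N + \<alpha>) f)"
proof -
  obtain W where W: "openin (mtop (total E)) W" "w \<in> W" "W \<subseteq> tdom b" "\<forall>q\<in>W. smooth_near (total E) q f"
    using smooth_near_on_tdom[OF b w f] by blast
  show ?thesis
    by (rule T.tangent_cong[OF v W(1,2)]) (use W(4) \<alpha> in \<open>simp add: frame_vertical dy_def\<close>)
qed

text \<open>Symmetry of second partial derivatives leaves only the derivatives of the anchor coefficients,
  which \<open>struct_fun_anchor\<close> turns into the structure functions.\<close>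

lemma frame_commutator:
  assumes b: "is_bchart E b" and w: "w \<in> tdom b" and f: "smooth_near (total E) w f"
    and k: "k < rk E + rk E" and l: "l < rk E + rk E"
  shows "frame b k w (\<lambda>w. frame b l w f) - frame b l w (\<lambda>w. frame b k w f) =
    (if k < rk E \<and> l < rk E then \<Sum>\<gamma><rk E. struct_fun E b k l \<gamma> (proj E w) * frame b \<gamma> w f else 0)"
proof -
  note w' = tdomD[OF w]
  let ?c = "induced_chart E b"
  let ?\<sigma> = "\<lambda>k i. anchor_coeff E b k i (proj E w)"
  have sd: "smooth_near (total E) w (coord_deriv ?c j f)" if "j < N + rk E" for j
    using T.smooth_near_coord_deriv[OF total_chart[OF b] w f] that by (simp add: mdim_total)
  have comm: "coord_deriv ?c i (coord_deriv ?c j f) w = coord_deriv ?c j (coord_deriv ?c i f) w" if "i < N + rk E" "j < N + rk E" for i j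
    using T.coord_deriv_commute[OF total_chart[OF b] w f] that by (simp add: mdim_total)
  have HH: "frame b k w (\<lambda>w. frame b l w f) =
      (\<Sum>j<N. (\<Sum>i<N. ?\<sigma> k i * coord_deriv (base_chart b) i (anchor_coeff E b l j) (proj E w)) * coord_deriv ?c j f w) +
      (\<Sum>j<N. \<Sum>i<N. ?\<sigma> l j * ?\<sigma> k i * coord_deriv ?c i (coord_deriv ?c j f) w)"
    if "k < rk E" "l < rk E" for k l
    using that sd
    by (simp add: frame_frame_horizontal[OF b w f frame_tangent[OF b w]] frame_proj(1)[OF b w anchor_coeff_smooth[OF b w'(2)]]
        frame_horizontal sum_distrib_left mult.assoc)
  have HV: "frame b k w (\<lambda>w. frame b (rk E + \<alpha>) w f) = (\<Sum>i<N. ?\<sigma> k i * coord_deriv ?c i (coord_deriv ?c (N + \<alpha>) f) w)"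
    if "k < rk E" "\<alpha> < rk E" for k \<alpha>
    using that sd[of "N + \<alpha>"] by (simp add: frame_frame_vertical[OF b w f frame_tangent[OF b w]] frame_horizontal)
  have VH: "frame b (rk E + \<alpha>) w (\<lambda>w. frame b k w f) = (\<Sum>j<N. ?\<sigma> k j * coord_deriv ?c (N + \<alpha>) (coord_deriv ?c j f) w)"
    if "k < rk E" "\<alpha> < rk E" for k \<alpha>
    using that sd
    by (simp add: frame_frame_horizontal[OF b w f frame_tangent[OF b w]] frame_proj(2)[OF b w anchor_coeff_smooth[OF b w'(2)]]
        frame_vertical dy_def)
  have VV: "frame b (rk E + \<alpha>) w (\<lambda>w. frame b (rk E + \<beta>) w f) = coord_deriv ?c (N + \<alpha>) (coord_deriv ?c (N + \<beta>) f) w"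
    if "\<alpha> < rk E" "\<beta> < rk E" for \<alpha> \<beta>
    using that sd[of "N + \<beta>"] by (simp add: frame_frame_vertical[OF b w f frame_tangent[OF b w]] frame_vertical dy_def)
  have split: "k < rk E \<or> (\<exists>\<alpha><rk E. k = rk E + \<alpha>)" if "k < rk E + rk E" for k
    using that by (metis add_less_cancel_left le_add_diff_inverse not_less)
  have HVVH: "frame b k w (\<lambda>w. frame b (rk E + \<alpha>) w f) = frame b (rk E + \<alpha>) w (\<lambda>w. frame b k w f)"
    if "k < rk E" "\<alpha> < rk E" for k \<alpha>
    unfolding HV[OF that] VH[OF that] by (rule sum.cong) (use comm that in auto)
  show ?thesis
  proof (cases "k < rk E \<and> l < rk E")
    case True
    have "(\<Sum>j<N. \<Sum>i<N. ?\<sigma> l j * ?\<sigma> k i * coord_deriv ?c i (coord_deriv ?c j f) w) =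
      (\<Sum>j<N. \<Sum>i<N. ?\<sigma> k j * ?\<sigma> l i * coord_deriv ?c i (coord_deriv ?c j f) w)"
      by (subst sum.swap) (intro sum.cong refl, use comm in auto)
    then have "frame b k w (\<lambda>w. frame b l w f) - frame b l w (\<lambda>w. frame b k w f) =
      (\<Sum>j<N. ((\<Sum>i<N. ?\<sigma> k i * coord_deriv (base_chart b) i (anchor_coeff E b l j) (proj E w)) -
         (\<Sum>i<N. ?\<sigma> l i * coord_deriv (base_chart b) i (anchor_coeff E b k j) (proj E w))) * coord_deriv ?c j f w)"
      using True by (simp add: HH left_diff_distrib sum_subtractf)
    also have "\<dots> = (\<Sum>j<N. (\<Sum>\<gamma><rk E. struct_fun E b k l \<gamma> (proj E w) * ?\<sigma> \<gamma> j) * coord_deriv ?c j f w)"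
      by (rule sum.cong) (use True struct_fun_anchor[OF b w'(2)] in auto)
    also have "\<dots> = (\<Sum>\<gamma><rk E. struct_fun E b k l \<gamma> (proj E w) * frame b \<gamma> w f)"
      by (simp add: frame_horizontal[OF f] sum_distrib_left sum_distrib_right ac_simps) (rule sum.swap)
    finally show ?thesis using True by simp
  next
    case False
    then consider \<alpha> where "k < rk E" "\<alpha> < rk E" "l = rk E + \<alpha>" | \<alpha> where "l < rk E" "\<alpha> < rk E" "k = rk E + \<alpha>"
      | \<alpha> \<beta> where "\<alpha> < rk E" "\<beta> < rk E" "k = rk E + \<alpha>" "l = rk E + \<beta>"
      using split[OF k] split[OF l] by blast
    then have "frame b k w (\<lambda>w. frame b l w f) = frame b l w (\<lambda>w. frame b k w f)"
      by cases (use HVVH VV comm in auto)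
    then show ?thesis using False by auto
  qed
qed

subsection \<open>Sections and their brackets\<close>

lemma prol_sectionD:
  assumes X: "X \<in> prol_sections E W" and W: "openin (mtop (total E)) W" and w: "w \<in> W"
  shows prol_section_fibre: "X w \<in> prol_fibre E w"
    and Xdual_smooth: "is_bchart E b \<Longrightarrow> w \<in> tdom b \<Longrightarrow> \<alpha> < rk E \<Longrightarrow> smooth_near (total E) w (\<lambda>w. Xdual b \<alpha> (X w))"
    and Vdual_smooth: "is_bchart E b \<Longrightarrow> w \<in> tdom b \<Longrightarrow> \<alpha> < rk E \<Longrightarrow> smooth_near (total E) w (\<lambda>w. Vdual b \<alpha> (X w))"
proof -
  show "X w \<in> prol_fibre E w" using X w by (simp add: prol_sections_def)
  assume b: "is_bchart E b" and wd: "w \<in> tdom b" and \<alpha>: "\<alpha> < rk E"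
  note iff = T.smooth_fun_on_iff[OF openin_Int[OF W dom_open[OF b]]]
  have s: "smooth_fun_on (total E) (W \<inter> tdom b) (\<lambda>w. Xdual b \<alpha> (X w)) \<and> smooth_fun_on (total E) (W \<inter> tdom b) (\<lambda>w. Vdual b \<alpha> (X w))"
    using X b \<alpha> by (simp add: prol_sections_def)
  show "smooth_near (total E) w (\<lambda>w. Xdual b \<alpha> (X w))" "smooth_near (total E) w (\<lambda>w. Vdual b \<alpha> (X w))"
    using s w wd unfolding iff by blast+
qed

lemma prol_sectionI:
  assumes W: "openin (mtop (total E)) W"
    and "\<And>w. w \<in> W \<Longrightarrow> X w \<in> prol_fibre E w"
    and "\<And>b w \<alpha>. is_bchart E b \<Longrightarrow> w \<in> W \<Longrightarrow> w \<in> tdom b \<Longrightarrow> \<alpha> < rk E \<Longrightarrow> smooth_near (total E) w (\<lambda>w. Xdual b \<alpha> (X w))"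
    and "\<And>b w \<alpha>. is_bchart E b \<Longrightarrow> w \<in> W \<Longrightarrow> w \<in> tdom b \<Longrightarrow> \<alpha> < rk E \<Longrightarrow> smooth_near (total E) w (\<lambda>w. Vdual b \<alpha> (X w))"
  shows "X \<in> prol_sections E W"
proof -
  have "smooth_fun_on (total E) (W \<inter> tdom b) (\<lambda>w. Xdual b \<alpha> (X w)) \<and> smooth_fun_on (total E) (W \<inter> tdom b) (\<lambda>w. Vdual b \<alpha> (X w))"
    if b: "is_bchart E b" and "\<alpha> < rk E" for b \<alpha>
    using assms(3,4)[OF b] that(2) unfolding T.smooth_fun_on_iff[OF openin_Int[OF W dom_open[OF b]]] by blast
  then show ?thesis using assms(2) by (simp add: prol_sections_def)
qed

lemma prol_section_subset:
  assumes "X \<in> prol_sections E W" "openin (mtop (total E)) W" "openin (mtop (total E)) W'" "W' \<subseteq> W"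
  shows "X \<in> prol_sections E W'"
  using prol_sectionD[OF assms(1,2)] assms(4) by (intro prol_sectionI[OF assms(3)]) blast+

lemma frame_coord_smooth:
  assumes X: "X \<in> prol_sections E W" and W: "openin (mtop (total E)) W" and w: "w \<in> W"
    and b: "is_bchart E b" "w \<in> tdom b" and k: "k < rk E + rk E"
  shows "smooth_near (total E) w (\<lambda>w. frame_coord b k (X w))"
proof (cases "k < rk E")
  case True then show ?thesis using Xdual_smooth[OF X W w b] by (simp add: frame_coord_def)
next
  case False then show ?thesis using Vdual_smooth[OF X W w b, of "k - rk E"] k by (simp add: frame_coord_def)
qed

lemma act_tangent:
  assumes "X \<in> prol_sections E W" "openin (mtop (total E)) W" "w \<in> W"
  shows "snd (X w) \<in> tangent_space (total E) w"
  using prol_fibreD(2)[OF prol_section_fibre[OF assms]] .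

lemma act_smooth:
  assumes X: "X \<in> prol_sections E W" and W: "openin (mtop (total E)) W" and w: "w \<in> W" and f: "smooth_near (total E) w f"
  shows "smooth_near (total E) w (act X f)"
proof -
  have wm: "w \<in> mpoints (total E)" using W w openin_subset by blast
  obtain b where "is_bchart E b" "proj E w \<in> bdom b" using ex_bchart[OF proj_mpoints[OF wm]] by blast
  then have b: "is_bchart E b" "w \<in> tdom b" using wm by (simp_all add: dom_iff)
  obtain W' where W': "openin (mtop (total E)) W'" "w \<in> W'" "W' \<subseteq> tdom b" "\<forall>q\<in>W'. smooth_near (total E) q f"
    using smooth_near_on_tdom[OF b f] by blast
  have "smooth_near (total E) w (\<lambda>w. \<Sum>k<rk E + rk E. frame_coord b k (X w) * frame b k w f)"
    by (intro T.smooth_near_sum[OF wm] T.smooth_near_mult frame_coord_smooth[OF X W w b] frame_smooth[OF b f]) auto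
  then show ?thesis
  proof (rule T.smooth_near_cong[OF _ openin_Int[OF W W'(1)]])
    show "w \<in> W \<inter> W'" using w W' by blast
    fix q assume q: "q \<in> W \<inter> W'"
    then show "(\<Sum>k<rk E + rk E. frame_coord b k (X q) * frame b k q f) = act X f q"
      using prol_expand[OF b(1) _ prol_section_fibre[OF X W]] W' by (auto simp: act_def)
  qed
qed

definition brk_coeff :: "('a, 'e) bchart \<Rightarrow> ('e \<Rightarrow> 'e prol) \<Rightarrow> ('e \<Rightarrow> 'e prol) \<Rightarrow> 'e \<Rightarrow> nat \<Rightarrow> real" where
  "brk_coeff b X Y w k = act X (\<lambda>w'. frame_coord b k (Y w')) w - act Y (\<lambda>w'. frame_coord b k (X w')) w +
     (if k < rk E then \<Sum>\<alpha><rk E. \<Sum>\<beta><rk E. Xdual b \<alpha> (X w) * Xdual b \<beta> (Y w) * struct_fun E b \<alpha> \<beta> k (proj E w) else 0)"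

text \<open>The bracket formula in an arbitrary chart instead of the chosen one.\<close>

definition brk_in_chart :: "('a, 'e) bchart \<Rightarrow> ('e \<Rightarrow> 'e prol) \<Rightarrow> ('e \<Rightarrow> 'e prol) \<Rightarrow> 'e \<Rightarrow> 'e prol" where
  "brk_in_chart b X Y w = prol_comb E b w (brk_coeff b X Y w) (\<lambda>\<gamma>. brk_coeff b X Y w (rk E + \<gamma>))"

lemma prol_comb_cong:
  assumes "is_bchart E b" "w \<in> tdom b" "\<And>\<alpha>. \<alpha> < rk E \<Longrightarrow> a \<alpha> = a' \<alpha>" "\<And>\<alpha>. \<alpha> < rk E \<Longrightarrow> c \<alpha> = c' \<alpha>"
  shows "prol_comb E b w a c = prol_comb E b w a' c'"
  by (rule prol_eqI[OF assms(1,2) prol_comb_fibre[OF assms(1,2)] prol_comb_fibre[OF assms(1,2)]])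
     (use assms in \<open>simp_all add: Xdual_comb Vdual_comb\<close>)

lemma prol_brk_chart_at:
  assumes w: "w \<in> mpoints (total E)"
  shows "prol_brk E X Y w = brk_in_chart (bchart_at E (proj E w)) X Y w"
proof -
  have b: "is_bchart E (bchart_at E (proj E w))" "w \<in> tdom (bchart_at E (proj E w))"
    using bchart_at[OF proj_mpoints[OF w]] w by (simp_all add: dom_iff)
  show ?thesis unfolding prol_brk_def Let_def brk_in_chart_def
    by (rule prol_comb_cong[OF b]) (simp_all add: brk_coeff_def frame_coord_def)
qed

lemma frame_coord_comb: "is_bchart E b \<Longrightarrow> w \<in> tdom b \<Longrightarrow> k < rk E + rk E \<Longrightarrow>
    frame_coord b k (prol_comb E b w a c) = (if k < rk E then a k else c (k - rk E))"
  by (auto simp: frame_coord_def Xdual_comb Vdual_comb)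

lemma frame_coord_brk_in_chart: "is_bchart E b \<Longrightarrow> w \<in> tdom b \<Longrightarrow> k < rk E + rk E \<Longrightarrow>
    frame_coord b k (brk_in_chart b X Y w) = brk_coeff b X Y w k"
  by (simp add: brk_in_chart_def frame_coord_comb)

lemma act_act:
  assumes X: "X \<in> prol_sections E W" and Y: "Y \<in> prol_sections E W"
    and W: "openin (mtop (total E)) W" and w: "w \<in> W"
    and b: "is_bchart E b" "w \<in> tdom b" and f: "smooth_near (total E) w f"
  shows "act X (act Y f) w = (\<Sum>k<rk E + rk E. act X (\<lambda>w. frame_coord b k (Y w)) w * frame b k w f) +
    (\<Sum>k<rk E + rk E. \<Sum>l<rk E + rk E. frame_coord b l (X w) * frame_coord b k (Y w) * frame b l w (\<lambda>w. frame b k w f))"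
proof -
  have wm: "w \<in> mpoints (total E)" using W w openin_subset by blast
  note v = act_tangent[OF X W w]
  obtain W' where W': "openin (mtop (total E)) W'" "w \<in> W'" "W' \<subseteq> tdom b" "\<forall>q\<in>W'. smooth_near (total E) q f"
    using smooth_near_on_tdom[OF b f] by blast
  have s: "smooth_near (total E) w (\<lambda>w. frame_coord b k (Y w))" "smooth_near (total E) w (\<lambda>w. frame b k w f)" if "k < rk E + rk E" for k
    using frame_coord_smooth[OF Y W w b that] frame_smooth[OF b f that] .
  have "act X (act Y f) w = snd (X w) (\<lambda>w. \<Sum>k<rk E + rk E. frame_coord b k (Y w) * frame b k w f)"
    unfolding act_def
  proof (rule T.tangent_cong[OF v openin_Int[OF W W'(1)]])
    show "w \<in> W \<inter> W'" using w W' by blast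
    fix q assume q: "q \<in> W \<inter> W'"
    then show "snd (Y q) f = (\<Sum>k<rk E + rk E. frame_coord b k (Y q) * frame b k q f)"
      using prol_expand[OF b(1) _ prol_section_fibre[OF Y W]] W' by auto
  qed
  also have "\<dots> = (\<Sum>k<rk E + rk E. snd (X w) (\<lambda>w. frame_coord b k (Y w) * frame b k w f))"
    by (rule T.tangent_sum[OF v _ wm]) (use s T.smooth_near_mult in auto)
  also have "\<dots> = (\<Sum>k<rk E + rk E. act X (\<lambda>w. frame_coord b k (Y w)) w * frame b k w f + frame_coord b k (Y w) * snd (X w) (\<lambda>w. frame b k w f))"
    by (rule sum.cong) (use T.tangent_mult[OF v s] in \<open>auto simp: act_def\<close>)
  also have "\<dots> = (\<Sum>k<rk E + rk E. act X (\<lambda>w. frame_coord b k (Y w)) w * frame b k w f +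
      (\<Sum>l<rk E + rk E. frame_coord b l (X w) * frame_coord b k (Y w) * frame b l w (\<lambda>w. frame b k w f)))"
    by (rule sum.cong)
       (use prol_expand[OF b prol_section_fibre[OF X W w] s(2)] in \<open>auto simp: sum_distrib_left ac_simps\<close>)
  finally show ?thesis by (simp add: sum.distrib)
qed

text \<open>Expand both derivations in the frame.  The derivatives of the components give the first two terms of
  the bracket coefficients; the rest combines to commutators of the frame.\<close>

lemma act_brk_in_chart:
  assumes X: "X \<in> prol_sections E W" and Y: "Y \<in> prol_sections E W"
    and W: "openin (mtop (total E)) W" and w: "w \<in> W"
    and b: "is_bchart E b" "w \<in> tdom b" and f: "smooth_near (total E) w f"
  shows "snd (brk_in_chart b X Y w) f = act X (act Y f) w - act Y (act X f) w"
proof -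
  let ?K = "rk E + rk E" and ?F = "\<lambda>k l. frame b k w (\<lambda>w. frame b l w f)"
  have "(\<Sum>k<?K. \<Sum>l<?K. frame_coord b l (Y w) * frame_coord b k (X w) * ?F l k) = (\<Sum>k<?K. \<Sum>l<?K. frame_coord b l (X w) * frame_coord b k (Y w) * ?F k l)"
    by (subst sum.swap) (simp add: ac_simps)
  then have "act X (act Y f) w - act Y (act X f) w =
    (\<Sum>k<?K. (act X (\<lambda>w. frame_coord b k (Y w)) w - act Y (\<lambda>w. frame_coord b k (X w)) w) * frame b k w f) +
    (\<Sum>k<?K. \<Sum>l<?K. frame_coord b l (X w) * frame_coord b k (Y w) * (?F l k - ?F k l))"
    by (simp add: act_act[OF X Y W w b f] act_act[OF Y X W w b f] sum_subtractf left_diff_distrib right_diff_distrib)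
  also have "(\<Sum>k<?K. \<Sum>l<?K. frame_coord b l (X w) * frame_coord b k (Y w) * (?F l k - ?F k l)) =
    (\<Sum>k<?K. \<Sum>l<?K. frame_coord b l (X w) * frame_coord b k (Y w) *
      (if l < rk E \<and> k < rk E then \<Sum>\<gamma><rk E. struct_fun E b l k \<gamma> (proj E w) * frame b \<gamma> w f else 0))"
    by (intro sum.cong refl) (simp add: frame_commutator[OF b f])
  also have "\<dots> = (\<Sum>k<rk E. \<Sum>l<rk E. \<Sum>\<gamma><rk E. Xdual b l (X w) * Xdual b k (Y w) * struct_fun E b l k \<gamma> (proj E w) * frame b \<gamma> w f)"
    by (simp add: sum_lessThan_add frame_coord_def sum_distrib_left mult.assoc)
  also have "\<dots> = (\<Sum>l<rk E. \<Sum>k<rk E. \<Sum>\<gamma><rk E. Xdual b l (X w) * Xdual b k (Y w) * struct_fun E b l k \<gamma> (proj E w) * frame b \<gamma> w f)"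
    by (rule sum.swap)
  also have "\<dots> = (\<Sum>l<rk E. \<Sum>\<gamma><rk E. \<Sum>k<rk E. Xdual b l (X w) * Xdual b k (Y w) * struct_fun E b l k \<gamma> (proj E w) * frame b \<gamma> w f)"
    by (intro sum.cong refl sum.swap)
  also have "\<dots> = (\<Sum>\<gamma><rk E. \<Sum>l<rk E. \<Sum>k<rk E. Xdual b l (X w) * Xdual b k (Y w) * struct_fun E b l k \<gamma> (proj E w) * frame b \<gamma> w f)"
    by (rule sum.swap)
  also have "(\<Sum>k<?K. (act X (\<lambda>w. frame_coord b k (Y w)) w - act Y (\<lambda>w. frame_coord b k (X w)) w) * frame b k w f) + \<dots> =
    (\<Sum>k<?K. brk_coeff b X Y w k * frame b k w f)"
    by (simp add: sum_lessThan_add brk_coeff_def distrib_right sum.distrib sum_distrib_right)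
  also have "\<dots> = snd (brk_in_chart b X Y w) f"
    using prol_expand[OF b prol_comb_fibre[OF b] f, of "brk_coeff b X Y w" "\<lambda>\<gamma>. brk_coeff b X Y w (rk E + \<gamma>)"]
      frame_coord_brk_in_chart[OF b] unfolding brk_in_chart_def by simp
  finally show ?thesis ..
qed

lemma Xdual_change:
  assumes b: "is_bchart E b" "w \<in> tdom b" and b': "is_bchart E b'" "w \<in> tdom b'" and z: "z \<in> prol_fibre E w"
  shows "Xdual b' \<gamma> z = (\<Sum>\<kappa><rk E. Xdual b \<kappa> z * bfib b' (basis_section E b \<kappa> (proj E w)) \<gamma>)"
  unfolding Xdual_def
  by (rule bfib_change[OF b(1) _ b'(1) _ prol_fibreD(1)[OF z]]) (use b b' in \<open>simp_all add: dom_iff\<close>)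

text \<open>The components in the new chart are those in the old one times the transition matrix, whose
  derivative along \<open>X\<close> accounts for the second sum.\<close>

lemma act_Xdual_change:
  assumes X: "X \<in> prol_sections E W" and Y: "Y \<in> prol_sections E W"
    and W: "openin (mtop (total E)) W" and w: "w \<in> W"
    and b: "is_bchart E b" "w \<in> tdom b" and b': "is_bchart E b'" "w \<in> tdom b'"
  shows "act X (\<lambda>w. Xdual b' \<gamma> (Y w)) w =
    (\<Sum>\<kappa><rk E. act X (\<lambda>w. Xdual b \<kappa> (Y w)) w * bfib b' (basis_section E b \<kappa> (proj E w)) \<gamma>) +
    (\<Sum>\<mu><rk E. \<Sum>\<nu><rk E. Xdual b \<mu> (X w) * Xdual b \<nu> (Y w) *
       anchor E (basis_section E b \<mu> (proj E w)) (\<lambda>q. bfib b' (basis_section E b \<nu> q) \<gamma>))"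
proof -
  note wb = tdomD[OF b(2)] and wb' = tdomD(2)[OF b'(2)]
  let ?A = "\<lambda>\<kappa> q. bfib b' (basis_section E b \<kappa> q) \<gamma>"
  note v = act_tangent[OF X W w]
  have sA: "smooth_near (base E) (proj E w) (?A \<kappa>)" for \<kappa> by (rule smooth_near_transition[OF b(1) wb(2) b'(1) wb'])
  have s: "smooth_near (total E) w (\<lambda>w. Xdual b \<kappa> (Y w))" "smooth_near (total E) w (\<lambda>w. ?A \<kappa> (proj E w))" if "\<kappa> < rk E" for \<kappa>
    using Xdual_smooth[OF Y W w b that] smooth_near_proj[OF wb(1) sA] .
  have XA: "snd (X w) (\<lambda>w. ?A \<kappa> (proj E w)) = (\<Sum>\<mu><rk E. Xdual b \<mu> (X w) * anchor E (basis_section E b \<mu> (proj E w)) (?A \<kappa>))" for \<kappa>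
    using prol_fibre_proj[OF prol_section_fibre[OF X W w] sA] anchor_expand[OF b(1) wb(2) prol_fibreD(1)[OF prol_section_fibre[OF X W w]]]
    by (simp add: Xdual_def)
  have "act X (\<lambda>w. Xdual b' \<gamma> (Y w)) w = snd (X w) (\<lambda>w. \<Sum>\<kappa><rk E. Xdual b \<kappa> (Y w) * ?A \<kappa> (proj E w))"
    unfolding act_def
  proof (rule T.tangent_cong[OF v openin_Int[OF W openin_Int[OF dom_open[OF b(1)] dom_open[OF b'(1)]]]])
    show "w \<in> W \<inter> (tdom b \<inter> tdom b')" using w b b' by blast
    fix q assume "q \<in> W \<inter> (tdom b \<inter> tdom b')"
    then have q: "q \<in> W" "q \<in> tdom b" "q \<in> tdom b'" by auto
    show "Xdual b' \<gamma> (Y q) = (\<Sum>\<kappa><rk E. Xdual b \<kappa> (Y q) * ?A \<kappa> (proj E q))"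
      by (rule Xdual_change[OF b(1) q(2) b'(1) q(3) prol_section_fibre[OF Y W q(1)]])
  qed
  also have "\<dots> = (\<Sum>\<kappa><rk E. snd (X w) (\<lambda>w. Xdual b \<kappa> (Y w) * ?A \<kappa> (proj E w)))"
    by (rule T.tangent_sum[OF v _ wb(1)]) (use s T.smooth_near_mult in auto)
  also have "\<dots> = (\<Sum>\<kappa><rk E. act X (\<lambda>w. Xdual b \<kappa> (Y w)) w * ?A \<kappa> (proj E w) + Xdual b \<kappa> (Y w) * snd (X w) (\<lambda>w. ?A \<kappa> (proj E w)))"
    by (rule sum.cong) (use T.tangent_mult[OF v s] in \<open>auto simp: act_def\<close>)
  also have "\<dots> = (\<Sum>\<kappa><rk E. act X (\<lambda>w. Xdual b \<kappa> (Y w)) w * ?A \<kappa> (proj E w)) +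
      (\<Sum>\<kappa><rk E. \<Sum>\<mu><rk E. Xdual b \<mu> (X w) * Xdual b \<kappa> (Y w) * anchor E (basis_section E b \<mu> (proj E w)) (?A \<kappa>))"
    by (simp add: XA sum.distrib sum_distrib_left ac_simps)
  also have "(\<Sum>\<kappa><rk E. \<Sum>\<mu><rk E. Xdual b \<mu> (X w) * Xdual b \<kappa> (Y w) * anchor E (basis_section E b \<mu> (proj E w)) (?A \<kappa>)) =
      (\<Sum>\<mu><rk E. \<Sum>\<kappa><rk E. Xdual b \<mu> (X w) * Xdual b \<kappa> (Y w) * anchor E (basis_section E b \<mu> (proj E w)) (?A \<kappa>))"
    by (rule sum.swap)
  finally show ?thesis .
qed

text \<open>The vertical part of the bracket is determined by its anchor, a commutator of derivations; the
  horizontal part transforms correctly by the transformation law of the structure functions.\<close>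

lemma brk_chart_independent:
  assumes X: "X \<in> prol_sections E W" and Y: "Y \<in> prol_sections E W"
    and W: "openin (mtop (total E)) W" and w: "w \<in> W"
    and b: "is_bchart E b" "w \<in> tdom b" and b': "is_bchart E b'" "w \<in> tdom b'"
  shows "brk_in_chart b X Y w = brk_in_chart b' X Y w"
proof (rule prod_eqI)
  note wb = tdomD[OF b(2)] and wb' = tdomD(2)[OF b'(2)]
  have F: "brk_in_chart b X Y w \<in> prol_fibre E w" if "is_bchart E b" "w \<in> tdom b" for b
    using prol_comb_fibre[OF that] by (simp add: brk_in_chart_def)
  show "snd (brk_in_chart b X Y w) = snd (brk_in_chart b' X Y w)"
  proof
    fix f show "snd (brk_in_chart b X Y w) f = snd (brk_in_chart b' X Y w) f"
      using act_brk_in_chart[OF X Y W w b, of f] act_brk_in_chart[OF X Y W w b', of f]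
        T.tangent_nonsmooth[OF prol_fibreD(2)[OF F[OF b]], of f] T.tangent_nonsmooth[OF prol_fibreD(2)[OF F[OF b']], of f]
      by (cases "smooth_near (total E) w f") simp_all
  qed
  show "fst (brk_in_chart b X Y w) = fst (brk_in_chart b' X Y w)"
  proof (rule bfib_inj[OF b'(1) wb' prol_fibreD(1)[OF F[OF b]] prol_fibreD(1)[OF F[OF b']]])
    fix \<gamma> assume \<gamma>: "\<gamma> < rk E"
    let ?p = "proj E w" and ?x = "\<lambda>\<mu>. Xdual b \<mu> (X w)" and ?y = "\<lambda>\<mu>. Xdual b \<mu> (Y w)"
    let ?A = "\<lambda>\<gamma> \<kappa> q. bfib b' (basis_section E b \<kappa> q) \<gamma>"
    let ?a = "\<lambda>\<mu> \<nu>. anchor E (basis_section E b \<mu> ?p) (?A \<gamma> \<nu>)"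
    let ?D = "\<lambda>\<kappa>. act X (\<lambda>w. Xdual b \<kappa> (Y w)) w - act Y (\<lambda>w. Xdual b \<kappa> (X w)) w"
    have fX: "X w \<in> prol_fibre E w" "Y w \<in> prol_fibre E w" using prol_section_fibre[OF X W w] prol_section_fibre[OF Y W w] .
    have "(\<Sum>\<alpha><rk E. \<Sum>\<beta><rk E. Xdual b' \<alpha> (X w) * Xdual b' \<beta> (Y w) * struct_fun E b' \<alpha> \<beta> \<gamma> ?p) =
      (\<Sum>\<alpha><rk E. \<Sum>\<beta><rk E. \<Sum>\<mu><rk E. \<Sum>\<nu><rk E. ?x \<mu> * ?y \<nu> * (?A \<alpha> \<mu> ?p * ?A \<beta> \<nu> ?p * struct_fun E b' \<alpha> \<beta> \<gamma> ?p))"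
      by (simp only: Xdual_change[OF b b' fX(1)] Xdual_change[OF b b' fX(2)] sum_product sum_distrib_right)
         (simp add: sum_distrib_left ac_simps)
    also have "\<dots> = (\<Sum>\<alpha><rk E. \<Sum>\<mu><rk E. \<Sum>\<beta><rk E. \<Sum>\<nu><rk E. ?x \<mu> * ?y \<nu> * (?A \<alpha> \<mu> ?p * ?A \<beta> \<nu> ?p * struct_fun E b' \<alpha> \<beta> \<gamma> ?p))"
      by (intro sum.cong refl sum.swap)
    also have "\<dots> = (\<Sum>\<mu><rk E. \<Sum>\<alpha><rk E. \<Sum>\<nu><rk E. \<Sum>\<beta><rk E. ?x \<mu> * ?y \<nu> * (?A \<alpha> \<mu> ?p * ?A \<beta> \<nu> ?p * struct_fun E b' \<alpha> \<beta> \<gamma> ?p))"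
      by (subst sum.swap) (intro sum.cong refl sum.swap)
    also have "\<dots> = (\<Sum>\<mu><rk E. \<Sum>\<nu><rk E. \<Sum>\<alpha><rk E. \<Sum>\<beta><rk E. ?x \<mu> * ?y \<nu> * (?A \<alpha> \<mu> ?p * ?A \<beta> \<nu> ?p * struct_fun E b' \<alpha> \<beta> \<gamma> ?p))"
      by (intro sum.cong refl sum.swap)
    also have "\<dots> = (\<Sum>\<mu><rk E. \<Sum>\<nu><rk E. ?x \<mu> * ?y \<nu> * (\<Sum>\<alpha><rk E. \<Sum>\<beta><rk E. ?A \<alpha> \<mu> ?p * ?A \<beta> \<nu> ?p * struct_fun E b' \<alpha> \<beta> \<gamma> ?p))"
      by (simp add: sum_distrib_left)
    also have "\<dots> = (\<Sum>\<mu><rk E. \<Sum>\<nu><rk E. ?x \<mu> * ?y \<nu> * ((\<Sum>\<kappa><rk E. struct_fun E b \<mu> \<nu> \<kappa> ?p * ?A \<gamma> \<kappa> ?p) - ?a \<mu> \<nu> + ?a \<nu> \<mu>))"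
      by (intro sum.cong refl) (simp add: struct_fun_change[OF b(1) wb(2) b'(1) wb' \<gamma>])
    also have "\<dots> = (\<Sum>\<mu><rk E. \<Sum>\<nu><rk E. \<Sum>\<kappa><rk E. ?x \<mu> * ?y \<nu> * struct_fun E b \<mu> \<nu> \<kappa> ?p * ?A \<gamma> \<kappa> ?p)
       - (\<Sum>\<mu><rk E. \<Sum>\<nu><rk E. ?x \<mu> * ?y \<nu> * ?a \<mu> \<nu>) + (\<Sum>\<mu><rk E. \<Sum>\<nu><rk E. ?x \<mu> * ?y \<nu> * ?a \<nu> \<mu>)"
      by (simp add: distrib_left right_diff_distrib sum.distrib sum_subtractf sum_distrib_left mult.assoc)
    also have "(\<Sum>\<mu><rk E. \<Sum>\<nu><rk E. ?x \<mu> * ?y \<nu> * ?a \<nu> \<mu>) = (\<Sum>\<mu><rk E. \<Sum>\<nu><rk E. ?y \<mu> * ?x \<nu> * ?a \<mu> \<nu>)"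
      by (subst sum.swap) (simp add: ac_simps)
    also have "(\<Sum>\<mu><rk E. \<Sum>\<nu><rk E. \<Sum>\<kappa><rk E. ?x \<mu> * ?y \<nu> * struct_fun E b \<mu> \<nu> \<kappa> ?p * ?A \<gamma> \<kappa> ?p) =
       (\<Sum>\<mu><rk E. \<Sum>\<kappa><rk E. \<Sum>\<nu><rk E. ?x \<mu> * ?y \<nu> * struct_fun E b \<mu> \<nu> \<kappa> ?p * ?A \<gamma> \<kappa> ?p)"
      by (intro sum.cong refl sum.swap)
    also have "\<dots> = (\<Sum>\<kappa><rk E. \<Sum>\<mu><rk E. \<Sum>\<nu><rk E. ?x \<mu> * ?y \<nu> * struct_fun E b \<mu> \<nu> \<kappa> ?p * ?A \<gamma> \<kappa> ?p)"
      by (rule sum.swap)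
    finally have L: "(\<Sum>\<alpha><rk E. \<Sum>\<beta><rk E. Xdual b' \<alpha> (X w) * Xdual b' \<beta> (Y w) * struct_fun E b' \<alpha> \<beta> \<gamma> ?p) = \<dots>
       - (\<Sum>\<mu><rk E. \<Sum>\<nu><rk E. ?x \<mu> * ?y \<nu> * ?a \<mu> \<nu>) + (\<Sum>\<mu><rk E. \<Sum>\<nu><rk E. ?y \<mu> * ?x \<nu> * ?a \<mu> \<nu>)" .
    have "bfib b' (fst (brk_in_chart b' X Y w)) \<gamma> = brk_coeff b' X Y w \<gamma>"
      using Xdual_comb[OF b' \<gamma>] by (simp add: brk_in_chart_def Xdual_def)
    also have "\<dots> = (\<Sum>\<kappa><rk E. ?D \<kappa> * ?A \<gamma> \<kappa> ?p) + (\<Sum>\<kappa><rk E. \<Sum>\<mu><rk E. \<Sum>\<nu><rk E. ?x \<mu> * ?y \<nu> * struct_fun E b \<mu> \<nu> \<kappa> ?p * ?A \<gamma> \<kappa> ?p)"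
      using \<gamma> by (simp add: brk_coeff_def frame_coord_def L act_Xdual_change[OF X Y W w b b'] act_Xdual_change[OF Y X W w b b']
          left_diff_distrib sum_subtractf)
    also have "\<dots> = (\<Sum>\<kappa><rk E. brk_coeff b X Y w \<kappa> * ?A \<gamma> \<kappa> ?p)"
      by (simp add: brk_coeff_def frame_coord_def distrib_right sum.distrib sum_distrib_right)
    also have "\<dots> = (\<Sum>\<kappa><rk E. Xdual b \<kappa> (brk_in_chart b X Y w) * ?A \<gamma> \<kappa> ?p)"
      by (simp add: brk_in_chart_def Xdual_comb[OF b])
    also have "\<dots> = bfib b' (fst (brk_in_chart b X Y w)) \<gamma>"
      using Xdual_change[OF b b' F[OF b], of \<gamma>] by (simp add: Xdual_def)
    finally show "bfib b' (fst (brk_in_chart b X Y w)) \<gamma> = bfib b' (fst (brk_in_chart b' X Y w)) \<gamma>" ..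
  qed
qed

lemma prol_brk_in_chart:
  assumes X: "X \<in> prol_sections E W" and Y: "Y \<in> prol_sections E W"
    and W: "openin (mtop (total E)) W" and w: "w \<in> W" and b: "is_bchart E b" "w \<in> tdom b"
  shows "prol_brk E X Y w = brk_in_chart b X Y w"
proof -
  have wm: "w \<in> mpoints (total E)" using W w openin_subset by blast
  then have b': "is_bchart E (bchart_at E (proj E w))" "w \<in> tdom (bchart_at E (proj E w))"
    using bchart_at[OF proj_mpoints[OF wm]] by (simp_all add: dom_iff)
  show ?thesis unfolding prol_brk_chart_at[OF wm] by (rule brk_chart_independent[OF X Y W w b' b])
qed

lemma brk_coeff_smooth:
  assumes X: "X \<in> prol_sections E W" and Y: "Y \<in> prol_sections E W"
    and W: "openin (mtop (total E)) W" and w: "w \<in> W" and b: "is_bchart E b" "w \<in> tdom b" and k: "k < rk E + rk E"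
  shows "smooth_near (total E) w (\<lambda>w. brk_coeff b X Y w k)"
proof -
  note wb = tdomD[OF b(2)]
  have "smooth_near (total E) w (\<lambda>w. act X (\<lambda>w'. frame_coord b k (Y w')) w - act Y (\<lambda>w'. frame_coord b k (X w')) w)"
    by (intro T.smooth_near_diff act_smooth[OF X W w] act_smooth[OF Y W w] frame_coord_smooth[OF X W w b k] frame_coord_smooth[OF Y W w b k])
  moreover have "smooth_near (total E) w (\<lambda>w. if k < rk E then \<Sum>\<alpha><rk E. \<Sum>\<beta><rk E.
      Xdual b \<alpha> (X w) * Xdual b \<beta> (Y w) * struct_fun E b \<alpha> \<beta> k (proj E w) else 0)"
  proof (cases "k < rk E")
    case True
    have "smooth_near (total E) w (\<lambda>w. \<Sum>\<alpha><rk E. \<Sum>\<beta><rk E. Xdual b \<alpha> (X w) * Xdual b \<beta> (Y w) * struct_fun E b \<alpha> \<beta> k (proj E w))"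
      by (intro T.smooth_near_sum[OF wb(1)] T.smooth_near_mult Xdual_smooth[OF X W w b] Xdual_smooth[OF Y W w b]
          smooth_near_proj[OF wb(1)] struct_fun_smooth[OF b(1) wb(2) True]) auto
    then show ?thesis using True by simp
  qed (simp add: T.smooth_near_const[OF wb(1)])
  ultimately show ?thesis unfolding brk_coeff_def by (rule T.smooth_near_add)
qed

lemma prol_brk_section:
  assumes X: "X \<in> prol_sections E W" and Y: "Y \<in> prol_sections E W" and W: "openin (mtop (total E)) W"
  shows "prol_brk E X Y \<in> prol_sections E W"
proof (rule prol_sectionI[OF W])
  fix w assume w: "w \<in> W"
  have wm: "w \<in> mpoints (total E)" using W w openin_subset by blast
  have b': "is_bchart E (bchart_at E (proj E w))" "w \<in> tdom (bchart_at E (proj E w))"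
    using bchart_at[OF proj_mpoints[OF wm]] wm by (simp_all add: dom_iff)
  show "prol_brk E X Y w \<in> prol_fibre E w"
    unfolding prol_brk_chart_at[OF wm] brk_in_chart_def by (rule prol_comb_fibre[OF b'])
next
  fix b w \<alpha> assume b: "is_bchart E b" and w: "w \<in> W" "w \<in> tdom b" and \<alpha>: "\<alpha> < rk E"
  have c: "smooth_near (total E) w (\<lambda>w. frame_coord b k (prol_brk E X Y w))" if k: "k < rk E + rk E" for k
    by (rule T.smooth_near_cong[OF brk_coeff_smooth[OF X Y W w(1) b w(2) k] openin_Int[OF W dom_open[OF b]]])
       (use w prol_brk_in_chart[OF X Y W _ b] frame_coord_brk_in_chart[OF b _ k] in auto)
  show "smooth_near (total E) w (\<lambda>w. Xdual b \<alpha> (prol_brk E X Y w))" using c[of \<alpha>] \<alpha> by (simp add: frame_coord_def)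
  show "smooth_near (total E) w (\<lambda>w. Vdual b \<alpha> (prol_brk E X Y w))" using c[of "rk E + \<alpha>"] \<alpha> by (simp add: frame_coord_def)
qed

lemma act_prol_brk:
  assumes X: "X \<in> prol_sections E W" and Y: "Y \<in> prol_sections E W"
    and W: "openin (mtop (total E)) W" and w: "w \<in> W" and f: "smooth_near (total E) w f"
  shows "act (prol_brk E X Y) f w = act X (act Y f) w - act Y (act X f) w"
proof -
  have wm: "w \<in> mpoints (total E)" using W w openin_subset by blast
  have b: "is_bchart E (bchart_at E (proj E w))" "w \<in> tdom (bchart_at E (proj E w))"
    using bchart_at[OF proj_mpoints[OF wm]] wm by (simp_all add: dom_iff)
  show ?thesis
    using act_brk_in_chart[OF X Y W w b f] by (simp add: act_def prol_brk_chart_at[OF wm])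
qed

lemma brk_coeff_antisym:
  assumes b: "is_bchart E b" "w \<in> tdom b"
  shows "brk_coeff b X Y w k = - brk_coeff b Y X w k"
proof -
  have p: "proj E w \<in> bdom b" using tdomD[OF b(2)] by blast
  have "(\<Sum>\<alpha><rk E. \<Sum>\<beta><rk E. Xdual b \<alpha> (X w) * Xdual b \<beta> (Y w) * struct_fun E b \<alpha> \<beta> k (proj E w)) =
    (\<Sum>\<beta><rk E. \<Sum>\<alpha><rk E. Xdual b \<alpha> (X w) * Xdual b \<beta> (Y w) * struct_fun E b \<alpha> \<beta> k (proj E w))" by (rule sum.swap)
  also have "\<dots> = (\<Sum>\<beta><rk E. \<Sum>\<alpha><rk E. - (Xdual b \<beta> (Y w) * Xdual b \<alpha> (X w) * struct_fun E b \<beta> \<alpha> k (proj E w)))"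
    by (intro sum.cong refl) (subst struct_fun_antisym[OF b(1) p], simp)
  finally show ?thesis by (simp add: brk_coeff_def sum_negf)
qed

end

section \<open>The Cartan forms\<close>

context algebroid begin

lemma ex_bchart_total: "w \<in> mpoints (total E) \<Longrightarrow> \<exists>b. is_bchart E b \<and> w \<in> tdom b"
  using ex_bchart[OF proj_mpoints] by (auto simp: dom_iff)

lemma prol_zero_comb:
  assumes b: "is_bchart E b" "w \<in> tdom b"
  shows "prol_zero E w = prol_comb E b w (\<lambda>_. 0) (\<lambda>_. 0)"
proof -
  note wb = tdomD[OF b(2)]
  note own = in_own_fibre[OF wb(1)]
  have "lincomb_at E b (proj E w) (\<lambda>_. 0) = fzero_of E w"
    unfolding fzero_of_def
    by (rule lincomb_eqI[OF b(1) wb(2) fscale_fibre[OF proj_mpoints[OF wb(1)] own]]) (simp add: bfib_fscale[OF b(1) wb(2) own])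
  moreover have "prol_coeff b w (\<lambda>_. 0) (\<lambda>_. 0) = (\<lambda>_. 0)" by (simp add: prol_coeff_def fun_eq_iff)
  ultimately show ?thesis by (simp add: prol_zero_def prol_comb_eq tvec_def fun_eq_iff)
qed

lemma Vdual_expand:
  assumes b: "is_bchart E b" "w \<in> tdom b" and b': "is_bchart E b'" "w \<in> tdom b'" and z: "z \<in> prol_fibre E w"
  shows "Vdual b' \<alpha> z = (\<Sum>k<rk E + rk E. frame_coord b k z * frame b k w (\<lambda>w. bfib b' w \<alpha>))"
  unfolding Vdual_def by (rule prol_expand[OF b z smooth_near_bfib[OF b']])

text \<open>Constant components in a chart, multiplied by a cutoff function, make any vector of the prolongation a
  value of a global section.\<close>

lemma global_prol_section:
  assumes b: "is_bchart E b" "w \<in> tdom b"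
  shows "\<exists>Z\<in>prol_sections E (mpoints (total E)). Z w = prol_comb E b w a c"
proof -
  obtain \<psi> W1 V2 where \<psi>: "\<forall>q\<in>mpoints (total E). smooth_near (total E) q \<psi>"
    "w \<in> W1" "\<forall>q\<in>W1. \<psi> q = 1"
    "openin (mtop (total E)) V2" "V2 \<union> tdom b = mpoints (total E)" "\<forall>q\<in>V2. \<psi> q = 0"
    using T.cutoff[OF dom_open[OF b(1)] b(2)] by (elim exE conjE)
  define Z where "Z q = (if q \<in> tdom b then prol_comb E b q (\<lambda>\<alpha>. \<psi> q * a \<alpha>) (\<lambda>\<alpha>. \<psi> q * c \<alpha>)
    else prol_zero E q)" for q
  have Zf: "Z q \<in> prol_fibre E q" if q: "q \<in> mpoints (total E)" for q
  proof -
    obtain b' where b': "is_bchart E b'" "q \<in> tdom b'" using ex_bchart_total[OF q] by blast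
    show ?thesis
      using prol_comb_fibre[OF b(1)] prol_comb_fibre[OF b'] by (simp add: Z_def prol_zero_comb[OF b'])
  qed
  have Z0: "Z q = prol_zero E q" if q: "q \<in> V2" for q
  proof (cases "q \<in> tdom b")
    case True
    have "\<psi> q = 0" using \<psi>(6) q by blast
    then show ?thesis by (simp add: Z_def True prol_zero_comb[OF b(1) True])
  qed (simp add: Z_def)
  have s: "smooth_near (total E) q (\<lambda>q. frame_coord b' k (Z q))"
    if b': "is_bchart E b'" "q \<in> tdom b'" and k: "k < rk E + rk E" for b' q k
  proof -
    have q: "q \<in> mpoints (total E)" using b'(2) tdomD by blast
    have \<psi>q: "smooth_near (total E) q \<psi>" using \<psi>(1) q by blast
    consider "q \<in> V2" | "q \<in> tdom b" using q \<psi>(5) by blast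
    then show ?thesis
    proof cases
      case 1
      show ?thesis
      proof (rule T.smooth_near_cong[OF T.smooth_near_const[OF q, of 0] openin_Int[OF \<psi>(4) dom_open[OF b'(1)]]])
        fix r assume "r \<in> V2 \<inter> tdom b'"
        then show "0 = frame_coord b' k (Z r)" using Z0 by (simp add: prol_zero_comb[OF b'(1)] frame_coord_comb[OF b'(1) _ k])
      qed (use 1 b' in blast)
    next
      case 2
      note qb = tdomD[OF 2] and qb' = tdomD(2)[OF b'(2)]
      let ?k = "\<lambda>l. if l < rk E then a l else c (l - rk E)"
      have comps: "frame_coord b l (Z r) = \<psi> r * ?k l" if "r \<in> tdom b" "l < rk E + rk E" for l r
        using that by (simp add: Z_def frame_coord_comb[OF b(1)])
      have o: "openin (mtop (total E)) (tdom b \<inter> tdom b')" using dom_open b(1) b'(1) by blast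
      show ?thesis
      proof (cases "k < rk E")
        case True
        have "smooth_near (total E) q (\<lambda>q. \<Sum>\<kappa><rk E. \<psi> q * a \<kappa> * bfib b' (basis_section E b \<kappa> (proj E q)) k)"
          by (intro T.smooth_near_sum[OF q] T.smooth_near_mult \<psi>q T.smooth_near_const[OF q]
              smooth_near_proj[OF q] smooth_near_transition[OF b(1) qb(2) b'(1) qb'])
        then show ?thesis
        proof (rule T.smooth_near_cong[OF _ o])
          fix r assume r: "r \<in> tdom b \<inter> tdom b'"
          then have "Z r \<in> prol_fibre E r" using Zf tdomD by blast
          then have "frame_coord b' k (Z r) = (\<Sum>\<kappa><rk E. frame_coord b \<kappa> (Z r) * bfib b' (basis_section E b \<kappa> (proj E r)) k)"
            using Xdual_change[OF b(1) _ b'(1), of r "Z r" k] r True by (simp add: frame_coord_def)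
          then show "(\<Sum>\<kappa><rk E. \<psi> r * a \<kappa> * bfib b' (basis_section E b \<kappa> (proj E r)) k) = frame_coord b' k (Z r)"
            using r by (simp add: comps)
        qed (use 2 b' in blast)
      next
        case False
        have "smooth_near (total E) q (\<lambda>q. \<Sum>l<rk E + rk E. \<psi> q * ?k l * frame b l q (\<lambda>w. bfib b' w (k - rk E)))"
          by (intro T.smooth_near_sum[OF q] T.smooth_near_mult \<psi>q T.smooth_near_const[OF q]
              frame_smooth[OF b(1) 2 smooth_near_bfib[OF b']]) simp
        then show ?thesis
        proof (rule T.smooth_near_cong[OF _ o])
          fix r assume r: "r \<in> tdom b \<inter> tdom b'"
          then have "Z r \<in> prol_fibre E r" using Zf tdomD by blast
          then have "frame_coord b' k (Z r) = (\<Sum>l<rk E + rk E. frame_coord b l (Z r) * frame b l r (\<lambda>w. bfib b' w (k - rk E)))"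
            using Vdual_expand[OF b(1) _ b'(1), of r "Z r" "k - rk E"] r False by (simp add: frame_coord_def[of b'])
          then show "(\<Sum>l<rk E + rk E. \<psi> r * ?k l * frame b l r (\<lambda>w. bfib b' w (k - rk E))) = frame_coord b' k (Z r)"
            using r by (simp add: comps)
        qed (use 2 b' in blast)
      qed
    qed
  qed
  have "Z \<in> prol_sections E (mpoints (total E))"
  proof (rule prol_sectionI[OF openin_topspace Zf])
    fix b' q \<alpha> assume b': "is_bchart E b'" "q \<in> tdom b'" and \<alpha>: "\<alpha> < rk E"
    show "smooth_near (total E) q (\<lambda>q. Xdual b' \<alpha> (Z q))" using s[OF b', of \<alpha>] \<alpha> by (simp add: frame_coord_def)
    show "smooth_near (total E) q (\<lambda>q. Vdual b' \<alpha> (Z q))" using s[OF b', of "rk E + \<alpha>"] \<alpha> by (simp add: frame_coord_def)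
  qed
  moreover have "Z w = prol_comb E b w a c" using \<psi>(2,3) b by (simp add: Z_def)
  ultimately show ?thesis by blast
qed

text \<open>The vertical derivatives transform like a frame of the fibres, which makes the Cartan 1-section and
  the Euler section independent of the chart.\<close>

lemma frame_vertical_bfib:
  assumes b: "is_bchart E b" "w \<in> tdom b" and b': "is_bchart E b'" "w \<in> tdom b'" and \<alpha>: "\<alpha> < rk E"
  shows "frame b (rk E + \<alpha>) w (\<lambda>w. bfib b' w \<beta>) = bfib b' (basis_section E b \<alpha> (proj E w)) \<beta>"
proof -
  note wb = tdomD[OF b(2)] and wb' = tdomD(2)[OF b'(2)]
  let ?v = "frame b (rk E + \<alpha>) w" and ?A = "\<lambda>\<kappa> q. bfib b' (basis_section E b \<kappa> q) \<beta>"
  note v = frame_tangent[OF b, of "rk E + \<alpha>"]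
  have sA: "smooth_near (base E) (proj E w) (?A \<kappa>)" for \<kappa> by (rule smooth_near_transition[OF b(1) wb(2) b'(1) wb'])
  have s: "smooth_near (total E) w (\<lambda>w. bfib b w \<kappa>)" "smooth_near (total E) w (\<lambda>w. ?A \<kappa> (proj E w))" for \<kappa>
    using smooth_near_bfib[OF b] smooth_near_proj[OF wb(1) sA] .
  have vb: "?v (\<lambda>w. bfib b w \<kappa>) = unit_coeff \<alpha> \<kappa>" if "\<kappa> < rk E" for \<kappa>
    using Vdual_comb[OF b that, of "\<lambda>_. 0" "unit_coeff \<alpha>"] by (simp add: frame_def Vdual_def)
  have "?v (\<lambda>w. bfib b' w \<beta>) = ?v (\<lambda>w. \<Sum>\<kappa><rk E. bfib b w \<kappa> * ?A \<kappa> (proj E w))"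
  proof (rule T.tangent_cong[OF v openin_Int[OF dom_open[OF b(1)] dom_open[OF b'(1)]]])
    fix q assume "q \<in> tdom b \<inter> tdom b'"
    then have "q \<in> mpoints (total E)" "proj E q \<in> bdom b" "proj E q \<in> bdom b'" using tdomD by blast+
    then show "bfib b' q \<beta> = (\<Sum>\<kappa><rk E. bfib b q \<kappa> * ?A \<kappa> (proj E q))"
      by (intro bfib_change[OF b(1) _ b'(1)] in_own_fibre)
  qed (use b b' in blast)
  also have "\<dots> = (\<Sum>\<kappa><rk E. ?v (\<lambda>w. bfib b w \<kappa> * ?A \<kappa> (proj E w)))"
    by (rule T.tangent_sum[OF v _ wb(1)]) (use s T.smooth_near_mult in auto)
  also have "\<dots> = (\<Sum>\<kappa><rk E. unit_coeff \<alpha> \<kappa> * ?A \<kappa> (proj E w))"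
    by (rule sum.cong) (use T.tangent_mult[OF v s] vb frame_proj(2)[OF b sA \<alpha>] in auto)
  finally show ?thesis by (simp add: sum_unit_coeff[OF \<alpha>])
qed

lemma dy_change:
  assumes b: "is_bchart E b" "w \<in> tdom b" and b': "is_bchart E b'" "w \<in> tdom b'"
    and \<alpha>: "\<alpha> < rk E" and f: "smooth_near (total E) w f"
  shows "dy E b \<alpha> f w = (\<Sum>\<beta><rk E. bfib b' (basis_section E b \<alpha> (proj E w)) \<beta> * dy E b' \<beta> f w)"
proof -
  let ?z = "prol_comb E b w (\<lambda>_. 0) (unit_coeff \<alpha>)"
  have z: "?z \<in> prol_fibre E w" by (rule prol_comb_fibre[OF b])
  have fr: "frame b (rk E + \<alpha>) w = snd ?z" by (simp add: frame_def)
  have X: "Xdual b' \<beta> ?z = 0" for \<beta>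
    by (simp add: Xdual_change[OF b b' z] Xdual_comb[OF b])
  have V: "Vdual b' \<beta> ?z = bfib b' (basis_section E b \<alpha> (proj E w)) \<beta>" for \<beta>
    using frame_vertical_bfib[OF b b' \<alpha>] by (simp add: fr Vdual_def)
  have "dy E b \<alpha> f w = snd ?z f" using frame_vertical[OF f \<alpha>, of b] by (simp add: fr)
  also have "\<dots> = (\<Sum>\<beta><rk E. bfib b' (basis_section E b \<alpha> (proj E w)) \<beta> * dy E b' \<beta> f w)"
    by (simp add: prol_expand[OF b' z f] sum_lessThan_add frame_coord_def X V frame_vertical[OF f])
  finally show ?thesis .
qed

lemma dy_contract_chart_independent:
  assumes b: "is_bchart E b" "w \<in> tdom b" and b': "is_bchart E b'" "w \<in> tdom b'"
    and u: "u \<in> fibre E (proj E w)" and f: "smooth_near (total E) w f"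
  shows "(\<Sum>\<alpha><rk E. dy E b \<alpha> f w * bfib b u \<alpha>) = (\<Sum>\<alpha><rk E. dy E b' \<alpha> f w * bfib b' u \<alpha>)"
proof -
  note wb = tdomD(2)[OF b(2)] and wb' = tdomD(2)[OF b'(2)]
  have "(\<Sum>\<alpha><rk E. dy E b \<alpha> f w * bfib b u \<alpha>) =
      (\<Sum>\<alpha><rk E. \<Sum>\<beta><rk E. dy E b' \<beta> f w * (bfib b u \<alpha> * bfib b' (basis_section E b \<alpha> (proj E w)) \<beta>))"
    by (simp add: dy_change[OF b b' _ f] sum_distrib_right sum_distrib_left ac_simps)
  also have "\<dots> = (\<Sum>\<beta><rk E. \<Sum>\<alpha><rk E. dy E b' \<beta> f w * (bfib b u \<alpha> * bfib b' (basis_section E b \<alpha> (proj E w)) \<beta>))"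
    by (rule sum.swap)
  also have "\<dots> = (\<Sum>\<beta><rk E. dy E b' \<beta> f w * bfib b' u \<beta>)"
    by (simp add: bfib_change[OF b(1) wb b'(1) wb' u] sum_distrib_left)
  finally show ?thesis .
qed

end

locale lagrangian = algebroid E for E :: "('a, 'e, 'z) algebroid_scheme" +
  fixes L :: "'e \<Rightarrow> real"
  assumes regular: "regular_lagrangian E L"
begin

lemma L_smooth: "w \<in> mpoints (total E) \<Longrightarrow> smooth_near (total E) w L"
  using regular T.smooth_fun_on_iff[OF openin_topspace] by (auto simp: regular_lagrangian_def)

lemma momentum_smooth:
  assumes "is_bchart E b" "w \<in> tdom b" "\<alpha> < rk E"
  shows "smooth_near (total E) w (dy E b \<alpha> L)"
  using dy_smooth[OF assms(1,2) L_smooth assms(3)] tdomD[OF assms(2)] by blast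

lemma cartan1_in_chart:
  assumes b: "is_bchart E b" "w \<in> tdom b" and A: "A w \<in> prol_fibre E w"
  shows "cartan1 E L A w = (\<Sum>\<alpha><rk E. dy E b \<alpha> L w * Xdual b \<alpha> (A w))"
proof -
  have wm: "w \<in> mpoints (total E)" using tdomD[OF b(2)] by blast
  have b': "is_bchart E (bchart_at E (proj E w))" "w \<in> tdom (bchart_at E (proj E w))"
    using bchart_at[OF proj_mpoints[OF wm]] wm by (simp_all add: dom_iff)
  show ?thesis
    using dy_contract_chart_independent[OF b' b prol_fibreD(1)[OF A] L_smooth[OF wm]]
    by (simp add: cartan1_def Let_def Xdual_def)
qed

lemma cartan1_brk:
  assumes A: "A \<in> prol_sections E W" and B: "B \<in> prol_sections E W"
    and W: "openin (mtop (total E)) W" and w: "w \<in> W" and b: "is_bchart E b" "w \<in> tdom b"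
  shows "cartan1 E L (prol_brk E A B) w = (\<Sum>\<gamma><rk E. dy E b \<gamma> L w * brk_coeff b A B w \<gamma>)"
proof -
  have "prol_brk E A B w \<in> prol_fibre E w"
    by (rule prol_section_fibre[OF prol_brk_section[OF A B W] W w])
  then have "cartan1 E L (prol_brk E A B) w = (\<Sum>\<gamma><rk E. dy E b \<gamma> L w * Xdual b \<gamma> (prol_brk E A B w))"
    by (rule cartan1_in_chart[OF b])
  also have "\<dots> = (\<Sum>\<gamma><rk E. dy E b \<gamma> L w * brk_coeff b A B w \<gamma>)"
    by (simp add: prol_brk_in_chart[OF A B W w b] brk_in_chart_def Xdual_comb[OF b])
  finally show ?thesis .
qed

lemma act_euler:
  assumes b: "is_bchart E b" "w \<in> tdom b" and f: "smooth_near (total E) w f"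
  shows "act (euler_section E) f w = (\<Sum>\<alpha><rk E. dy E b \<alpha> f w * bfib b w \<alpha>)"
proof -
  have wm: "w \<in> mpoints (total E)" using tdomD[OF b(2)] by blast
  let ?b = "bchart_at E (proj E w)"
  have b': "is_bchart E ?b" "w \<in> tdom ?b"
    using bchart_at[OF proj_mpoints[OF wm]] wm by (simp_all add: dom_iff)
  have "act (euler_section E) f w = (\<Sum>\<alpha><rk E. dy E ?b \<alpha> f w * bfib ?b w \<alpha>)"
    using prol_expand[OF b' prol_comb_fibre[OF b'] f, of "\<lambda>_. 0" "bfib ?b w"]
    by (simp add: act_def euler_section_def Let_def sum_lessThan_add frame_coord_comb[OF b'] frame_vertical[OF f] mult.commute)
  then show ?thesis
    using dy_contract_chart_independent[OF b' b in_own_fibre[OF wm] f] by simp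
qed

lemma energy_smooth:
  assumes w: "w \<in> mpoints (total E)" shows "smooth_near (total E) w (energy E L)"
proof -
  obtain b where b: "is_bchart E b" "w \<in> tdom b" using ex_bchart_total[OF w] by blast
  have "smooth_near (total E) w (\<lambda>w. (\<Sum>\<alpha><rk E. dy E b \<alpha> L w * bfib b w \<alpha>) - L w)"
    by (intro T.smooth_near_diff T.smooth_near_sum[OF w] T.smooth_near_mult momentum_smooth[OF b] smooth_near_bfib[OF b] L_smooth[OF w]) simp
  then show ?thesis
    by (rule T.smooth_near_cong[OF _ dom_open[OF b(1)] b(2)])
       (use act_euler[OF b(1) _ L_smooth] tdomD in \<open>simp add: energy_def\<close>)
qed

text \<open>The derivatives of the components of \<open>A\<close> and \<open>B\<close> cancel against those in the bracket, so only the values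
  at the point remain.  This is what makes the 2-section a tensor.\<close>

lemma cartan2_in_chart:
  assumes A: "A \<in> prol_sections E W" and B: "B \<in> prol_sections E W"
    and W: "openin (mtop (total E)) W" and w: "w \<in> W" and b: "is_bchart E b" "w \<in> tdom b"
  shows "cartan2 E L A B w =
    (\<Sum>\<alpha><rk E. snd (A w) (dy E b \<alpha> L) * Xdual b \<alpha> (B w)) - (\<Sum>\<alpha><rk E. snd (B w) (dy E b \<alpha> L) * Xdual b \<alpha> (A w)) -
    (\<Sum>\<gamma><rk E. dy E b \<gamma> L w * (\<Sum>\<alpha><rk E. \<Sum>\<beta><rk E. Xdual b \<alpha> (A w) * Xdual b \<beta> (B w) * struct_fun E b \<alpha> \<beta> \<gamma> (proj E w)))"
proof -
  have wm: "w \<in> mpoints (total E)" using tdomD[OF b(2)] by blast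
  have act1: "act A (cartan1 E L B) w = (\<Sum>\<alpha><rk E. snd (A w) (dy E b \<alpha> L) * Xdual b \<alpha> (B w)) +
      (\<Sum>\<alpha><rk E. dy E b \<alpha> L w * act A (\<lambda>w. Xdual b \<alpha> (B w)) w)"
    if A: "A \<in> prol_sections E W" and B: "B \<in> prol_sections E W" for A B
  proof -
    note v = act_tangent[OF A W w]
    have s: "smooth_near (total E) w (dy E b \<alpha> L)" "smooth_near (total E) w (\<lambda>w. Xdual b \<alpha> (B w))" if "\<alpha> < rk E" for \<alpha>
      using momentum_smooth[OF b that] Xdual_smooth[OF B W w b that] .
    have "act A (cartan1 E L B) w = snd (A w) (\<lambda>w. \<Sum>\<alpha><rk E. dy E b \<alpha> L w * Xdual b \<alpha> (B w))"
      unfolding act_def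
      by (rule T.tangent_cong[OF v openin_Int[OF W dom_open[OF b(1)]]])
         (use w b cartan1_in_chart[where A = B, OF b(1)] prol_section_fibre[OF B W] in auto)
    also have "\<dots> = (\<Sum>\<alpha><rk E. snd (A w) (\<lambda>w. dy E b \<alpha> L w * Xdual b \<alpha> (B w)))"
      by (rule T.tangent_sum[OF v _ wm]) (use s T.smooth_near_mult in auto)
    also have "\<dots> = (\<Sum>\<alpha><rk E. snd (A w) (dy E b \<alpha> L) * Xdual b \<alpha> (B w) + dy E b \<alpha> L w * act A (\<lambda>w. Xdual b \<alpha> (B w)) w)"
      by (rule sum.cong) (use T.tangent_mult[OF v s] in \<open>auto simp: act_def\<close>)
    finally show ?thesis by (simp add: sum.distrib)
  qed
  have "cartan1 E L (prol_brk E A B) w = (\<Sum>\<gamma><rk E. dy E b \<gamma> L w * brk_coeff b A B w \<gamma>)"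
    by (rule cartan1_brk[OF A B W w b])
  also have "\<dots> = (\<Sum>\<gamma><rk E. dy E b \<gamma> L w * act A (\<lambda>w. Xdual b \<gamma> (B w)) w) -
      (\<Sum>\<gamma><rk E. dy E b \<gamma> L w * act B (\<lambda>w. Xdual b \<gamma> (A w)) w) +
      (\<Sum>\<gamma><rk E. dy E b \<gamma> L w * (\<Sum>\<alpha><rk E. \<Sum>\<beta><rk E. Xdual b \<alpha> (A w) * Xdual b \<beta> (B w) * struct_fun E b \<alpha> \<beta> \<gamma> (proj E w)))"
    by (simp add: brk_coeff_def frame_coord_def distrib_left right_diff_distrib sum.distrib sum_subtractf)
  finally show ?thesis
    by (simp add: cartan2_def d1_def act1[OF A B] act1[OF B A])
qed

lemma cartan2_pointwise:
  assumes "A \<in> prol_sections E W" "B \<in> prol_sections E W" "openin (mtop (total E)) W" "w \<in> W"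
    and "A \<in> prol_sections E W'" "B' \<in> prol_sections E W'" "openin (mtop (total E)) W'" "w \<in> W'"
    and "B w = B' w"
  shows "cartan2 E L A B w = cartan2 E L A B' w"
proof -
  have "w \<in> mpoints (total E)" using assms(3,4) openin_subset by blast
  then obtain b where b: "is_bchart E b" "w \<in> tdom b" using ex_bchart_total by blast
  show ?thesis
    unfolding cartan2_in_chart[OF assms(1-4) b] cartan2_in_chart[OF assms(5-8) b] assms(9) ..
qed

lemma cartan1_brk_antisym:
  assumes A: "A \<in> prol_sections E W" and B: "B \<in> prol_sections E W"
    and W: "openin (mtop (total E)) W" and w: "w \<in> W"
  shows "cartan1 E L (prol_brk E A B) w = - cartan1 E L (prol_brk E B A) w"
proof -
  have "w \<in> mpoints (total E)" using W w openin_subset by blast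
  then obtain b where b: "is_bchart E b" "w \<in> tdom b" using ex_bchart_total by blast
  show ?thesis
    unfolding cartan1_brk[OF A B W w b] cartan1_brk[OF B A W w b]
    by (subst brk_coeff_antisym[OF b]) (simp add: sum_negf)
qed

lemma cartan2_antisym:
  assumes "A \<in> prol_sections E W" "B \<in> prol_sections E W" "openin (mtop (total E)) W" "w \<in> W"
  shows "cartan2 E L A B w = - cartan2 E L B A w"
  using cartan1_brk_antisym[OF assms] by (simp add: cartan2_def d1_def)

text \<open>Full rank of the Hessian makes its determinant nonzero, and hence its kernel trivial.\<close>

lemma hessian_kernel:
  assumes b: "is_bchart E b" "w \<in> tdom b"
    and x: "\<And>\<beta>. \<beta> < rk E \<Longrightarrow> (\<Sum>\<alpha><rk E. dy E b \<beta> (dy E b \<alpha> L) w * x \<alpha>) = 0" and \<alpha>: "\<alpha> < rk E"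
  shows "x \<alpha> = 0"
proof -
  let ?H = "hessian_mat E b L w" and ?x = "Matrix.vec (rk E) x"
  have H: "?H \<in> carrier_mat (rk E) (rk E)" by (simp add: hessian_mat_def)
  have "vec_space.rank (rk E) ?H = rk E" using regular b by (simp add: regular_lagrangian_def)
  then have det: "Determinant.det ?H \<noteq> 0" using vec_space.det_rank_iff[OF H] by simp
  have "?H *\<^sub>v ?x = 0\<^sub>v (rk E)"
  proof (rule eq_vecI)
    fix \<beta> assume "\<beta> < dim_vec (0\<^sub>v (rk E) :: real Matrix.vec)"
    then have \<beta>: "\<beta> < rk E" by simp
    then have "vec_index (?H *\<^sub>v ?x) \<beta> = (\<Sum>\<alpha><rk E. dy E b \<beta> (dy E b \<alpha> L) w * x \<alpha>)"
      by (simp add: hessian_mat_def scalar_prod_def lessThan_atLeast0)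
    then show "vec_index (?H *\<^sub>v ?x) \<beta> = vec_index (0\<^sub>v (rk E)) \<beta>" using x[OF \<beta>] \<beta> by simp
  qed (simp add: hessian_mat_def)
  then have xz: "?x = 0\<^sub>v (rk E)"
    using det det_0_iff_vec_prod_zero_field[OF H] by (metis vec_carrier)
  have "vec_index ?x \<alpha> = vec_index (0\<^sub>v (rk E)) \<alpha>" by (simp only: xz)
  then show ?thesis using \<alpha> by simp
qed

lemma hessian_symmetric:
  assumes b: "is_bchart E b" "w \<in> tdom b" and "\<alpha> < rk E" "\<beta> < rk E"
  shows "dy E b \<alpha> (dy E b \<beta> L) w = dy E b \<beta> (dy E b \<alpha> L) w"
  using T.coord_deriv_commute[OF total_chart[OF b(1)] b(2) L_smooth] tdomD[OF b(2)] assms(3,4)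
  by (simp add: dy_def mdim_total)

text \<open>Nondegeneracy: testing with vertical vectors kills the horizontal components through the Hessian,
  after which testing with horizontal vectors kills the vertical components in the same way.\<close>

lemma cartan2_nondegenerate:
  assumes A: "A \<in> prol_sections E W" and W: "openin (mtop (total E)) W" and w: "w \<in> W"
    and b: "is_bchart E b" "w \<in> tdom b"
    and zero: "\<And>Z. Z \<in> prol_sections E (mpoints (total E)) \<Longrightarrow> cartan2 E L A Z w = 0"
    and k: "k < rk E + rk E"
  shows "frame_coord b k (A w) = 0"
proof -
  have wm: "w \<in> mpoints (total E)" using tdomD[OF b(2)] by blast
  have formula: "(\<Sum>\<alpha><rk E. snd (A w) (dy E b \<alpha> L) * a \<alpha>) -
      (\<Sum>\<alpha><rk E. snd (prol_comb E b w a c) (dy E b \<alpha> L) * Xdual b \<alpha> (A w)) -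
    (\<Sum>\<gamma><rk E. dy E b \<gamma> L w * (\<Sum>\<alpha><rk E. \<Sum>\<beta><rk E. Xdual b \<alpha> (A w) * a \<beta> * struct_fun E b \<alpha> \<beta> \<gamma> (proj E w))) = 0" for a c
  proof -
    obtain Z where Z: "Z \<in> prol_sections E (mpoints (total E))" "Z w = prol_comb E b w a c"
      using global_prol_section[OF b] by blast
    have ZW: "Z \<in> prol_sections E W"
      by (rule prol_section_subset[OF Z(1) openin_topspace W openin_subset[OF W]])
    show ?thesis
      using zero[OF Z(1)] by (simp add: cartan2_in_chart[OF A ZW W w b] Z(2) Xdual_comb[OF b])
  qed
  have X0: "Xdual b \<alpha> (A w) = 0" if "\<alpha> < rk E" for \<alpha>
  proof (rule hessian_kernel[OF b _ that])
    fix \<beta> assume \<beta>: "\<beta> < rk E"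
    have "snd (prol_comb E b w (\<lambda>_. 0) (unit_coeff \<beta>)) (dy E b \<alpha> L) = dy E b \<beta> (dy E b \<alpha> L) w" if "\<alpha> < rk E" for \<alpha>
      using frame_vertical[OF momentum_smooth[OF b that] \<beta>, of b] by (simp add: frame_def)
    then show "(\<Sum>\<alpha><rk E. dy E b \<beta> (dy E b \<alpha> L) w * Xdual b \<alpha> (A w)) = 0"
      using formula[of "\<lambda>_. 0" "unit_coeff \<beta>"] by simp
  qed
  have V0: "Vdual b \<alpha> (A w) = 0" if "\<alpha> < rk E" for \<alpha>
  proof (rule hessian_kernel[OF b _ that])
    fix \<beta> assume \<beta>: "\<beta> < rk E"
    have "(\<Sum>\<alpha><rk E. unit_coeff \<beta> \<alpha> * snd (A w) (dy E b \<alpha> L)) = 0"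
      using formula[of "unit_coeff \<beta>" "\<lambda>_. 0"] by (simp add: X0 mult.commute)
    then have "snd (A w) (dy E b \<beta> L) = 0" by (simp add: sum_unit_coeff[OF \<beta>])
    then show "(\<Sum>\<alpha><rk E. dy E b \<beta> (dy E b \<alpha> L) w * Vdual b \<alpha> (A w)) = 0"
      using prol_expand[OF b prol_section_fibre[OF A W w] momentum_smooth[OF b \<beta>]] hessian_symmetric[OF b \<beta>]
      by (simp add: sum_lessThan_add frame_coord_def X0 frame_vertical[OF momentum_smooth[OF b \<beta>]] mult.commute)
  qed
  show ?thesis using X0 V0 k by (simp add: frame_coord_def)
qed

section \<open>Cartan symmetries\<close>

text \<open>The Leibniz form of the Lie derivative: the terms \<open>Y(\<omega>(X,Z))\<close>, \<open>Z(\<omega>(X,Y))\<close> and \<open>\<omega>(X,[Y,Z])\<close> occur in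
  \<open>i\<^sub>X d \<omega>\<close> and in \<open>d i\<^sub>X \<omega>\<close> with opposite signs.\<close>

lemma lie_derivative_cartan2:
  assumes X: "X \<in> prol_sections E W" and Y: "Y \<in> prol_sections E W" and Z: "Z \<in> prol_sections E W"
    and W: "openin (mtop (total E)) W" and w: "w \<in> W"
  shows "lie2 E X (cartan2 E L) Y Z w = act X (cartan2 E L Y Z) w -
    cartan2 E L (prol_brk E X Y) Z w - cartan2 E L Y (prol_brk E X Z) w"
  using cartan2_antisym[OF prol_brk_section[OF X Z W] Y W w] cartan2_antisym[OF prol_brk_section[OF Y Z W] X W w]
  by (simp add: lie2_def d2_def d1_def)

text \<open>Both sides only depend on the value of \<open>Y\<close> at the point, so the equation extends from global to local
  sections.\<close>

lemma canonical_semispray_energy: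
  assumes S: "canonical_semispray E L S" and Y: "Y \<in> prol_sections E W"
    and W: "openin (mtop (total E)) W" and w: "w \<in> W"
  shows "cartan2 E L S Y w = - act Y (energy E L) w"
proof -
  have Ss: "S \<in> prol_sections E (mpoints (total E))" using S by (simp add: canonical_semispray_def)
  have wm: "w \<in> mpoints (total E)" using W w openin_subset by blast
  then obtain b where b: "is_bchart E b" "w \<in> tdom b" using ex_bchart_total by blast
  obtain Y' where Y': "Y' \<in> prol_sections E (mpoints (total E))" "Y' w = Y w"
    using global_prol_section[OF b] prol_fibre_comb[OF b prol_section_fibre[OF Y W w]] by metis
  have "cartan2 E L S Y w = cartan2 E L S Y' w"
    by (rule cartan2_pointwise[OF prol_section_subset[OF Ss openin_topspace W openin_subset[OF W]] Y W w
          Ss Y'(1) openin_topspace wm Y'(2)[symmetric]])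
  also have "\<dots> = - act Y' (energy E L) w" using S Y'(1) wm by (simp add: canonical_semispray_def d0_def)
  finally show ?thesis by (simp add: act_def Y'(2))
qed

text \<open>The heart of the proof: \<open>\<L>\<^sub>X \<omega> = 0\<close> on the pair \<open>(S, Z)\<close>, where the terms that only involve the energy
  cancel because \<open>X\<close> preserves it.\<close>

lemma cartan_symmetry_bracket:
  assumes S: "canonical_semispray E L S" and X: "X \<in> prol_sections E (slit E)" and sym: "cartan_symmetry E L X"
    and Z: "Z \<in> prol_sections E (mpoints (total E))" and w: "w \<in> slit E"
  shows "cartan2 E L (prol_brk E X S) Z w = 0"
proof -
  note W = slit_open
  have sub: "Y \<in> prol_sections E (slit E)" if "Y \<in> prol_sections E (mpoints (total E))" for Y
    by (rule prol_section_subset[OF that openin_topspace W openin_subset[OF W]])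
  have S': "S \<in> prol_sections E (slit E)" using S sub by (simp add: canonical_semispray_def)
  have Z': "Z \<in> prol_sections E (slit E)" using sub[OF Z] .
  have wm: "q \<in> mpoints (total E)" if "q \<in> slit E" for q using that by (simp add: slit_def)
  have E_smooth: "smooth_near (total E) w (energy E L)" by (rule energy_smooth[OF wm[OF w]])
  have XE: "act X (energy E L) q = 0" if "q \<in> slit E" for q
    using sym that by (simp add: cartan_symmetry_def lie0_def d0_def)
  have "act Z (act X (energy E L)) w = act Z (\<lambda>_. 0) w"
    unfolding act_def[of Z] by (rule T.tangent_cong[OF act_tangent[OF Z' W w] W w]) (rule XE)
  then have ZXE: "act Z (act X (energy E L)) w = 0"
    using T.tangent_const[OF act_tangent[OF Z' W w]] by (simp add: act_def)
  have "act X (cartan2 E L S Z) w = act X (\<lambda>q. - act Z (energy E L) q) w"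
    unfolding act_def[of X]
    by (rule T.tangent_cong[OF act_tangent[OF X W w] W w]) (rule canonical_semispray_energy[OF S Z' W])
  also have "\<dots> = - act X (act Z (energy E L)) w"
    unfolding act_def[of X]
    by (rule T.tangent_minus[OF act_tangent[OF X W w] act_smooth[OF Z' W w E_smooth]])
  finally have 1: "act X (cartan2 E L S Z) w = - act X (act Z (energy E L)) w" .
  have 2: "cartan2 E L S (prol_brk E X Z) w = - act X (act Z (energy E L)) w"
    using canonical_semispray_energy[OF S prol_brk_section[OF X Z' W] W w] act_prol_brk[OF X Z' W w E_smooth] ZXE by simp
  have "lie2 E X (cartan2 E L) S Z w = 0"
    using sym S' Z' w by (simp add: cartan_symmetry_def)
  then show ?thesis using lie_derivative_cartan2[OF X S' Z' W w] 1 2 by simp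
qed

end

theorem proposition18:
  fixes E :: "('a, 'e) algebroid" and L :: "'e \<Rightarrow> real" and S X :: "'e \<Rightarrow> 'e prol"
  assumes "lie_algebroid E"
    and "regular_lagrangian E L"
    and "canonical_semispray E L S"
    and "X \<in> prol_sections E (slit E)"
    and "cartan_symmetry E L X"
  shows "dynamical_symmetry E S X"
  unfolding dynamical_symmetry_def
proof
  interpret lagrangian E L
    using assms(1,2) by unfold_locales
  fix w assume w: "w \<in> slit E"
  note W = slit_open
  have S: "S \<in> prol_sections E (slit E)"
    using assms(3) prol_section_subset[OF _ openin_topspace W openin_subset[OF W]]
    by (simp add: canonical_semispray_def)
  have "w \<in> mpoints (total E)" using w by (simp add: slit_def)
  then obtain b where b: "is_bchart E b" "w \<in> tdom b" using ex_bchart_total by blast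
  have "brk_coeff b X S w k = 0" if k: "k < rk E + rk E" for k
    using cartan2_nondegenerate[OF prol_brk_section[OF assms(4) S W] W w b
        cartan_symmetry_bracket[OF assms(3,4,5) _ w] k]
    by (simp add: prol_brk_in_chart[OF assms(4) S W w b] frame_coord_brk_in_chart[OF b k])
  then have "brk_coeff b S X w k = 0" if "k < rk E + rk E" for k
    using brk_coeff_antisym[OF b, of S X k] that by simp
  then have "brk_in_chart b S X w = prol_comb E b w (\<lambda>_. 0) (\<lambda>_. 0)"
    unfolding brk_in_chart_def by (intro prol_comb_cong[OF b]) auto
  then show "prol_brk E S X w = prol_zero E w"
    by (simp add: prol_brk_in_chart[OF S assms(4) W w b] prol_zero_comb[OF b])
qed

end
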